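(* Let $E$ be a finite gap set with $g\ge1$ gaps, let $\Delta_E=\Psi+1/\Psi$ where $\Psi$ is the Ahlfors function of $\overline{\mathbb C}\setminus E$, let $\mathbf C=(\mathbf c_1,\dots,\mathbf c_g)$ be a fixed ordering of the finite zeros of $\Psi$, and write $$\Delta_E(z)=\lambda_0z+\mathbf c_0+\sum_{j=1}^g\frac{\lambda_j}{\mathbf c_j-z}.$$ Let $A\in\mathrm{GMP}(\mathbf C)$ be periodic with generating coefficients $\vec p=(p_0,\dots,p_g)$, $\vec q=(q_0,\dots,q_g)$. Then $A\in A(E,\mathbf C)$ if and only if $$p_g=\frac1{\lambda_0},\qquad q_g=-\mathbf c_0-\lambda_0\sum_{j=0}^{g-1}p_jq_j,\qquad \Lambda_k(\vec p,\vec q)=\lambda_k\quad\text{for }k=1,\dots,g.$$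
   Context: **Finite gap set and $\Delta_E$.** $E=[\mathbf b_0,\mathbf a_0]\setminus\bigcup_{j=1}^g(\mathbf a_j,\mathbf b_j)$ with $\mathbf b_0<\mathbf a_1<\mathbf b_1<\dots<\mathbf a_g<\mathbf b_g<\mathbf a_0$ real. The Ahlfors function $\Psi$ of $\overline{\mathbb C}\setminus E$ is the analytic function on $\overline{\mathbb C}\setminus E$ maximizing $|\lim_{z\to\infty}z\Psi(z)|$ among analytic functions vanishing at $\infty$ and bounded by one in modulus, normalized by $\lim_{z\to\infty}z\Psi(z)>0$. $\Delta_E$ is a rational function of the displayed form with all $\lambda_j>0$, exactly one of the points $\mathbf c_1,\dots,\mathbf c_g$ lying in each gap, and $E=\Delta_E^{-1}([-2,2])$. **GMP matrices.** $S$ is the right shift on $\ell^2(\mathbb Z)$, $Se_n=e_{n+1}$. Vectors in $\mathbb R^{g+1}$ are indexed by $0,\dots,g$; $\delta_g$ is the last standard basis vector. For a matrix $T$, $T^-$ is its upper triangular part excluding the main diagonal and $T^+=T-T^-$. For an ordered collection $\mathbf C=(\mathbf c_1,\dots,\mathbf c_g)$ of distinct real points, a bounded operator $A$ on $\ell^2(\mathbb Z)$ is of the class $\mathbb A$ (with respect to $\mathbf C$) if it is a $(g+1)$-block Jacobi matrix (block number $j$ consists of the indices $(g+1)j,\dots,(g+1)j+g$) whose $j$-th block row has the entries $A(\vec p_j)^*$, $B(\vec p_j,\vec q_j)$, $A(\vec p_{j+1})$ in block columns $j-1,j,j+1$ and zeros elsewhere, where $\vec p_j,\vec q_j\in\mathbb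 R^{g+1}$, the last entry of each $\vec p_j$ is positive, and $$A(\vec p)=\delta_g\vec p^{\,*},\qquad B(\vec p,\vec q)=(\vec q\,\vec p^{\,*})^-+(\vec p\,\vec q^{\,*})^++\operatorname{diag}(\mathbf c_1,\dots,\mathbf c_g,0).$$ The $(\vec p_j,\vec q_j)$ are the generating coefficients. $A\in\mathrm{GMP}(\mathbf C)$ if $A$ is of the class $\mathbb A$ with respect to $\mathbf C$, all $\mathbf c_k-A$ ($1\le k\le g$) are invertible, and for each $1\le k\le g$ the operator $S^{-k}(\mathbf c_k-A)^{-1}S^k$ is also of the class $\mathbb A$, with respect to the collection $\big(\tfrac1{\mathbf c_k-\mathbf c_{k+1}},\dots,\tfrac1{\mathbf c_k-\mathbf c_g},0,\tfrac1{\mathbf c_k-\mathbf c_1},\dots,\tfrac1{\mathbf c_k-\mathbf c_{k-1}}\big)$. A GMP matrix is periodic if $(\vec p_j,\vec q_j)=(\vec p,\vec q)$ for all $j\in\mathbb Z$. Finally $A(E,\mathbf C)=\{A\in\mathrm{GMP}(\mathbf C):\ \sigma(A)=E,\ A\text{ periodic}\}$. **The functions $\Lambda_k$.** Put $\mathfrak j=\begin{bmatrix}0&-1\\ 1&0\end{bmatrix}$, $$\mathfrak a(z;p,q)=\begin{bmatrix}0&-p\\ \frac1p&\frac{z-pq}{p}\end{bmatrix},\qquad \mathfrak a(z,\mathbf c;p,q)=I-\frac1{\mathbf c-z}\begin{bmatrix}p\\ q\end{bmatrix}\begin{bmatrix}p&q\end{bmatrix}\mathfrak j.$$ For $1\le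 k\le g$ (products ordered from left to right with increasing index), $$\Lambda_k(\vec p,\vec q)=-\operatorname{tr}\Big\{\prod_{m=0}^{k-2}\mathfrak a(\mathbf c_k,\mathbf c_{m+1};p_m,q_m)\begin{bmatrix}p_{k-1}\\ q_{k-1}\end{bmatrix}\begin{bmatrix}p_{k-1}&q_{k-1}\end{bmatrix}\mathfrak j\prod_{m=k}^{g-1}\mathfrak a(\mathbf c_k,\mathbf c_{m+1};p_m,q_m)\ \mathfrak a(\mathbf c_k;p_g,q_g)\Big\}.$$ Equivalently, $\Lambda_k(\vec p,\vec q)=-\operatorname{Res}_{z=\mathbf c_k}\operatorname{tr}\mathfrak A(z)$ with $\mathfrak A(z)=\mathfrak a(z,\mathbf c_1;p_0,q_0)\cdots\mathfrak a(z,\mathbf c_g;p_{g-1},q_{g-1})\,\mathfrak a(z;p_g,q_g)$. *)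

theory Defs
  imports "HOL-Complex_Analysis.Complex_Analysis"
begin

section \<open>The complex Hilbert space of square-summable two-sided sequences\<close>

lemma ell2_product_summable:
  fixes x y :: "int \<Rightarrow> complex"
  assumes "(\<lambda>n. (cmod (x n))\<^sup>2) summable_on UNIV" "(\<lambda>n. (cmod (y n))\<^sup>2) summable_on UNIV"
  shows "(\<lambda>n. x n \<bullet> y n) summable_on UNIV"
proof -
  have "(\<lambda>n. (cmod (x n))\<^sup>2 + (cmod (y n))\<^sup>2) summable_on UNIV"
    using assms by (rule summable_on_add)
  moreover have "norm (x n \<bullet> y n) \<le> (cmod (x n))\<^sup>2 + (cmod (y n))\<^sup>2" for n
  proof -
    have "\<bar>x n \<bullet> y n\<bar> \<le> cmod (x n) * cmod (y n)" by (rule Cauchy_Schwarz_ineq2)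
    also have "2 * \<dots> \<le> (cmod (x n))\<^sup>2 + (cmod (y n))\<^sup>2"
      using sum_squares_bound[of "cmod (x n)" "cmod (y n)"] by simp
    finally have "2 * \<bar>x n \<bullet> y n\<bar> \<le> (cmod (x n))\<^sup>2 + (cmod (y n))\<^sup>2" by simp
    thus ?thesis
      using abs_ge_zero[of "x n \<bullet> y n"] unfolding real_norm_def by linarith
  qed
  ultimately have "(\<lambda>n. norm (x n \<bullet> y n)) summable_on UNIV"
    by (intro Infinite_Sum.abs_summable_on_comparison_test') auto
  thus ?thesis by (rule Infinite_Sum.abs_summable_summable)
qed

typedef ell2 = "{x :: int \<Rightarrow> complex. (\<lambda>n. (cmod (x n))\<^sup>2) summable_on UNIV}"
  morphisms coord Abs_ell2
  by (rule exI[of _ "\<lambda>_. 0"]) simp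

setup_lifting type_definition_ell2

instantiation ell2 :: real_vector
begin

lift_definition zero_ell2 :: ell2 is "\<lambda>_. 0" by simp

lift_definition plus_ell2 :: "ell2 \<Rightarrow> ell2 \<Rightarrow> ell2" is "\<lambda>x y n. x n + y n"
proof -
  fix x y :: "int \<Rightarrow> complex"
  assume *: "(\<lambda>n. (cmod (x n))\<^sup>2) summable_on UNIV" "(\<lambda>n. (cmod (y n))\<^sup>2) summable_on UNIV"
  have "(\<lambda>n. (cmod (x n))\<^sup>2 + 2 * (x n \<bullet> y n) + (cmod (y n))\<^sup>2) summable_on UNIV"
    by (intro summable_on_add summable_on_cmult_right * ell2_product_summable)
  thus "(\<lambda>n. (cmod (x n + y n))\<^sup>2) summable_on UNIV"
    by (simp add: power2_norm_eq_inner inner_add_left inner_add_right inner_commute algebra_simps)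
qed

lift_definition uminus_ell2 :: "ell2 \<Rightarrow> ell2" is "\<lambda>x n. - x n" by simp

definition minus_ell2 :: "ell2 \<Rightarrow> ell2 \<Rightarrow> ell2" where "minus_ell2 x y = x + - y"

lift_definition scaleR_ell2 :: "real \<Rightarrow> ell2 \<Rightarrow> ell2" is "\<lambda>r x n. r *\<^sub>R x n"
  by (auto simp: power_mult_distrib intro: summable_on_cmult_right)

instance
proof
  fix x y z :: ell2 and r s :: real
  show "x + y + z = x + (y + z)" "x + y = y + x" "0 + x = x" "- x + x = 0"
    by (transfer; simp add: algebra_simps)+
  show "x - y = x + - y" by (simp add: minus_ell2_def)
  show "r *\<^sub>R (x + y) = r *\<^sub>R x + r *\<^sub>R y" "(r + s) *\<^sub>R x = r *\<^sub>R x + s *\<^sub>R x"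
       "r *\<^sub>R s *\<^sub>R x = (r * s) *\<^sub>R x" "1 *\<^sub>R x = x"
    by (transfer; simp add: algebra_simps)+
qed

end

instantiation ell2 :: real_inner
begin

lift_definition inner_ell2 :: "ell2 \<Rightarrow> ell2 \<Rightarrow> real" is "\<lambda>x y. \<Sum>\<^sub>\<infinity>n. x n \<bullet> y n" .

lift_definition norm_ell2 :: "ell2 \<Rightarrow> real" is "\<lambda>x. sqrt (\<Sum>\<^sub>\<infinity>n. (cmod (x n))\<^sup>2)" .

definition sgn_ell2 :: "ell2 \<Rightarrow> ell2" where "sgn_ell2 x = x /\<^sub>R norm x"
definition dist_ell2 :: "ell2 \<Rightarrow> ell2 \<Rightarrow> real" where "dist_ell2 x y = norm (x - y)"
definition uniformity_ell2 :: "(ell2 \<times> ell2) filter"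
  where "uniformity_ell2 = (INF e\<in>{0<..}. principal {(x, y). dist x y < e})"
definition open_ell2 :: "ell2 set \<Rightarrow> bool"
  where "open_ell2 U = (\<forall>x\<in>U. eventually (\<lambda>(x', y). x' = x \<longrightarrow> y \<in> U) uniformity)"

instance
proof
  fix x y z :: ell2 and r s :: real
  show "sgn x = x /\<^sub>R norm x" by (rule sgn_ell2_def)
  show "dist x y = norm (x - y)" by (rule dist_ell2_def)
  show "(uniformity :: (ell2 \<times> ell2) filter) = (INF e\<in>{0<..}. principal {(x, y). dist x y < e})"
    by (rule uniformity_ell2_def)
  show "open U = (\<forall>x\<in>U. eventually (\<lambda>(x', y). x' = x \<longrightarrow> y \<in> U) uniformity)" for U :: "ell2 set"
    by (rule open_ell2_def)
  show "x \<bullet> y = y \<bullet> x" by transfer (simp add: inner_commute)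
  show "(x + y) \<bullet> z = x \<bullet> z + y \<bullet> z"
    by transfer (simp add: inner_add_left infsum_add ell2_product_summable)
  show "r *\<^sub>R x \<bullet> y = r * (x \<bullet> y)"
    by transfer (simp add: infsum_cmult_right')
  show "0 \<le> x \<bullet> x" by transfer (simp add: infsum_nonneg)
  show "x \<bullet> x = 0 \<longleftrightarrow> x = 0"
  proof transfer
    fix x :: "int \<Rightarrow> complex"
    assume *: "(\<lambda>n. (cmod (x n))\<^sup>2) summable_on UNIV"
    show "(\<Sum>\<^sub>\<infinity>n. x n \<bullet> x n) = 0 \<longleftrightarrow> x = (\<lambda>_. 0)"
    proof
      assume "(\<Sum>\<^sub>\<infinity>n. x n \<bullet> x n) = 0"
      hence "x n \<bullet> x n = 0" for n
        using nonneg_infsum_le_0D[of "\<lambda>n. x n \<bullet> x n" UNIV n] ell2_product_summable[OF * *] by simp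
      thus "x = (\<lambda>_. 0)" by auto
    qed simp
  qed
  show "norm x = sqrt (x \<bullet> x)" by transfer (simp add: power2_norm_eq_inner)
qed

end

lift_definition scale_ell2 :: "complex \<Rightarrow> ell2 \<Rightarrow> ell2" is "\<lambda>c x n. c * x n"
  by (auto simp: norm_mult power_mult_distrib intro: summable_on_cmult_right)

lift_definition basis_ell2 :: "int \<Rightarrow> ell2" is "\<lambda>n m. if m = n then 1 else 0"
proof -
  fix n :: int
  have "(\<lambda>m. (cmod (if m = n then 1 else 0))\<^sup>2) summable_on {n}" by simp
  thus "(\<lambda>m. (cmod (if m = n then 1 else 0))\<^sup>2) summable_on UNIV"
    by (rule summable_on_cong_neutral[THEN iffD1, rotated -1]) auto
qed

lift_definition shift_ell2 :: "ell2 \<Rightarrow> ell2" is "\<lambda>x n. x (n - 1)"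
proof -
  fix x :: "int \<Rightarrow> complex"
  assume "(\<lambda>n. (cmod (x n))\<^sup>2) summable_on UNIV"
  moreover have "bij_betw (\<lambda>n::int. n - 1) UNIV UNIV"
    by (rule bij_betwI[of _ _ _ "\<lambda>n. n + 1"]) auto
  ultimately show "(\<lambda>n. (cmod (x (n - 1)))\<^sup>2) summable_on UNIV"
    using summable_on_reindex_bij_betw[of "\<lambda>n. n - 1" UNIV UNIV "\<lambda>n. (cmod (x n))\<^sup>2"] by simp
qed

lemma shift_basis: "shift_ell2 (basis_ell2 n) = basis_ell2 (n + 1)"
  by transfer auto


section \<open>Bounded operators\<close>

text \<open>The type class only provides real scalars, so complex homogeneity is demanded separately.\<close>

definition bounded_op :: "(ell2 \<Rightarrow> ell2) \<Rightarrow> bool" where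
  "bounded_op T \<longleftrightarrow> bounded_linear T \<and> (\<forall>c x. T (scale_ell2 c x) = scale_ell2 c (T x))"

definition invertible_op :: "(ell2 \<Rightarrow> ell2) \<Rightarrow> bool" where
  "invertible_op T \<longleftrightarrow> bounded_op T \<and> (\<exists>R. bounded_op R \<and> R \<circ> T = id \<and> T \<circ> R = id)"

definition spectrum_op :: "(ell2 \<Rightarrow> ell2) \<Rightarrow> complex set" where
  "spectrum_op T = {z. \<not> invertible_op (\<lambda>x. scale_ell2 z x - T x)}"

definition entry_op :: "(ell2 \<Rightarrow> ell2) \<Rightarrow> int \<Rightarrow> int \<Rightarrow> complex" where
  "entry_op T m n = coord (T (basis_ell2 n)) m"


section \<open>Finite gap sets and the Ahlfors function\<close>

text \<open>The outer band edges are \<open>b 0\<close> and \<open>a 0\<close>; the gaps are \<open>(a j, b j)\<close> for \<open>1 \<le> j \<le> g\<close>.\<close>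

definition finite_gap_set :: "nat \<Rightarrow> real set \<Rightarrow> bool" where
  "finite_gap_set g E \<longleftrightarrow> (\<exists>a b :: nat \<Rightarrow> real.
     (\<forall>j<g. b j < a (Suc j)) \<and> (\<forall>j\<in>{1..g}. a j < b j) \<and> b g < a 0 \<and>
     E = {b 0..a 0} - (\<Union>j\<in>{1..g}. {a j<..<b j}))"

text \<open>
  Analyticity at infinity with value zero is expressed in the chart \<open>w = 1 / z\<close>.
  The values of the functions on \<open>E\<close> are irrelevant.
\<close>

definition ahlfors_class :: "real set \<Rightarrow> (complex \<Rightarrow> complex) set" where
  "ahlfors_class E = {f. f holomorphic_on - (of_real ` E) \<and>
     (\<lambda>w. if w = 0 then 0 else f (1 / w)) analytic_on {0} \<and>
     (\<forall>z\<in>- (of_real ` E). cmod (f z) \<le> 1)}"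

definition coeff_inf :: "(complex \<Rightarrow> complex) \<Rightarrow> complex" where
  "coeff_inf f = Lim at_infinity (\<lambda>z. z * f z)"

definition ahlfors_function :: "real set \<Rightarrow> (complex \<Rightarrow> complex) \<Rightarrow> bool" where
  "ahlfors_function E \<Psi> \<longleftrightarrow> \<Psi> \<in> ahlfors_class E \<and>
     (\<forall>f\<in>ahlfors_class E. cmod (coeff_inf f) \<le> cmod (coeff_inf \<Psi>)) \<and>
     coeff_inf \<Psi> \<in> \<real> \<and> 0 < Re (coeff_inf \<Psi>)"

definition Delta :: "(complex \<Rightarrow> complex) \<Rightarrow> complex \<Rightarrow> complex" where
  "Delta \<Psi> z = \<Psi> z + 1 / \<Psi> z"


section \<open>GMP matrices\<close>

text \<open>
  Vectors with entries \<open>0, \<dots>, g\<close> are functions on \<open>nat\<close> of which only these values are used, and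
  \<open>(g + 1) \<times> (g + 1)\<close> matrices likewise. A collection \<open>c\<close> has the entries \<open>c 1, \<dots>, c g\<close>, so that
  the diagonal entry number \<open>r < g\<close> of \<open>diag (c 1, \<dots>, c g, 0)\<close> is \<open>c (r + 1)\<close>.
\<close>

definition upper_part :: "(nat \<Rightarrow> nat \<Rightarrow> real) \<Rightarrow> nat \<Rightarrow> nat \<Rightarrow> real" where
  "upper_part T r s = (if r < s then T r s else 0)"

definition lower_part :: "(nat \<Rightarrow> nat \<Rightarrow> real) \<Rightarrow> nat \<Rightarrow> nat \<Rightarrow> real" where
  "lower_part T r s = T r s - upper_part T r s"

definition blockA :: "nat \<Rightarrow> (nat \<Rightarrow> real) \<Rightarrow> nat \<Rightarrow> nat \<Rightarrow> real" where
  "blockA g p r s = (if r = g then 1 else 0) * p s"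

definition blockB :: "nat \<Rightarrow> (nat \<Rightarrow> real) \<Rightarrow> (nat \<Rightarrow> real) \<Rightarrow> (nat \<Rightarrow> real) \<Rightarrow> nat \<Rightarrow> nat \<Rightarrow> real" where
  "blockB g c p q r s =
     upper_part (\<lambda>r s. q r * p s) r s + lower_part (\<lambda>r s. p r * q s) r s +
     (if r = s \<and> r < g then c (r + 1) else 0)"

definition block_jacobi_entry ::
  "nat \<Rightarrow> (nat \<Rightarrow> real) \<Rightarrow> (int \<Rightarrow> nat \<Rightarrow> real) \<Rightarrow> (int \<Rightarrow> nat \<Rightarrow> real) \<Rightarrow> int \<Rightarrow> int \<Rightarrow> real" where
  "block_jacobi_entry g c P Q m n =
     (let N = int (g + 1);
          j = m div N; r = nat (m mod N);
          i = n div N; s = nat (n mod N)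
      in if i = j - 1 then blockA g (P j) s r
         else if i = j then blockB g c (P j) (Q j) r s
         else if i = j + 1 then blockA g (P (j + 1)) r s
         else 0)"

definition generating_coeffs ::
  "nat \<Rightarrow> (nat \<Rightarrow> real) \<Rightarrow> (int \<Rightarrow> nat \<Rightarrow> real) \<Rightarrow> (int \<Rightarrow> nat \<Rightarrow> real) \<Rightarrow> (ell2 \<Rightarrow> ell2) \<Rightarrow> bool" where
  "generating_coeffs g c P Q A \<longleftrightarrow>
     (\<forall>j. 0 < P j g) \<and> (\<forall>m n. entry_op A m n = of_real (block_jacobi_entry g c P Q m n))"

definition class_A :: "nat \<Rightarrow> (nat \<Rightarrow> real) \<Rightarrow> (ell2 \<Rightarrow> ell2) set" where
  "class_A g c = {A. inj_on c {1..g} \<and> bounded_op A \<and> (\<exists>P Q. generating_coeffs g c P Q A)}"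

text \<open>
  The collection \<open>1/(c\<^sub>k - c\<^sub>k\<^sub>+\<^sub>1), \<dots>, 1/(c\<^sub>k - c\<^sub>g), 0, 1/(c\<^sub>k - c\<^sub>1), \<dots>, 1/(c\<^sub>k - c\<^sub>k\<^sub>-\<^sub>1)\<close>,
  numbered from 1; the entry 0 has number \<open>g - k + 1\<close>.
\<close>

definition resolvent_collection :: "nat \<Rightarrow> (nat \<Rightarrow> real) \<Rightarrow> nat \<Rightarrow> nat \<Rightarrow> real" where
  "resolvent_collection g c k i =
     (if i \<le> g - k then 1 / (c k - c (k + i))
      else if i = g - k + 1 then 0
      else 1 / (c k - c (i - (g - k + 1))))"

definition GMP :: "nat \<Rightarrow> (nat \<Rightarrow> real) \<Rightarrow> (ell2 \<Rightarrow> ell2) set" where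
  "GMP g c = {A. A \<in> class_A g c \<and>
     (\<forall>k\<in>{1..g}. invertible_op (\<lambda>x. c k *\<^sub>R x - A x) \<and>
        (inv shift_ell2 ^^ k) \<circ> inv (\<lambda>x. c k *\<^sub>R x - A x) \<circ> (shift_ell2 ^^ k)
          \<in> class_A g (resolvent_collection g c k))}"

definition periodic_GMP :: "nat \<Rightarrow> (nat \<Rightarrow> real) \<Rightarrow> (ell2 \<Rightarrow> ell2) \<Rightarrow> bool" where
  "periodic_GMP g c A \<longleftrightarrow> A \<in> GMP g c \<and> (\<exists>p q. generating_coeffs g c (\<lambda>_. p) (\<lambda>_. q) A)"

definition isospectral_GMP :: "real set \<Rightarrow> nat \<Rightarrow> (nat \<Rightarrow> real) \<Rightarrow> (ell2 \<Rightarrow> ell2) set" where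
  "isospectral_GMP E g c = {A \<in> GMP g c. spectrum_op A = of_real ` E \<and> periodic_GMP g c A}"


section \<open>The functions \<open>\<Lambda>\<^sub>k\<close>\<close>

definition vec2 :: "real \<Rightarrow> real \<Rightarrow> real^2" where "vec2 x y = vector [x, y]"

definition mat2 :: "real \<Rightarrow> real \<Rightarrow> real \<Rightarrow> real \<Rightarrow> real^2^2" where
  "mat2 x y z w = vector [vec2 x y, vec2 z w]"

definition jmat :: "real^2^2" where "jmat = mat2 0 (-1) 1 0"

definition outer :: "real^2 \<Rightarrow> real^2 \<Rightarrow> real^2^2" where "outer u v = (\<chi> i j. u $ i * v $ j)"

definition pole_matrix :: "real \<Rightarrow> real \<Rightarrow> real^2^2" where
  "pole_matrix p q = outer (vec2 p q) (vec2 p q) ** jmat"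

definition transfer_inf :: "real \<Rightarrow> real \<Rightarrow> real \<Rightarrow> real^2^2" where
  "transfer_inf z p q = mat2 0 (- p) (1 / p) ((z - p * q) / p)"

definition transfer_fin :: "real \<Rightarrow> real \<Rightarrow> real \<Rightarrow> real \<Rightarrow> real^2^2" where
  "transfer_fin z c p q = mat 1 - (1 / (c - z)) *\<^sub>R pole_matrix p q"

definition ordered_prod :: "(real^2^2) list \<Rightarrow> real^2^2" where
  "ordered_prod Ms = foldr (**) Ms (mat 1)"

definition Lambda :: "nat \<Rightarrow> (nat \<Rightarrow> real) \<Rightarrow> nat \<Rightarrow> (nat \<Rightarrow> real) \<Rightarrow> (nat \<Rightarrow> real) \<Rightarrow> real" where
  "Lambda g c k p q = - trace (
     ordered_prod (map (\<lambda>m. transfer_fin (c k) (c (m + 1)) (p m) (q m)) [0..<k - 1]) **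
     pole_matrix (p (k - 1)) (q (k - 1)) **
     ordered_prod (map (\<lambda>m. transfer_fin (c k) (c (m + 1)) (p m) (q m)) [k..<g]) **
     transfer_inf (c k) (p g) (q g))"

end

theory Submission
  imports Defs
begin

text \<open>
  Let \<open>\<AA>(z)\<close> be the product of the transfer matrices over one period of \<open>A\<close>. Expanding the product in
  partial fractions, where the residue at each simple pole is read off from the factors, gives
  (\<open>trace_monodromy\<close>)
  \<open>tr \<AA>(z) = z / p\<^sub>g - q\<^sub>g - (1 / p\<^sub>g) \<Sum> p\<^sub>j q\<^sub>j + \<Sum> \<Lambda>\<^sub>k / (c\<^sub>k - z)\<close>.
  So the three conditions say exactly that \<open>tr \<AA> = \<Delta>\<^sub>E\<close>, and it has to be shown that this is
  equivalent to \<open>\<sigma>(A) = E\<close>.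

  By Floquet theory, a point \<open>z\<close> different from all \<open>c\<^sub>k\<close> lies in the spectrum iff \<open>tr \<AA>(z)\<close> lies in
  \<open>[-2, 2]\<close>. If it does, \<open>\<AA>(z)\<close> has a unimodular eigenvalue, which gives a bounded formal
  eigenvector whose truncations show that \<open>z - A\<close> has no bounded inverse (\<open>periodic_not_invertible\<close>).
  If it does not, the Cayley-Hamilton theorem for \<open>\<AA>(z)\<close> provides bounded operators \<open>D\<close> and \<open>D'\<close>
  with \<open>D (z - A) = (z - A) D' = tr \<AA>(z) - T - 1 / T\<close>, where \<open>T\<close> is the translation by a period, and the
  right-hand side is invertible (\<open>periodic_invertible\<close>). The points \<open>c\<^sub>k\<close> are not in the spectrum by
  the definition of a GMP matrix, and not in \<open>E\<close>, being zeros of \<open>\<Psi>\<close>.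

  It remains to compare \<open>\<Delta>\<^sub>E\<close> and \<open>tr \<AA>\<close>, using that \<open>w + 1 / w\<close> maps the punctured unit disc
  bijectively to the complement of \<open>[-2, 2]\<close>. On the one hand, \<open>\<Delta>\<^sub>E\<close> takes values in
  \<open>[-2, 2]\<close> exactly on \<open>E\<close>: off \<open>E\<close> because \<open>\<bar>\<Psi>\<bar> < 1\<close>, and on \<open>E\<close> because otherwise \<open>\<Psi>\<close> could
  be perturbed to a competitor with a larger leading coefficient (\<open>ahlfors_delta_on_bands\<close>). Hence
  \<open>tr \<AA> = \<Delta>\<^sub>E\<close> implies \<open>\<sigma>(A) = E\<close>. On the other hand, if \<open>\<sigma>(A) = E\<close>, then the solution
  \<open>w\<close> of \<open>w + 1 / w = tr \<AA>\<close> with \<open>\<bar>w\<bar> < 1\<close> competes with \<open>\<Psi>\<close>, its zeros are among those of \<open>\<Psi>\<close>, and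
  its modulus tends to one at \<open>E\<close>. By the maximum principle for \<open>\<Psi> / w\<close> and the extremality of \<open>\<Psi>\<close>,
  \<open>\<Psi> = w\<close> (\<open>ahlfors_eq_joukowski_inv\<close>), so \<open>tr \<AA> = \<Delta>\<^sub>E\<close>, and the coefficients of the partial
  fractions agree.
\<close>

(* The symbol stands for the entries of vectors and matrices only. *)
no_notation fps_nth (infixl "$" 75)

section \<open>Holomorphic functions on the complement of a compact set of reals\<close>

lemma open_compl_real:
  assumes "compact (E :: real set)"
  shows "open (- (complex_of_real ` E))"
proof -
  have "compact (complex_of_real ` E)"
    by (rule compact_continuous_image[OF _ assms]) (intro continuous_intros)
  thus ?thesis by (simp add: compact_imp_closed open_Compl)
qed

lemma eventually_compl_real:
  assumes "compact (E :: real set)"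
  shows "eventually (\<lambda>z. z \<in> - (complex_of_real ` E)) at_infinity"
proof -
  have "compact (complex_of_real ` E)"
    by (rule compact_continuous_image[OF _ assms]) (intro continuous_intros)
  hence "bounded (complex_of_real ` E)" by (rule compact_imp_bounded)
  then obtain B where "\<And>z. z \<in> complex_of_real ` E \<Longrightarrow> norm z \<le> B"
    unfolding bounded_iff by blast
  hence "\<And>z. norm z \<ge> B + 1 \<Longrightarrow> z \<in> - (complex_of_real ` E)" by force
  thus ?thesis by (auto simp: eventually_at_infinity)
qed

text \<open>Both open half planes can be joined through a real point outside the compact set.\<close>

lemma connected_compl_real:
  assumes "compact (E :: real set)"
  shows "connected (- (complex_of_real ` E))"
proof -
  let ?R = "complex_of_real ` (- E)"
  define U where "U = {z. Im z > 0}"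
  define L where "L = {z. Im z < 0}"
  have "Im z \<le> 0 \<Longrightarrow> Im z \<ge> 0 \<Longrightarrow> z = complex_of_real (Re z)" for z
    by (simp add: complex_eq_iff)
  hence eq: "- (complex_of_real ` E) = (U \<union> ?R) \<union> (L \<union> ?R)"
    unfolding U_def L_def by (force simp: not_less)
  have cl: "closure U = {z. Im z \<ge> 0}" "closure L = {z. Im z \<le> 0}"
    using closure_halfspace_gt[of \<i> 0] closure_halfspace_lt[of \<i> 0]
    by (simp_all add: U_def L_def inner_complex_def)
  have "connected U" "connected L"
    unfolding U_def L_def
    by (auto intro!: convex_connected simp: convex_halfspace_Im_gt convex_halfspace_Im_lt)
  have "connected (U \<union> ?R)"
    by (rule connected_intermediate_closure[OF \<open>connected U\<close>]) (auto simp: cl, auto simp: U_def)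
  moreover have "connected (L \<union> ?R)"
    by (rule connected_intermediate_closure[OF \<open>connected L\<close>]) (auto simp: cl, auto simp: L_def)
  moreover have "?R \<noteq> {}"
  proof -
    have "E \<noteq> UNIV" using assms not_compact_UNIV[where 'a=real] by metis
    thus ?thesis by auto
  qed
  ultimately show ?thesis
    unfolding eq by (intro connected_Un[of "U \<union> ?R" "L \<union> ?R"]) blast+
qed

lemma inversion_holomorphic:
  assumes "open U" "f holomorphic_on U" "eventually (\<lambda>z. z \<in> U) at_infinity"
    and "(f \<longlongrightarrow> L) at_infinity"
  obtains r where "r > 0" "(\<lambda>w. if w = 0 then L else f (1 / w)) holomorphic_on ball 0 r"
    "\<And>w. w \<in> ball 0 r \<Longrightarrow> w \<noteq> 0 \<Longrightarrow> 1 / w \<in> U"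
proof -
  from assms(3) obtain B where B: "\<And>z. norm z \<ge> B \<Longrightarrow> z \<in> U"
    by (auto simp: eventually_at_infinity)
  define r where "r = 1 / (\<bar>B\<bar> + 1)"
  have r: "r > 0" by (simp add: r_def)
  have U: "1 / w \<in> U" if "w \<in> ball 0 r" "w \<noteq> 0" for w :: complex
  proof (rule B)
    have "norm w < 1 / (\<bar>B\<bar> + 1)" using that by (simp add: r_def)
    hence "\<bar>B\<bar> + 1 < 1 / norm w" using that by (simp add: field_simps)
    thus "norm (1 / w) \<ge> B" by (simp add: norm_divide)
  qed
  let ?G = "\<lambda>w. if w = 0 then L else f (1 / w)"
  have hol: "?G holomorphic_on (ball 0 r - {0})"
  proof (rule holomorphic_transform[of "\<lambda>w. f (1 / w)"])
    have "(f \<circ> (\<lambda>w. 1 / w)) holomorphic_on (ball 0 r - {0})"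
      by (rule holomorphic_on_compose_gen[OF _ assms(2)]) (auto intro!: holomorphic_intros U)
    thus "(\<lambda>w. f (1 / w)) holomorphic_on (ball 0 r - {0})" by (simp add: o_def)
  qed auto
  have "?G \<midarrow>0\<rightarrow> L"
    by (rule Lim_transform_eventually[of "f \<circ> inverse"])
       (use assms(4) in \<open>auto simp: lim_at_infinity_0 eventually_at_filter inverse_eq_divide\<close>)
  hence "?G holomorphic_on ball 0 r"
    by (intro no_isolated_singularity'[OF _ hol]) (auto intro: tendsto_within_subset)
  thus ?thesis using that r U by blast
qed

text \<open>If the maximum of the modulus is attained at infinity, the function is constant.\<close>

lemma tendsto_max_at_infinity_const:
  assumes "open U" "connected U" "f holomorphic_on U" "eventually (\<lambda>z. z \<in> U) at_infinity"
    and "(f \<longlongrightarrow> L) at_infinity" and le: "\<And>z. z \<in> U \<Longrightarrow> cmod (f z) \<le> cmod L"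
    and "z \<in> U"
  shows "f z = L"
proof -
  obtain r where r: "r > 0" "(\<lambda>w. if w = 0 then L else f (1 / w)) holomorphic_on ball 0 r"
    and rU: "\<And>w. w \<in> ball 0 r \<Longrightarrow> w \<noteq> 0 \<Longrightarrow> 1 / w \<in> U"
    using inversion_holomorphic[OF assms(1,3,4,5)] by metis
  have "(\<lambda>w. if w = 0 then L else f (1 / w)) constant_on ball 0 r"
    by (rule maximum_modulus_principle[OF r(2), of "ball 0 r" 0]) (use r rU le in auto)
  then obtain k where k: "\<And>w. w \<in> ball 0 r \<Longrightarrow> (if w = 0 then L else f (1 / w)) = k"
    by (auto simp: constant_on_def)
  have kL: "k = L" using k[of 0] r by simp
  define w where "w = complex_of_real (r / 2)"
  have w: "w \<in> ball 0 r" "w \<noteq> 0" using r by (auto simp: w_def)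
  have f1: "f (1 / w) = L" using k[OF w(1)] w(2) kL by simp
  have "f constant_on U"
    by (rule maximum_modulus_principle[OF assms(3,1,2,1) order_refl rU[OF w]])
       (use le f1 in auto)
  thus ?thesis using f1 rU[OF w] \<open>z \<in> U\<close> by (metis constant_on_def)
qed

text \<open>
  The maximum principle on a neighbourhood of infinity in the sphere, with the boundary values
  controlled by an upper limit only.
\<close>

lemma maximum_principle_at_infinity:
  assumes U: "open U" "connected U" "U \<noteq> UNIV"
    and f: "f holomorphic_on U" and ev: "eventually (\<lambda>z. z \<in> U) at_infinity"
    and lim: "(f \<longlongrightarrow> L) at_infinity"
    and bd: "\<And>x e. x \<notin> U \<Longrightarrow> e > 0 \<Longrightarrow> eventually (\<lambda>z. z \<in> U \<longrightarrow> cmod (f z) \<le> 1 + e) (nhds x)"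
    and z: "z \<in> U"
  shows "cmod (f z) \<le> 1"
proof (rule ccontr)
  \<comment> \<open>A value of modulus above both 1 and \<open>cmod L\<close> is impossible: the maximum would be attained.\<close>
  have no: False if z1: "z1 \<in> U" and m: "cmod (f z1) > 1" "cmod (f z1) > cmod L" for z1
  proof -
    define m where "m = cmod (f z1)"
    define K where "K = {z \<in> U. cmod (f z) \<ge> m}"
    have contf: "continuous_on U f" using f by (rule holomorphic_on_imp_continuous_on)
    have "((\<lambda>z. cmod (f z)) \<longlongrightarrow> cmod L) at_infinity" using lim by (rule tendsto_norm)
    hence "eventually (\<lambda>z. cmod (f z) < m) at_infinity"
      using m order_tendstoD(2) by (auto simp: m_def)
    then obtain B where B: "\<And>z. norm z \<ge> B \<Longrightarrow> cmod (f z) < m"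
      by (auto simp: eventually_at_infinity)
    have "bounded K"
      unfolding bounded_iff K_def
      by (rule exI[of _ B]) (use B in \<open>auto intro!: leI dest: less_imp_le simp: not_less[symmetric]\<close>)
    moreover have "closed K"
    proof -
      have "open (- K)"
      proof (subst open_subopen, safe)
        fix x assume x: "x \<notin> K"
        show "\<exists>T. open T \<and> x \<in> T \<and> T \<subseteq> - K"
        proof (cases "x \<in> U")
          case True
          have "open {z \<in> U. cmod (f z) < m}"
          proof -
            have "continuous_on U (\<lambda>z. cmod (f z))" using contf by (intro continuous_intros)
            hence "open (U \<inter> (\<lambda>z. cmod (f z)) -` {..<m})"
              using U(1) by (simp add: continuous_on_open_vimage Int_commute)
            moreover have "U \<inter> (\<lambda>z. cmod (f z)) -` {..<m} = {z \<in> U. cmod (f z) < m}" by auto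
            ultimately show ?thesis by simp
          qed
          moreover have "x \<in> {z \<in> U. cmod (f z) < m}" "{z \<in> U. cmod (f z) < m} \<subseteq> - K"
            using x True by (auto simp: K_def)
          ultimately show ?thesis by blast
        next
          case False
          have "eventually (\<lambda>z. z \<in> U \<longrightarrow> cmod (f z) \<le> 1 + (m - 1) / 2) (nhds x)"
            by (rule bd[OF False]) (use m in \<open>simp add: m_def\<close>)
          then obtain T where T: "open T" "x \<in> T" "\<And>z. z \<in> T \<Longrightarrow> z \<in> U \<Longrightarrow> cmod (f z) \<le> 1 + (m - 1) / 2"
            by (auto simp: eventually_nhds)
          have "1 + (m - 1) / 2 < m" using m by (simp add: m_def field_simps)
          hence "T \<subseteq> - K" using T(3) by (force simp: K_def)
          thus ?thesis using T by blast
        qed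
      qed
      thus ?thesis by (simp add: closed_def)
    qed
    ultimately have "compact K" by (simp add: compact_eq_bounded_closed)
    moreover have "z1 \<in> K" using z1 by (simp add: K_def m_def)
    moreover have "continuous_on K (\<lambda>z. cmod (f z))"
      by (intro continuous_intros continuous_on_subset[OF contf]) (auto simp: K_def)
    ultimately obtain z2 where z2: "z2 \<in> K" "\<And>z. z \<in> K \<Longrightarrow> cmod (f z) \<le> cmod (f z2)"
      using continuous_attains_sup[of K "\<lambda>z. cmod (f z)"] by blast
    have "cmod (f z) \<le> cmod (f z2)" if "z \<in> U" for z
      using z2 that by (cases "z \<in> K") (auto simp: K_def)
    moreover have z2U: "z2 \<in> U" and z2m: "cmod (f z2) \<ge> m" using z2 by (auto simp: K_def)
    ultimately have "f constant_on U"
      by (intro maximum_modulus_principle[OF f U(1,2) U(1) order_refl]) auto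
    then obtain k where k: "\<And>z. z \<in> U \<Longrightarrow> f z = k" by (auto simp: constant_on_def)
    have "eventually (\<lambda>z. f z = k) at_infinity" using ev by eventually_elim (rule k)
    hence "(f \<longlongrightarrow> k) at_infinity" by (rule tendsto_eventually)
    hence "k = L" using lim by (rule tendsto_unique[rotated 1, of _ _ _ L])
      (simp add: trivial_limit_at_infinity)
    thus False using k[OF z1] m by simp
  qed
  assume "\<not> cmod (f z) \<le> 1"
  hence z1: "cmod (f z) > 1" by simp
  have le: "cmod (f z') \<le> cmod L" if "z' \<in> U" for z'
  proof (rule ccontr)
    assume *: "\<not> cmod (f z') \<le> cmod L"
    show False
    proof (cases "cmod (f z) > cmod L")
      case True thus False using no[OF z] z1 by simp
    next
      case False thus False using no[OF that] z1 * by simp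
    qed
  qed
  have const: "f z' = L" if "z' \<in> U" for z'
    using tendsto_max_at_infinity_const[OF U(1,2) f ev lim le that] .
  have L1: "cmod L > 1" using const[OF z] z1 by simp
  \<comment> \<open>A boundary point of \<open>U\<close> contradicts the constant value of modulus above 1.\<close>
  have "frontier U \<noteq> {}" using U z by (auto simp: frontier_eq_empty)
  then obtain x where x: "x \<in> frontier U" by blast
  hence xU: "x \<notin> U" using U(1) by (simp add: frontier_def interior_open)
  have "eventually (\<lambda>z. z \<in> U \<longrightarrow> cmod (f z) \<le> 1 + (cmod L - 1) / 2) (nhds x)"
    by (rule bd[OF xU]) (use L1 in simp)
  then obtain T where T: "open T" "x \<in> T" "\<And>z. z \<in> T \<Longrightarrow> z \<in> U \<Longrightarrow> cmod (f z) \<le> 1 + (cmod L - 1) / 2"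
    by (auto simp: eventually_nhds)
  have "x \<in> closure U" using x by (simp add: frontier_def)
  hence "T \<inter> U \<noteq> {}" using T(1,2) open_Int_closure_eq_empty[OF T(1), of U] by blast
  then obtain y where "y \<in> T" "y \<in> U" by blast
  hence "cmod L \<le> 1 + (cmod L - 1) / 2" using T(3) const by metis
  thus False using L1 by (simp add: field_simps)
qed

text \<open>Riemann's removable singularity theorem for finitely many points.\<close>

lemma removable_finite:
  assumes "finite K" "open S" "f holomorphic_on (S - K)"
    and "\<And>x. x \<in> K \<Longrightarrow> x \<in> S \<Longrightarrow> \<exists>B. eventually (\<lambda>z. cmod (f z) \<le> B) (at x)"
  shows "\<exists>h. h holomorphic_on S \<and> (\<forall>z\<in>S - K. h z = f z)"
  using assms
proof (induction K arbitrary: S rule: finite_induct)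
  case empty
  thus ?case by auto
next
  case (insert x K)
  have "open (S - {x})" using insert.prems(1) by (intro open_Diff) auto
  moreover have "f holomorphic_on (S - {x} - K)"
    using insert.prems(2) Diff_insert2[of S x K] by metis
  ultimately obtain h0 where h0: "h0 holomorphic_on (S - {x})" "\<And>z. z \<in> S - {x} - K \<Longrightarrow> h0 z = f z"
    using insert.IH[of "S - {x}"] insert.prems(3) by auto
  show ?case
  proof (cases "x \<in> S")
    case False
    thus ?thesis using h0 by (intro exI[of _ h0]) auto
  next
    case True
    obtain B where B: "eventually (\<lambda>z. cmod (f z) \<le> B) (at x)" using insert.prems(3) True by blast
    have "open (S - K)" using insert.prems(1) insert.hyps(1) by (intro open_Diff finite_imp_closed)
    hence "eventually (\<lambda>z. z \<in> S - K) (at x)"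
      using True insert.hyps(2) by (intro eventually_at_in_open') auto
    hence "eventually (\<lambda>z. cmod (h0 z) \<le> B) (at x)"
      using B eventually_neq_at_within[of x x UNIV]
    proof eventually_elim
      case (elim z)
      thus ?case using h0(2)[of z] by simp
    qed
    hence "\<exists>B. eventually (\<lambda>z. cmod (h0 z) \<le> B) (at x)" by blast
    moreover have "x \<in> interior S" using True insert.prems(1) by (simp add: interior_open)
    ultimately obtain h where "h holomorphic_on S" "\<forall>z\<in>S - {x}. h z = h0 z"
      using holomorphic_on_extend_bounded[OF h0(1)] by blast
    thus ?thesis using h0(2) by (intro exI[of _ h]) auto
  qed
qed

section \<open>The inverse of the Joukowski map\<close>

text \<open>The solution of \<open>w + 1 / w = d\<close> in the open unit disc, for \<open>d\<close> outside \<open>[-2, 2]\<close>.\<close>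

definition joukowski_inv :: "complex \<Rightarrow> complex" where
  "joukowski_inv d = d / 2 * (1 - csqrt (1 - 4 / d\<^sup>2))"

text \<open>Outside \<open>[-2, 2]\<close> the square root is evaluated away from its branch cut.\<close>

lemma joukowski_cut:
  assumes "d \<notin> complex_of_real ` {-2..2}"
  shows "d \<noteq> 0" "1 - 4 / d\<^sup>2 \<notin> \<real>\<^sub>\<le>\<^sub>0"
proof -
  show d: "d \<noteq> 0" using assms by (auto simp: image_iff dest: bspec[of _ _ 0])
  show "1 - 4 / d\<^sup>2 \<notin> \<real>\<^sub>\<le>\<^sub>0"
  proof
    assume "1 - 4 / d\<^sup>2 \<in> \<real>\<^sub>\<le>\<^sub>0"
    then obtain r where r: "r \<le> 0" "1 - 4 / d\<^sup>2 = of_real r" by (auto elim!: nonpos_Reals_cases)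
    have "d\<^sup>2 * (1 - of_real r) = 4" using r(2) d by (simp add: field_simps)
    hence eq: "d\<^sup>2 = of_real (4 / (1 - r))"
      using r(1) by (simp add: field_simps)
    define s where "s = sqrt (4 / (1 - r))"
    have s2: "s\<^sup>2 = 4 / (1 - r)" using r(1) by (simp add: s_def)
    have "4 / (1 - r) \<le> 4" using r(1) by (simp add: field_simps)
    hence "s\<^sup>2 \<le> 2\<^sup>2" using s2 by simp
    hence s: "\<bar>s\<bar> \<le> 2" by (metis abs_le_square_iff abs_numeral)
    have "d\<^sup>2 = (of_real s)\<^sup>2" using eq s2 by (metis of_real_power)
    hence "d = of_real s \<or> d = of_real (- s)" by (simp add: power2_eq_iff)
    moreover have "s \<in> {-2..2}" "- s \<in> {-2..2}" using s by auto
    ultimately show False using assms by blast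
  qed
qed

lemma joukowski_inv:
  assumes "d \<notin> complex_of_real ` {-2..2}"
  shows "joukowski_inv d \<noteq> 0" "cmod (joukowski_inv d) < 1"
    "joukowski_inv d + 1 / joukowski_inv d = d"
proof -
  define s where "s = csqrt (1 - 4 / d\<^sup>2)"
  define w where "w = d / 2 * (1 - s)"
  define w' where "w' = d / 2 * (1 + s)"
  have d: "d \<noteq> 0" and cut: "1 - 4 / d\<^sup>2 \<notin> \<real>\<^sub>\<le>\<^sub>0" using joukowski_cut[OF assms] by auto
  have s2: "s\<^sup>2 = 1 - 4 / d\<^sup>2" by (simp add: s_def)
  have "w * w' = d\<^sup>2 / 4 * (1 - s\<^sup>2)" by (simp add: w_def w'_def power2_eq_square algebra_simps)
  hence ww: "w * w' = 1" using d by (simp add: s2)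
  hence w0: "w \<noteq> 0" by auto
  hence w': "w' = 1 / w" using ww by (simp add: field_simps)
  have Re: "Re s > 0"
  proof -
    have "Re s \<noteq> 0"
    proof
      assume "Re s = 0"
      hence "s\<^sup>2 = of_real (- (Im s)\<^sup>2)" by (simp add: complex_eq_iff power2_eq_square)
      hence "1 - 4 / d\<^sup>2 \<in> \<real>\<^sub>\<le>\<^sub>0" unfolding s2 by (simp only: nonpos_Reals_of_real_iff) simp
      thus False using cut by simp
    qed
    thus ?thesis using Re_csqrt[of "1 - 4 / d\<^sup>2"] by (simp add: s_def)
  qed
  have "(cmod (1 - s))\<^sup>2 < (cmod (1 + s))\<^sup>2"
    using Re unfolding cmod_power2 by (simp add: power2_eq_square algebra_simps)
  hence "cmod (1 - s) < cmod (1 + s)" by (rule power2_less_imp_less) simp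
  hence "cmod w < cmod w'" using d by (simp add: w_def w'_def norm_mult)
  hence "cmod w * cmod w < 1" using w0 by (simp add: w' norm_divide field_simps)
  hence w1: "cmod w < 1"
    by (simp add: power2_eq_square[symmetric] abs_square_less_1)
  have jw: "joukowski_inv d = w" by (simp add: joukowski_inv_def w_def s_def)
  have "w + w' = d" by (simp add: w_def w'_def field_simps)
  thus "joukowski_inv d \<noteq> 0" "cmod (joukowski_inv d) < 1"
    "joukowski_inv d + 1 / joukowski_inv d = d"
    using w0 w1 w' by (simp_all add: jw)
qed

lemma holomorphic_joukowski_inv: "joukowski_inv holomorphic_on - (complex_of_real ` {-2..2})"
  unfolding joukowski_inv_def[abs_def]
  by (intro holomorphic_intros) (use joukowski_cut in auto)

lemma holomorphic_joukowski_inv' [holomorphic_intros]: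
  assumes "f holomorphic_on S" "\<And>z. z \<in> S \<Longrightarrow> f z \<notin> complex_of_real ` {-2..2}"
  shows "(\<lambda>z. joukowski_inv (f z)) holomorphic_on S"
proof -
  have "f ` S \<subseteq> - (complex_of_real ` {-2..2})" 
    by (rule image_subsetI) (use assms(2) in \<open>simp only: Compl_iff not_False_eq_True\<close>)
  thus ?thesis using holomorphic_on_compose_gen[OF assms(1) holomorphic_joukowski_inv]
    by (simp add: o_def)
qed

lemma isCont_joukowski_inv:
  assumes "d \<notin> complex_of_real ` {-2..2}"
  shows "isCont joukowski_inv d"
proof -
  have "open (- (complex_of_real ` {-2..2}))" by (rule open_compl_real) simp
  thus ?thesis
    using holomorphic_on_imp_continuous_on[OF holomorphic_joukowski_inv] assms
    by (simp add: continuous_on_eq_continuous_at)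
qed

lemma joukowski_inv_real:
  assumes "\<bar>x\<bar> > 2"
  shows "joukowski_inv (of_real x) \<in> \<real>"
proof -
  have x2: "x\<^sup>2 > 4" using assms power_strict_mono[of 2 "\<bar>x\<bar>" 2] by simp
  hence "x\<^sup>2 > 0" by linarith
  hence "0 \<le> 1 - 4 / x\<^sup>2" using x2 by (simp add: divide_le_eq_1)
  hence "csqrt (of_real (1 - 4 / x\<^sup>2)) = of_real (sqrt (1 - 4 / x\<^sup>2))"
    using csqrt_of_real_nonneg[of "1 - 4 / x\<^sup>2"] by simp
  hence "joukowski_inv (of_real x) = of_real (x / 2 * (1 - sqrt (1 - 4 / x\<^sup>2)))"
    by (simp add: joukowski_inv_def)
  thus ?thesis by (metis Reals_of_real)
qed

lemma joukowski_not_cut: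
  assumes "w \<noteq> 0" "cmod w < 1"
  shows "w + 1 / w \<notin> complex_of_real ` {-2..2}"
proof
  assume "w + 1 / w \<in> complex_of_real ` {-2..2}"
  then obtain t where t: "\<bar>t\<bar> \<le> 2" "w + 1 / w = of_real t" by (auto simp: abs_le_iff)
  have eq: "w\<^sup>2 - of_real t * w + 1 = 0"
    using t(2) assms(1) by (simp add: field_simps power2_eq_square)
  \<comment> \<open>The two roots of this quadratic are conjugate, with product 1.\<close>
  have Imz: "Im w * (2 * Re w - t) = 0"
    using arg_cong[OF eq, of Im] by (simp add: power2_eq_square algebra_simps)
  have Rez: "(Re w)\<^sup>2 - (Im w)\<^sup>2 - t * Re w + 1 = 0"
    using arg_cong[OF eq, of Re] by (simp add: power2_eq_square algebra_simps)
  have lt: "(Re w)\<^sup>2 + (Im w)\<^sup>2 < 1"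
    using assms(2) unfolding cmod_power2[symmetric] by (simp add: abs_square_less_1)
  show False
  proof (cases "Im w = 0")
    case True
    have r1: "\<bar>Re w\<bar> < 1" using lt True by (simp add: abs_square_less_1)
    have "t * Re w \<le> \<bar>t\<bar> * \<bar>Re w\<bar>" by (simp flip: abs_mult)
    also have "\<dots> \<le> 2 * \<bar>Re w\<bar>" using t(1) by (intro mult_right_mono) auto
    finally have "t * Re w \<le> 2 * \<bar>Re w\<bar>" .
    hence "\<bar>Re w\<bar>\<^sup>2 - 2 * \<bar>Re w\<bar> + 1 \<le> 0" using Rez True by simp
    hence "(\<bar>Re w\<bar> - 1)\<^sup>2 \<le> 0" by (simp add: power2_eq_square algebra_simps)
    thus False using r1 by simp
  next
    case False
    hence "t = 2 * Re w" using Imz by simp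
    thus False using Rez lt by (simp add: power2_eq_square)
  qed
qed

text \<open>
  The Joukowski map sends circles about the origin to ellipses with foci \<open>2\<close> and \<open>-2\<close>. Hence
  \<open>cmod w\<close>, unlike \<open>w\<close> itself, is controlled by \<open>d\<close> up to the cut \<open>[-2, 2]\<close>.
\<close>

lemma joukowski_ellipse:
  assumes "w \<noteq> 0" "d = w + 1 / w"
  shows "cmod w + 1 / cmod w = (cmod (d - 2) + cmod (d + 2)) / 2"
proof -
  have "d - 2 = (1 - w)\<^sup>2 / w" "d + 2 = (1 + w)\<^sup>2 / w"
    using assms by (simp_all add: field_simps power2_eq_square)
  hence "cmod (d - 2) + cmod (d + 2) = ((cmod (1 - w))\<^sup>2 + (cmod (1 + w))\<^sup>2) / cmod w"
    by (simp add: norm_divide norm_power add_divide_distrib)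
  also have "(cmod (1 - w))\<^sup>2 + (cmod (1 + w))\<^sup>2 = 2 * (1 + (cmod w)\<^sup>2)"
    unfolding cmod_power2 by (simp add: power2_eq_square algebra_simps)
  also have "\<dots> / cmod w = 2 * (cmod w + 1 / cmod w)"
    using assms(1) by (simp add: field_simps power2_eq_square)
  finally show ?thesis by simp
qed

lemma ellipse_sum_cut:
  assumes "d \<in> complex_of_real ` {-2..2}"
  shows "cmod (d - 2) + cmod (d + 2) = 4"
proof -
  obtain t where t: "d = of_real t" "t \<in> {-2..2}" using assms by auto
  have "d - 2 = of_real (t - 2)" "d + 2 = of_real (t + 2)" by (simp_all add: t)
  hence "cmod (d - 2) = \<bar>t - 2\<bar>" "cmod (d + 2) = \<bar>t + 2\<bar>" by (simp_all only: norm_of_real)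
  thus ?thesis using t by auto
qed

lemma ellipse_sum_not_cut:
  assumes "d \<notin> complex_of_real ` {-2..2}"
  shows "cmod (d - 2) + cmod (d + 2) > 4"
proof -
  let ?w = "joukowski_inv d"
  note w = joukowski_inv[OF assms]
  have "0 < (1 - cmod ?w)\<^sup>2 / cmod ?w" using w(1,2) by simp
  also have "(1 - cmod ?w)\<^sup>2 / cmod ?w = cmod ?w + 1 / cmod ?w - 2"
    using w(1) by (simp add: field_simps power2_eq_square)
  finally show ?thesis using joukowski_ellipse[OF w(1) w(3)[symmetric]] by simp
qed

section \<open>The extremal problem for analytic capacity\<close>

lemma ahlfors_class_limits:
  assumes "f \<in> ahlfors_class E"
  shows "(f \<longlongrightarrow> 0) at_infinity" "((\<lambda>z. z * f z) \<longlongrightarrow> coeff_inf f) at_infinity"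
proof -
  define G where "G = (\<lambda>w. if w = 0 then 0 else f (1 / w))"
  have "G analytic_on {0}" using assms by (simp add: ahlfors_class_def G_def)
  hence "G field_differentiable (at 0)" by (auto intro: analytic_on_imp_differentiable_at)
  then obtain d where d: "(G has_field_derivative d) (at 0)"
    by (auto simp: field_differentiable_def)
  have G0: "G 0 = 0" by (simp add: G_def)
  have "G \<midarrow>0\<rightarrow> 0" using DERIV_isCont[OF d] by (simp only: isCont_def G0)
  hence "(f \<circ> inverse) \<midarrow>0\<rightarrow> 0"
    by (rule Lim_transform_eventually)
       (auto simp: G_def eventually_at_filter inverse_eq_divide)
  thus "(f \<longlongrightarrow> 0) at_infinity" by (simp add: lim_at_infinity_0)
  have "(\<lambda>h. (G (0 + h) - G 0) / h) \<midarrow>0\<rightarrow> d" using d by (simp add: DERIV_def)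
  hence "((\<lambda>z. z * f z) \<circ> inverse) \<midarrow>0\<rightarrow> d"
    by (rule Lim_transform_eventually)
       (auto simp: G_def eventually_at_filter inverse_eq_divide)
  hence lim: "((\<lambda>z. z * f z) \<longlongrightarrow> d) at_infinity" by (simp add: lim_at_infinity_0)
  hence "coeff_inf f = d" unfolding coeff_inf_def
    by (intro tendsto_Lim) (simp_all add: trivial_limit_at_infinity)
  thus "((\<lambda>z. z * f z) \<longlongrightarrow> coeff_inf f) at_infinity" using lim by simp
qed

lemma tendsto_zero_of_mult_id:
  assumes "((\<lambda>z. z * f z) \<longlongrightarrow> (l :: complex)) at_infinity"
  shows "(f \<longlongrightarrow> 0) at_infinity"
proof -
  have "((\<lambda>z. (z * f z) * inverse z) \<longlongrightarrow> l * 0) at_infinity"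
    by (intro tendsto_mult assms tendsto_inverse_0)
  moreover have "eventually (\<lambda>z::complex. (z * f z) * inverse z = f z) at_infinity"
    unfolding eventually_at_infinity
  proof (intro exI[of _ 1] allI impI)
    fix z :: complex assume "1 \<le> norm z"
    hence "z \<noteq> 0" by auto
    thus "(z * f z) * inverse z = f z" by simp
  qed
  ultimately show ?thesis by (auto intro: Lim_transform_eventually)
qed

lemma ahlfors_classI:
  assumes "compact E" "f holomorphic_on - (of_real ` E)" "(f \<longlongrightarrow> 0) at_infinity"
    and "\<And>z. z \<notin> of_real ` E \<Longrightarrow> cmod (f z) \<le> 1"
  shows "f \<in> ahlfors_class E"
proof -
  obtain r where "r > 0" "(\<lambda>w. if w = 0 then 0 else f (1 / w)) holomorphic_on ball 0 r"
    using inversion_holomorphic[OF open_compl_real[OF assms(1)] assms(2)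
        eventually_compl_real[OF assms(1)] assms(3)] by metis
  hence "(\<lambda>w. if w = 0 then 0 else f (1 / w)) analytic_on {0}"
    unfolding analytic_at by (intro exI[of _ "ball 0 r"]) auto
  thus ?thesis using assms by (simp add: ahlfors_class_def)
qed

lemma coeff_infI: "((\<lambda>z. z * f z) \<longlongrightarrow> l) at_infinity \<Longrightarrow> coeff_inf f = l"
  unfolding coeff_inf_def by (intro tendsto_Lim) (simp_all add: trivial_limit_at_infinity)

lemma ahlfors_lt_1:
  assumes E: "compact E" and "ahlfors_function E \<Psi>" and z: "z \<notin> of_real ` E"
  shows "cmod (\<Psi> z) < 1"
proof (rule ccontr)
  assume "\<not> cmod (\<Psi> z) < 1"
  let ?U = "- (complex_of_real ` E)"
  have cl: "\<Psi> \<in> ahlfors_class E" using assms by (simp add: ahlfors_function_def)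
  hence hol: "\<Psi> holomorphic_on ?U" and le: "\<And>z. z \<in> ?U \<Longrightarrow> cmod (\<Psi> z) \<le> 1"
    by (auto simp: ahlfors_class_def)
  have z1: "cmod (\<Psi> z) = 1" using \<open>\<not> cmod (\<Psi> z) < 1\<close> le[of z] z by simp
  have "\<Psi> constant_on ?U"
    by (rule maximum_modulus_principle[OF hol open_compl_real[OF E] connected_compl_real[OF E]
          open_compl_real[OF E] order_refl, of z]) (use z z1 le in auto)
  hence "\<And>z'. z' \<in> ?U \<Longrightarrow> \<Psi> z' = \<Psi> z" using z unfolding constant_on_def by (metis ComplI)
  hence "eventually (\<lambda>z'. \<Psi> z' = \<Psi> z) at_infinity"
    using eventually_compl_real[OF E] by (auto elim: eventually_mono)
  hence "(\<Psi> \<longlongrightarrow> \<Psi> z) at_infinity" by (rule tendsto_eventually)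
  hence "\<Psi> z = 0"
    using ahlfors_class_limits(1)[OF cl]
    by (rule tendsto_unique[rotated 1]) (simp add: trivial_limit_at_infinity)
  thus False using z1 by simp
qed

text \<open>If \<open>D\<close> grows like \<open>a z\<close>, then the small solution of \<open>w + 1 / w = D\<close> decays like \<open>1 / (a z)\<close>.\<close>

lemma joukowski_inv_at_infinity:
  assumes a: "a \<noteq> 0" and lim: "((\<lambda>z. D z / z) \<longlongrightarrow> a) at_infinity"
    and ev: "eventually (\<lambda>z. D z \<notin> complex_of_real ` {-2..2}) at_infinity"
  shows "((\<lambda>z. z * joukowski_inv (D z)) \<longlongrightarrow> 1 / a) at_infinity"
proof -
  let ?w = "\<lambda>z. joukowski_inv (D z)"
  have "((\<lambda>z. ?w z * inverse z) \<longlongrightarrow> 0) at_infinity"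
  proof (rule Lim_null_comparison[where g = "\<lambda>z. norm (inverse z)"])
    show "eventually (\<lambda>z. norm (?w z * inverse z) \<le> norm (inverse z)) at_infinity"
      using ev
    proof eventually_elim
      case (elim z)
      have "norm (?w z) * norm (inverse z) \<le> 1 * norm (inverse z)"
        using joukowski_inv(2)[OF elim] by (intro mult_right_mono) auto
      thus ?case by (simp add: norm_mult)
    qed
    show "((\<lambda>z::complex. norm (inverse z)) \<longlongrightarrow> 0) at_infinity"
      by (intro tendsto_norm_zero tendsto_inverse_0)
  qed
  hence "((\<lambda>z. 1 / (D z / z - ?w z * inverse z)) \<longlongrightarrow> 1 / (a - 0)) at_infinity"
    using a by (intro tendsto_intros lim) auto
  moreover have "eventually (\<lambda>z. 1 / (D z / z - ?w z * inverse z) = z * ?w z) at_infinity"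
  proof -
    have "eventually (\<lambda>z::complex. z \<noteq> 0) at_infinity"
      unfolding eventually_at_infinity by (rule exI[of _ 1]) auto
    with ev show ?thesis
    proof eventually_elim
      case (elim z)
      have "D z - ?w z = 1 / ?w z" using joukowski_inv(3)[OF elim(1)] by (simp add: algebra_simps)
      hence "D z / z - ?w z * inverse z = 1 / (?w z * z)"
        using elim(2) by (simp add: field_simps)
      thus ?case by simp
    qed
  qed
  ultimately show ?thesis by (auto intro: Lim_transform_eventually)
qed

text \<open>For real \<open>a\<close> in \<open>(-1, 1)\<close>, the map \<open>(w + a) / (1 + a w)\<close> is an automorphism of the unit disc.\<close>

lemma moebius_real_le:
  assumes "cmod w \<le> 1" "\<bar>a\<bar> \<le> 1"
  shows "cmod (w + of_real a) \<le> cmod (1 + of_real a * w)"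
proof -
  have "(cmod (1 + of_real a * w))\<^sup>2 - (cmod (w + of_real a))\<^sup>2 = (1 - a\<^sup>2) * (1 - (cmod w)\<^sup>2)"
    unfolding cmod_power2 by (simp add: power2_eq_square algebra_simps)
  also have "\<dots> \<ge> 0"
    using assms by (intro mult_nonneg_nonneg) (auto simp: abs_square_le_1 power_le_one)
  finally have "(cmod (w + of_real a))\<^sup>2 \<le> (cmod (1 + of_real a * w))\<^sup>2" by simp
  thus ?thesis by (rule power2_le_imp_le) simp
qed

lemma finite_gap_compact:
  assumes "finite_gap_set g E"
  shows "compact E"
proof -
  obtain a b where "E = {b 0..a 0} - (\<Union>j\<in>{1..g}. {a j<..<b j :: real})"
    using assms by (auto simp: finite_gap_set_def)
  thus ?thesis by (auto intro!: compact_diff)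
qed

lemma finite_gap_nonempty:
  assumes "finite_gap_set g E"
  shows "E \<noteq> {}"
proof -
  obtain a b where ba: "\<forall>j<g. b j < a (Suc j)" and ab: "\<forall>j\<in>{1..g}. a j < b j" and last: "b g < a 0"
    and E: "E = {b 0..a 0} - (\<Union>j\<in>{1..g}. {a j<..<b j :: real})"
    using assms unfolding finite_gap_set_def by blast
  have mono: "b 0 \<le> b j \<and> (0 < j \<longrightarrow> b 0 < a j)" if "j \<le> g" for j
    using that
  proof (induction j)
    case (Suc j)
    hence "b 0 \<le> b j" "b j < a (Suc j)" "a (Suc j) < b (Suc j)" using ba ab by auto
    thus ?case by simp
  qed simp
  have "b 0 \<notin> {a j<..<b j}" if "j \<in> {1..g}" for j
    using mono[of j] that by simp
  moreover have "b 0 \<le> a 0" using mono[of g] last by simp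
  ultimately have "b 0 \<in> E" unfolding E by simp
  thus ?thesis by blast
qed

text \<open>A finite gap set has no isolated points: each of its points lies in a nondegenerate band.\<close>

lemma finite_gap_interval:
  assumes "finite_gap_set g E" "x \<in> E" "\<delta> > 0"
  obtains u v where "u < v" "{u..v} \<subseteq> E" "{u..v} \<subseteq> {x - \<delta><..<x + \<delta>}"
proof -
  obtain a b where *: "\<forall>j<g. b j < a (Suc j)" "\<forall>j\<in>{1..g}. a j < b j"
    and last: "b g < a 0" and E: "E = {b 0..a 0} - (\<Union>j\<in>{1..g}. {a j<..<b j :: real})"
    using assms(1) unfolding finite_gap_set_def by blast
  have ba: "\<And>j. j < g \<Longrightarrow> b j < a (Suc j)" and ab: "\<And>j. j \<in> {1..g} \<Longrightarrow> a j < b j"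
    using * by blast+
  have bmono: "b i \<le> b j" if "i \<le> j" "j \<le> g" for i j
    using that
  proof (induction j rule: dec_induct)
    case (step n)
    thus ?case using ba[of n] ab[of "Suc n"] by simp
  qed simp
  have amono: "a i \<le> a j" if "i \<le> j" "j \<le> g" "1 \<le> i" for i j
    using that
  proof (induction j rule: dec_induct)
    case (step n)
    thus ?case using ba[of n] ab[of n] by simp
  qed simp
  define J where "J = {j. j \<le> g \<and> b j \<le> x}"
  have fin: "finite J" by (simp add: J_def)
  have "0 \<in> J" using assms(2) by (simp add: J_def E)
  define j where "j = Max J"
  have "j \<in> J" unfolding j_def using fin \<open>0 \<in> J\<close> by (intro Max_in) auto
  hence j: "j \<le> g" "b j \<le> x" by (auto simp: J_def)
  have jmax: "i \<le> j" if "i \<le> g" "b i \<le> x" for i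
    using Max_ge[OF fin, of i] that by (simp add: j_def J_def)
  define e where "e = (if j < g then a (Suc j) else a 0)"
  have be: "b j < e" using ba[of j] last j(1) by (auto simp: e_def)
  have ea0: "e \<le> a 0"
    using amono[of "Suc j" g] ab[of g] last j(1) by (auto simp: e_def)
  have xe: "x \<le> e"
  proof (cases "j < g")
    case True
    hence "x < b (Suc j)" using jmax[of "Suc j"] by force
    moreover have "x \<notin> {a (Suc j)<..<b (Suc j)}" using assms(2) True by (auto simp: E)
    ultimately show ?thesis using True by (simp add: e_def)
  next
    case False
    thus ?thesis using assms(2) by (simp add: e_def E)
  qed
  have band: "{b j..e} \<subseteq> E"
  proof
    fix y assume y: "y \<in> {b j..e}"
    have "y \<notin> {a i<..<b i}" if i: "i \<in> {1..g}" for i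
    proof (cases "i \<le> j")
      case True
      thus ?thesis using bmono[of i j] j(1) y by auto
    next
      case False
      hence "e \<le> a i" using amono[of "Suc j" i] i by (auto simp: e_def)
      thus ?thesis using y by auto
    qed
    moreover have "b 0 \<le> y" "y \<le> a 0" using y bmono[of 0 j] j(1) ea0 by auto
    ultimately show "y \<in> E" by (auto simp: E)
  qed
  define u where "u = max (b j) (x - \<delta> / 2)"
  define v where "v = min e (x + \<delta> / 2)"
  have "u < v" using be j(2) xe assms(3) by (auto simp: u_def v_def)
  moreover have "{u..v} \<subseteq> E" using band by (auto simp: u_def v_def)
  moreover have "{u..v} \<subseteq> {x - \<delta><..<x + \<delta>}" using assms(3) by (auto simp: u_def v_def)
  ultimately show ?thesis using that by blast
qed

text \<open>The affine map below takes \<open>[u, v]\<close> to \<open>[-2, 2]\<close>.\<close>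

lemma affine_not_cut:
  assumes "u < v" "z \<notin> complex_of_real ` {u..v}"
  shows "(4 * z - of_real (2 * (u + v))) / of_real (v - u) \<notin> complex_of_real ` {-2..2}"
proof
  assume "(4 * z - of_real (2 * (u + v))) / of_real (v - u) \<in> complex_of_real ` {-2..2}"
  then obtain t where t: "-2 \<le> t" "t \<le> 2"
    "(4 * z - of_real (2 * (u + v))) / of_real (v - u) = complex_of_real t" by auto
  have vu: "complex_of_real (v - u) \<noteq> 0" unfolding of_real_eq_0_iff using assms(1) by simp
  have "4 * z - of_real (2 * (u + v)) = of_real (t * (v - u))"
    using iffD1[OF nonzero_divide_eq_eq[OF vu] t(3)] by simp
  hence z: "z = of_real ((t * (v - u) + 2 * (u + v)) / 4)" by (simp add: algebra_simps)
  have "- 2 * (v - u) \<le> t * (v - u)" "t * (v - u) \<le> 2 * (v - u)"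
    using t assms(1) by (intro mult_right_mono; simp)+
  hence "(t * (v - u) + 2 * (u + v)) / 4 \<in> {u..v}" by (auto simp: field_simps)
  thus False using assms(2) z by blast
qed

text \<open>
  If \<open>D\<close> took a value outside \<open>[-2, 2]\<close> at a point of \<open>E\<close>, then \<open>\<Psi>\<close> would stay away from the unit
  circle near an interval \<open>[u, v]\<close> contained in \<open>E\<close>. With \<open>k\<close> mapping the complement of \<open>[u, v]\<close> to the unit
  disc, real on the real line outside of \<open>[u, v]\<close>, the function \<open>(\<Psi> + \<epsilon> k) / (1 + \<epsilon> k \<Psi>)\<close>
  would still be bounded by one, with a larger leading coefficient.
\<close>

lemma ahlfors_delta_on_bands:
  assumes gap: "finite_gap_set g E" and ahl: "ahlfors_function E \<Psi>"
    and cont: "\<And>x. x \<in> E \<Longrightarrow> isCont D (of_real x)"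
    and D: "\<And>z. z \<notin> of_real ` E \<Longrightarrow> \<Psi> z \<noteq> 0 \<Longrightarrow> D z = \<Psi> z + 1 / \<Psi> z"
    and x0: "x0 \<in> E"
  shows "D (of_real x0) \<in> complex_of_real ` {-2..2}"
proof (rule ccontr)
  assume notin: "D (of_real x0) \<notin> complex_of_real ` {-2..2}"
  let ?U = "- (complex_of_real ` E)"
  have E: "compact E" using gap by (rule finite_gap_compact)
  have cl: "\<Psi> \<in> ahlfors_class E" using ahl by (simp add: ahlfors_function_def)
  hence hol: "\<Psi> holomorphic_on ?U" and le1: "\<And>z. z \<in> ?U \<Longrightarrow> cmod (\<Psi> z) \<le> 1"
    by (auto simp: ahlfors_class_def)
  define s where "s = (\<lambda>z. cmod (D z - 2) + cmod (D z + 2))"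
  \<comment> \<open>Any level strictly between 4, the value on the cut, and the value at the exceptional point.\<close>
  define m where "m = (4 + s (of_real x0)) / 2"
  have m4: "m > 4" and ms: "m < s (of_real x0)"
    using ellipse_sum_not_cut[OF notin] by (auto simp: m_def s_def field_simps)
  have "isCont s (of_real x0)" unfolding s_def using cont[OF x0] by (intro continuous_intros)
  hence "eventually (\<lambda>z. s z > m) (nhds (of_real x0))"
    using ms order_tendstoD(1)[of s "s (of_real x0)"]
    unfolding isCont_def eventually_nhds_conv_at by blast
  then obtain \<delta> where \<delta>: "\<delta> > 0" "\<And>z. dist z (of_real x0) < \<delta> \<Longrightarrow> s z > m"
    by (auto simp: eventually_nhds_metric)
  obtain u v where uv: "u < v" "{u..v} \<subseteq> E" "{u..v} \<subseteq> {x0 - \<delta><..<x0 + \<delta>}"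
    using finite_gap_interval[OF gap x0 \<delta>(1)] by metis
  \<comment> \<open>From \<open>t + 1 / t > m / 2\<close> and \<open>t \<le> 1\<close> follows \<open>t \<le> r\<close>.\<close>
  define r where "r = 1 / (m / 2 - 1)"
  have r: "0 < r" "r < 1" using m4 by (auto simp: r_def field_simps)
  have \<Psi>r: "cmod (\<Psi> z) \<le> r" if z: "z \<in> ?U" and d: "dist z (of_real x0) < \<delta>" for z
  proof (cases "\<Psi> z = 0")
    case False
    have "cmod (\<Psi> z) + 1 / cmod (\<Psi> z) = s z / 2"
      using joukowski_ellipse[OF False D] z False by (simp add: s_def)
    hence "1 / cmod (\<Psi> z) \<ge> m / 2 - 1" using \<delta>(2)[OF d] le1[OF z] by linarith
    moreover have "m / 2 - 1 > 0" using m4 by simp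
    ultimately show ?thesis unfolding r_def
      using False by (simp add: field_simps)
  qed (use r in simp)
  \<comment> \<open>The perturbation is so small that \<open>(r + \<epsilon>) / (1 - \<epsilon> r) \<le> 1\<close>.\<close>
  define \<epsilon> where "\<epsilon> = (1 - r) / 2"
  have \<epsilon>: "0 < \<epsilon>" "\<epsilon> \<le> 1 / 2" "r + \<epsilon> \<le> 1 - \<epsilon> * r"
  proof -
    show "0 < \<epsilon>" "\<epsilon> \<le> 1 / 2" using r by (auto simp: \<epsilon>_def)
    have "\<epsilon> * r \<le> \<epsilon> * 1" using r by (intro mult_left_mono) (auto simp: \<epsilon>_def)
    thus "r + \<epsilon> \<le> 1 - \<epsilon> * r" by (simp add: \<epsilon>_def field_simps)
  qed
  define dd where "dd = (\<lambda>z. (4 * z - of_real (2 * (u + v))) / complex_of_real (v - u))"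
  define k where "k = (\<lambda>z. joukowski_inv (dd z))"
  have vu: "complex_of_real (v - u) \<noteq> 0" unfolding of_real_eq_0_iff using uv(1) by simp
  have ddcut: "dd z \<notin> complex_of_real ` {-2..2}" if "z \<notin> complex_of_real ` {u..v}" for z
    unfolding dd_def using affine_not_cut[OF uv(1) that] .
  have k1: "cmod (k z) < 1" if "z \<notin> complex_of_real ` {u..v}" for z
    unfolding k_def using joukowski_inv(2)[OF ddcut[OF that]] .
  have Uuv: "z \<notin> complex_of_real ` {u..v}" if "z \<in> ?U" for z using that uv(2) by blast
  have holk: "k holomorphic_on ?U"
  proof -
    have "dd holomorphic_on ?U" unfolding dd_def using vu by (intro holomorphic_intros)
    thus ?thesis unfolding k_def by (rule holomorphic_joukowski_inv') (use ddcut Uuv in blast)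
  qed
  have limk: "((\<lambda>z. z * k z) \<longlongrightarrow> 1 / of_real (4 / (v - u))) at_infinity"
    unfolding k_def
  proof (rule joukowski_inv_at_infinity)
    show "complex_of_real (4 / (v - u)) \<noteq> 0" unfolding of_real_eq_0_iff using uv(1) by simp
    define W where "W = complex_of_real (v - u)"
    define S where "S = complex_of_real (2 * (u + v))"
    have "((\<lambda>z. 4 / W - S / W * inverse z) \<longlongrightarrow> 4 / W - S / W * 0) at_infinity"
      by (intro tendsto_intros tendsto_inverse_0)
    moreover have "eventually (\<lambda>z. 4 / W - S / W * inverse z = dd z / z) at_infinity"
      unfolding eventually_at_infinity
    proof (intro exI[of _ 1] allI impI)
      fix z :: complex assume "1 \<le> norm z"
      hence z: "z \<noteq> 0" by auto
      have "W \<noteq> 0" using vu by (simp add: W_def)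
      thus "4 / W - S / W * inverse z = dd z / z"
        unfolding dd_def W_def[symmetric] S_def[symmetric] using z by (simp add: field_simps)
    qed
    moreover have "4 / W - S / W * 0 = of_real (4 / (v - u))" by (simp add: W_def)
    ultimately show "((\<lambda>z. dd z / z) \<longlongrightarrow> complex_of_real (4 / (v - u))) at_infinity"
      by (auto intro: Lim_transform_eventually)
    show "eventually (\<lambda>z. dd z \<notin> complex_of_real ` {-2..2}) at_infinity"
      using eventually_compl_real[OF E] by eventually_elim (use ddcut Uuv in blast)
  qed
  define f where "f = (\<lambda>z. (\<Psi> z + \<epsilon> * k z) / (1 + \<epsilon> * k z * \<Psi> z))"
  have small: "cmod (\<epsilon> * k z * \<Psi> z) < 1" if "z \<in> ?U" for z
  proof -
    have "cmod (k z) * cmod (\<Psi> z) \<le> 1 * 1"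
      using k1[OF Uuv[OF that]] le1[OF that] by (intro mult_mono) auto
    hence "\<epsilon> * (cmod (k z) * cmod (\<Psi> z)) \<le> \<epsilon> * 1" using \<epsilon> by (intro mult_left_mono) auto
    moreover have "cmod (\<epsilon> * k z * \<Psi> z) = \<epsilon> * (cmod (k z) * cmod (\<Psi> z))"
      using \<epsilon> by (simp add: norm_mult)
    ultimately show ?thesis using \<epsilon> by linarith
  qed
  have den: "1 + \<epsilon> * k z * \<Psi> z \<noteq> 0" if "z \<in> ?U" for z
  proof
    assume "1 + \<epsilon> * k z * \<Psi> z = 0"
    hence "\<epsilon> * k z * \<Psi> z = -1" by (metis add.commute eq_neg_iff_add_eq_0)
    thus False using small[OF that] by simp
  qed
  have holf: "f holomorphic_on ?U"
    unfolding f_def by (intro holomorphic_intros hol holk den)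
  have \<Psi>0: "(\<Psi> \<longlongrightarrow> 0) at_infinity" and \<Psi>c: "((\<lambda>z. z * \<Psi> z) \<longlongrightarrow> coeff_inf \<Psi>) at_infinity"
    using ahlfors_class_limits[OF cl] by auto
  have k0: "(k \<longlongrightarrow> 0) at_infinity" using limk by (rule tendsto_zero_of_mult_id)
  define \<epsilon>' where "\<epsilon>' = complex_of_real \<epsilon>"
  have "((\<lambda>z. (z * \<Psi> z + \<epsilon>' * (z * k z)) / (1 + \<epsilon>' * k z * \<Psi> z)) \<longlongrightarrow>
      (coeff_inf \<Psi> + \<epsilon>' * (1 / of_real (4 / (v - u)))) / (1 + \<epsilon>' * 0 * 0)) at_infinity"
    by (intro tendsto_divide tendsto_add tendsto_mult tendsto_const \<Psi>0 \<Psi>c k0 limk) simp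
  moreover have "(\<lambda>z. (z * \<Psi> z + \<epsilon>' * (z * k z)) / (1 + \<epsilon>' * k z * \<Psi> z)) = (\<lambda>z. z * f z)"
    unfolding f_def \<epsilon>'_def[symmetric] by (rule ext) (simp add: distrib_left mult.left_commute)
  moreover have "(coeff_inf \<Psi> + \<epsilon>' * (1 / of_real (4 / (v - u)))) / (1 + \<epsilon>' * 0 * 0)
      = coeff_inf \<Psi> + of_real (\<epsilon> * ((v - u) / 4))"
    by (simp add: \<epsilon>'_def)
  ultimately have limf: "((\<lambda>z. z * f z) \<longlongrightarrow> coeff_inf \<Psi> + of_real (\<epsilon> * ((v - u) / 4))) at_infinity"
    by (simp only:)
  have f0: "(f \<longlongrightarrow> 0) at_infinity" using limf by (rule tendsto_zero_of_mult_id)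
  have bd: "eventually (\<lambda>z. z \<in> ?U \<longrightarrow> cmod (f z) \<le> 1 + e) (nhds x)" if x: "x \<notin> ?U" and e: "e > 0" for x e
  proof -
    obtain y where y: "x = of_real y" "y \<in> E" using x by auto
    show ?thesis
    proof (cases "y \<in> {u..v}")
      case True
      hence "y \<in> {x0 - \<delta><..<x0 + \<delta>}" using uv(3) by blast
      hence "\<bar>y - x0\<bar> < \<delta>" by auto
      hence "dist x (of_real x0) < \<delta>" unfolding y dist_norm by (metis norm_of_real of_real_diff)
      hence "eventually (\<lambda>z. dist z (of_real x0) < \<delta>) (nhds x)"
        unfolding eventually_nhds
        by (intro exI[of _ "ball (of_real x0) \<delta>"]) (auto simp: dist_commute)
      thus ?thesis
      proof eventually_elim
        case (elim z)
        show ?case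
        proof
          assume z: "z \<in> ?U"
          have k: "cmod (k z) \<le> 1" using k1[OF Uuv[OF z]] by simp
          have "cmod (\<Psi> z + \<epsilon> * k z) \<le> cmod (\<Psi> z) + \<epsilon> * cmod (k z)"
            using norm_triangle_ineq[of "\<Psi> z" "\<epsilon> * k z"] \<epsilon> by (simp add: norm_mult)
          also have "\<dots> \<le> r + \<epsilon> * 1"
            using \<Psi>r[OF z elim] k \<epsilon> by (intro add_mono mult_left_mono) auto
          also have "\<dots> \<le> 1 - \<epsilon> * r" using \<epsilon> by simp
          also have "\<epsilon> * (cmod (k z) * cmod (\<Psi> z)) \<le> \<epsilon> * (1 * r)"
            using \<Psi>r[OF z elim] k \<epsilon> by (intro mult_mono) auto
          hence "1 - \<epsilon> * r \<le> 1 - cmod (\<epsilon> * k z * \<Psi> z)" using \<epsilon> by (simp add: norm_mult mult.assoc)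
          also have "\<dots> \<le> cmod (1 + \<epsilon> * k z * \<Psi> z)"
            using norm_diff_ineq[of 1 "\<epsilon> * k z * \<Psi> z"] by simp
          finally have "cmod (f z) \<le> 1"
            unfolding f_def norm_divide using den[OF z] by (simp add: divide_le_eq_1)
          thus "cmod (f z) \<le> 1 + e" using e by simp
        qed
      qed
    next
      case False
      \<comment> \<open>Here \<open>k\<close> is continuous with a real value, so that \<open>f\<close> is close to a disc automorphism of \<open>\<Psi>\<close>.\<close>
      hence xuv: "x \<notin> complex_of_real ` {u..v}" by (auto simp: y)
      have "dd x = of_real ((4 * y - 2 * (u + v)) / (v - u))" by (simp add: dd_def y)
      moreover have "dd x \<notin> complex_of_real ` {-2..2}" by (rule ddcut[OF xuv])
      ultimately have "\<bar>(4 * y - 2 * (u + v)) / (v - u)\<bar> > 2"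
        by (metis abs_le_iff atLeastAtMost_iff imageI minus_le_iff not_le)
      hence "k x \<in> \<real>" unfolding k_def \<open>dd x = _\<close> by (rule joukowski_inv_real)
      then obtain t where t: "k x = of_real t" by (auto elim: Reals_cases)
      have t1: "\<bar>t\<bar> < 1" using k1[OF xuv] by (simp add: t)
      define \<eta> where "\<eta> = e / (2 * (2 + e))"
      have \<eta>: "\<eta> > 0" "\<eta> * (2 + e) = e / 2" using e by (auto simp: \<eta>_def field_simps)
      have "isCont dd x" unfolding dd_def using vu by (intro continuous_intros) auto
      hence "isCont k x" unfolding k_def
        using isCont_joukowski_inv[OF ddcut[OF xuv]] by (rule isCont_o2)
      hence "eventually (\<lambda>z. dist (k z) (k x) < \<eta>) (nhds x)"
        using \<eta> tendstoD[of k "k x"] unfolding isCont_def eventually_nhds_conv_at by simp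
      thus ?thesis
      proof eventually_elim
        case (elim z)
        show ?case
        proof
          assume z: "z \<in> ?U"
          have close: "cmod (\<epsilon> * (k z - of_real t)) \<le> \<eta>"
          proof -
            have "\<epsilon> * cmod (k z - of_real t) \<le> 1 * \<eta>"
              using elim \<epsilon> by (intro mult_mono) (auto simp: dist_norm t)
            thus ?thesis using \<epsilon> by (simp add: norm_mult)
          qed
          define b where "b = cmod (1 + of_real (\<epsilon> * t) * \<Psi> z)"
          have et: "\<bar>\<epsilon> * t\<bar> \<le> 1 / 2"
          proof -
            have "\<epsilon> * \<bar>t\<bar> \<le> (1 / 2) * 1" using \<epsilon> t1 by (intro mult_mono) auto
            thus ?thesis using \<epsilon> by (simp add: abs_mult)
          qed
          have "cmod (of_real (\<epsilon> * t) * \<Psi> z) \<le> (1 / 2) * 1"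
            unfolding norm_mult norm_of_real using et le1[OF z] by (intro mult_mono) auto
          hence b2: "b \<ge> 1 / 2"
            using norm_diff_ineq[of 1 "of_real (\<epsilon> * t) * \<Psi> z"] by (simp add: b_def)
          have num: "cmod (\<Psi> z + \<epsilon> * k z) \<le> b + \<eta>"
          proof -
            have "\<Psi> z + \<epsilon> * k z = (\<Psi> z + of_real (\<epsilon> * t)) + \<epsilon> * (k z - of_real t)"
              by (simp add: algebra_simps)
            hence "cmod (\<Psi> z + \<epsilon> * k z) \<le> cmod (\<Psi> z + of_real (\<epsilon> * t)) + cmod (\<epsilon> * (k z - of_real t))"
              by (metis norm_triangle_ineq)
            also have "cmod (\<Psi> z + of_real (\<epsilon> * t)) \<le> b"
              unfolding b_def using et by (intro moebius_real_le le1[OF z]) simp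
            finally show ?thesis using close by simp
          qed
          have den': "cmod (1 + \<epsilon> * k z * \<Psi> z) \<ge> b - \<eta>"
          proof -
            define b0 where "b0 = 1 + of_real (\<epsilon> * t) * \<Psi> z"
            define d where "d = \<epsilon> * (k z - of_real t) * \<Psi> z"
            have eq: "1 + \<epsilon> * k z * \<Psi> z = b0 + d"
              by (simp add: b0_def d_def algebra_simps)
            have "cmod d \<le> \<eta> * 1"
              unfolding d_def norm_mult[of "_ * _" "\<Psi> z"] using close le1[OF z] \<eta>(1)
              by (intro mult_mono) auto
            thus ?thesis
              unfolding eq using norm_diff_ineq[of b0 d] by (simp add: b_def b0_def)
          qed
          have "e * (1 / 2) \<le> e * b" using b2 e by (intro mult_left_mono) auto
          hence "\<eta> * (2 + e) \<le> e * b" using \<eta>(2) by simp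
          hence "b + \<eta> \<le> (1 + e) * (b - \<eta>)" by (simp add: algebra_simps)
          also have "\<dots> \<le> (1 + e) * cmod (1 + \<epsilon> * k z * \<Psi> z)"
            using den' e by (intro mult_left_mono) auto
          finally have "cmod (\<Psi> z + \<epsilon> * k z) \<le> (1 + e) * cmod (1 + \<epsilon> * k z * \<Psi> z)" using num by simp
          thus "cmod (f z) \<le> 1 + e"
            unfolding f_def norm_divide using den[OF z] by (simp add: pos_divide_le_eq)
        qed
      qed
    qed
  qed
  have neU: "?U \<noteq> UNIV" using x0 by blast
  have "cmod (f z) \<le> 1" if "z \<in> ?U" for z
    using maximum_principle_at_infinity[OF open_compl_real[OF E] connected_compl_real[OF E] neU
          holf eventually_compl_real[OF E] f0 bd that] by blast
  hence "f \<in> ahlfors_class E" by (intro ahlfors_classI[OF E holf f0]) simp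
  hence "cmod (coeff_inf f) \<le> cmod (coeff_inf \<Psi>)" using ahl by (simp add: ahlfors_function_def)
  moreover have "coeff_inf f = coeff_inf \<Psi> + of_real (\<epsilon> * ((v - u) / 4))"
    using coeff_infI[OF limf] by simp
  moreover obtain \<kappa> where \<kappa>: "coeff_inf \<Psi> = of_real \<kappa>" "\<kappa> > 0"
    using ahl by (auto simp: ahlfors_function_def elim!: Reals_cases)
  ultimately have "cmod (of_real (\<kappa> + \<epsilon> * ((v - u) / 4))) \<le> cmod (of_real \<kappa>)" by simp
  hence "\<bar>\<kappa> + \<epsilon> * ((v - u) / 4)\<bar> \<le> \<bar>\<kappa>\<bar>" by (simp only: norm_of_real)
  moreover have "\<epsilon> * ((v - u) / 4) > 0" using \<epsilon>(1) uv(1) by simp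
  ultimately show False using \<kappa>(2) by simp
qed

text \<open>
  Let \<open>E\<close> be the set on which \<open>D\<close> takes values in \<open>[-2, 2]\<close>. Then \<open>joukowski_inv D\<close> competes with \<open>\<Psi>\<close>, and its zeros are
  among those of \<open>\<Psi>\<close>. So \<open>h = \<Psi> / joukowski_inv D\<close> is holomorphic off \<open>E\<close> with boundary values of
  modulus at most one, hence bounded by one, while the extremality of \<open>\<Psi>\<close> gives \<open>cmod h \<ge> 1\<close> at
  infinity; therefore \<open>h = 1\<close>. The residues of \<open>D\<close> may vanish, so that the points of \<open>C\<close> are only treated
  as removable singularities.
\<close>

lemma ahlfors_eq_joukowski_inv:
  assumes E: "compact E" "E \<noteq> {}" and ahl: "ahlfors_function E \<Psi>"
    and C: "finite C" "C \<inter> complex_of_real ` E = {}"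
    and holD: "D holomorphic_on - C"
    and pole: "\<And>c. c \<in> C \<Longrightarrow> \<exists>B. eventually (\<lambda>z. cmod ((z - c) * D z) \<le> B) (at c)"
    and zero: "\<And>c. c \<in> C \<Longrightarrow> \<Psi> c = 0"
    and lim: "((\<lambda>z. D z / z) \<longlongrightarrow> of_real a) at_infinity" and a: "a > 0"
    and off: "\<And>z. z \<notin> complex_of_real ` E \<Longrightarrow> z \<notin> C \<Longrightarrow> D z \<notin> complex_of_real ` {-2..2}"
    and on: "\<And>z. z \<in> complex_of_real ` E \<Longrightarrow> D z \<in> complex_of_real ` {-2..2}"
    and z: "z \<notin> complex_of_real ` E" "z \<notin> C"
  shows "\<Psi> z = joukowski_inv (D z)"
proof -
  define S where "S = - (complex_of_real ` E)"
  note opS = open_compl_real[OF E(1), folded S_def]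
  note conS = connected_compl_real[OF E(1), folded S_def]
  note evS = eventually_compl_real[OF E(1), folded S_def]
  have opSC: "open (S - C)" using opS C(1) by (intro open_Diff finite_imp_closed)
  have cl: "\<Psi> \<in> ahlfors_class E" using ahl by (simp add: ahlfors_function_def)
  hence hol\<Psi>: "\<Psi> holomorphic_on S" and le\<Psi>: "\<And>z. z \<in> S \<Longrightarrow> cmod (\<Psi> z) \<le> 1"
    by (auto simp: ahlfors_class_def S_def)
  obtain \<kappa> where \<kappa>: "coeff_inf \<Psi> = of_real \<kappa>" "\<kappa> > 0"
    using ahl by (auto simp: ahlfors_function_def elim!: Reals_cases)
  let ?w = "\<lambda>z. joukowski_inv (D z)"
  have cut: "D z \<notin> complex_of_real ` {-2..2}" if "z \<in> S - C" for z
    using off that by (simp add: S_def)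
  have evC: "eventually (\<lambda>z. z \<in> S - C) (at c)" if "c \<in> C" for c
  proof -
    have "open (S - (C - {c}))" using opS C(1) by (intro open_Diff finite_imp_closed) auto
    moreover have "c \<in> S - (C - {c})" using C(2) that by (auto simp: S_def)
    ultimately have "eventually (\<lambda>z. z \<in> S - (C - {c})) (at c)" by (rule eventually_at_in_open')
    thus ?thesis using eventually_neq_at_within[of c c UNIV] by eventually_elim auto
  qed
  have evinf: "eventually (\<lambda>z. z \<in> S - C) at_infinity"
  proof -
    obtain B where B: "\<And>z. z \<in> C \<Longrightarrow> norm z \<le> B"
      using finite_imp_bounded[OF C(1)] unfolding bounded_iff by blast
    have "eventually (\<lambda>z::complex. norm z \<ge> B + 1) at_infinity" by (auto simp: eventually_at_infinity)
    with evS show ?thesis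
    proof eventually_elim
      case (elim z)
      thus ?case using B[of z] by fastforce
    qed
  qed
  have holw: "?w holomorphic_on (S - C)"
    by (rule holomorphic_joukowski_inv'[OF holomorphic_on_subset[OF holD]]) (use cut in auto)
  have limw: "((\<lambda>z. z * ?w z) \<longlongrightarrow> 1 / of_real a) at_infinity"
  proof (rule joukowski_inv_at_infinity[OF _ lim])
    show "complex_of_real a \<noteq> 0" using a by simp
    show "eventually (\<lambda>z. D z \<notin> complex_of_real ` {-2..2}) at_infinity"
      using evinf by eventually_elim (rule cut)
  qed
  \<comment> \<open>The competitor in the extremal problem.\<close>
  obtain \<psi> where hol\<psi>: "\<psi> holomorphic_on S" and \<psi>: "\<And>z. z \<in> S - C \<Longrightarrow> \<psi> z = ?w z"
  proof -
    have "\<exists>B. eventually (\<lambda>z. cmod (?w z) \<le> B) (at c)" if "c \<in> C" for c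
      using evC[OF that] by (intro exI[of _ 1]) (auto elim!: eventually_mono intro!: less_imp_le[OF joukowski_inv(2)] cut)
    thus ?thesis using removable_finite[OF C(1) opS holw] that by blast
  qed
  have le\<psi>: "cmod (\<psi> z) \<le> 1" if "z \<in> S" for z
  proof (cases "z \<in> C")
    case False
    thus ?thesis using \<psi>[of z] joukowski_inv(2)[OF cut[of z]] that by simp
  next
    case True
    have "continuous_on S \<psi>" using hol\<psi> by (rule holomorphic_on_imp_continuous_on)
    hence "isCont \<psi> z" using opS that by (simp add: continuous_on_eq_continuous_at)
    hence "((\<lambda>z. cmod (\<psi> z)) \<longlongrightarrow> cmod (\<psi> z)) (at z)"
      by (intro tendsto_norm) (simp add: isCont_def)
    moreover have "eventually (\<lambda>z. cmod (\<psi> z) \<le> 1) (at z)"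
      using evC[OF True]
    proof eventually_elim
      case (elim y)
      show ?case using \<psi>[OF elim] joukowski_inv(2)[OF cut[OF elim]] by simp
    qed
    ultimately show ?thesis by (rule tendsto_upperbound) simp
  qed
  have lim\<psi>: "((\<lambda>z. z * \<psi> z) \<longlongrightarrow> 1 / of_real a) at_infinity"
    by (rule Lim_transform_eventually[OF limw]) (use evinf \<psi> in \<open>auto elim!: eventually_mono\<close>)
  have "\<psi> \<in> ahlfors_class E"
    using le\<psi> by (intro ahlfors_classI[OF E(1) hol\<psi>[unfolded S_def] tendsto_zero_of_mult_id[OF lim\<psi>]])
      (simp add: S_def)
  hence "cmod (coeff_inf \<psi>) \<le> cmod (coeff_inf \<Psi>)" using ahl by (simp add: ahlfors_function_def)
  moreover have "coeff_inf \<psi> = of_real (1 / a)" using coeff_infI[OF lim\<psi>] by simp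
  ultimately have "1 / a \<le> \<kappa>" using \<kappa> a by (simp add: norm_divide)
  hence L1: "\<kappa> * a \<ge> 1" using a by (simp add: field_simps)
  have inv_w: "1 / ?w z = D z - ?w z" if "z \<in> S - C" for z
    using joukowski_inv(3)[OF cut[OF that]] by (simp add: algebra_simps)
  \<comment> \<open>Near a point \<open>c\<close> of \<open>C\<close>, the zero of \<open>\<Psi>\<close> compensates the growth of \<open>1 / joukowski_inv D = D - joukowski_inv D\<close>.\<close>
  obtain h where holh: "h holomorphic_on S" and h: "\<And>z. z \<in> S - C \<Longrightarrow> h z = \<Psi> z / ?w z"
  proof -
    have "(\<lambda>z. \<Psi> z / ?w z) holomorphic_on (S - C)"
      by (intro holomorphic_intros holw holomorphic_on_subset[OF hol\<Psi>])
         (use joukowski_inv(1) cut in auto)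
    moreover have "\<exists>B. eventually (\<lambda>z. cmod (\<Psi> z / ?w z) \<le> B) (at c)" if c: "c \<in> C" for c
    proof -
      have cS: "c \<in> S" using C(2) c by (auto simp: S_def)
      obtain d where "(\<Psi> has_field_derivative d) (at c)"
        using hol\<Psi> opS cS by (metis holomorphic_derivI)
      hence "((\<lambda>z. (\<Psi> z - \<Psi> c) / (z - c)) \<longlongrightarrow> d) (at c)"
        by (simp add: has_field_derivative_iff)
      hence "((\<lambda>z. cmod (\<Psi> z / (z - c))) \<longlongrightarrow> cmod d) (at c)"
        using zero[OF c] by (intro tendsto_norm) simp
      hence ev1: "eventually (\<lambda>z. cmod (\<Psi> z / (z - c)) < cmod d + 1) (at c)"
        by (rule order_tendstoD(2)) simp
      obtain B where ev2: "eventually (\<lambda>z. cmod ((z - c) * D z) \<le> B) (at c)" using pole[OF c] by blast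
      have "eventually (\<lambda>z. cmod (\<Psi> z / ?w z) \<le> (cmod d + 1) * B + 1) (at c)"
        using ev1 ev2 evC[OF c] eventually_neq_at_within[of c c UNIV]
      proof eventually_elim
        case (elim z)
        have "\<Psi> z / ?w z = (\<Psi> z / (z - c)) * ((z - c) * D z) - \<Psi> z * ?w z"
        proof -
          have "\<Psi> z / ?w z = \<Psi> z * (1 / ?w z)" by simp
          also have "\<dots> = \<Psi> z * (D z - ?w z)" by (simp only: inv_w[OF elim(3)])
          also have "\<dots> = \<Psi> z * D z - \<Psi> z * ?w z" by (rule right_diff_distrib)
          also have "\<Psi> z * D z = (\<Psi> z / (z - c)) * ((z - c) * D z)" using elim(4) by simp
          finally show ?thesis .
        qed
        hence "cmod (\<Psi> z / ?w z) \<le> cmod (\<Psi> z / (z - c)) * cmod ((z - c) * D z) + cmod (\<Psi> z) * cmod (?w z)"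
          by (metis norm_mult norm_triangle_ineq4)
        also have "\<dots> \<le> (cmod d + 1) * B + 1 * 1"
          using elim(1,2) le\<Psi>[of z] elim(3) joukowski_inv(2)[OF cut[OF elim(3)]]
          by (intro add_mono mult_mono) auto
        finally show ?case by simp
      qed
      thus ?thesis by blast
    qed
    ultimately show ?thesis using removable_finite[OF C(1) opS] that by blast
  qed
  have limh: "(h \<longlongrightarrow> of_real (\<kappa> * a)) at_infinity"
  proof -
    have "((\<lambda>z. (z * \<Psi> z) / (z * ?w z)) \<longlongrightarrow> of_real \<kappa> / (1 / of_real a)) at_infinity"
      using ahlfors_class_limits(2)[OF cl] a by (intro tendsto_divide limw) (simp_all add: \<kappa>)
    moreover have "of_real \<kappa> / (1 / of_real a) = complex_of_real (\<kappa> * a)" by simp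
    moreover have "eventually (\<lambda>z. (z * \<Psi> z) / (z * ?w z) = h z) at_infinity"
    proof -
      have "eventually (\<lambda>z::complex. norm z \<ge> 1) at_infinity" by (auto simp: eventually_at_infinity)
      with evinf show ?thesis
      proof eventually_elim
        case (elim z)
        hence "z \<noteq> 0" by auto
        thus ?case using h[OF elim(1)] by simp
      qed
    qed
    ultimately show ?thesis using Lim_transform_eventually by fastforce
  qed
  have bd: "eventually (\<lambda>z. z \<in> S \<longrightarrow> cmod (h z) \<le> 1 + e) (nhds x)" if x: "x \<notin> S" and e: "e > 0" for x e
  proof -
    have xE: "x \<in> complex_of_real ` E" using x by (simp add: S_def)
    hence xC: "x \<in> - C" using C(2) by blast
    have opC: "open (- C)" using C(1) by (intro open_Compl finite_imp_closed)
    have "isCont D x"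
      using holomorphic_on_imp_continuous_on[OF holD] opC xC by (simp add: continuous_on_eq_continuous_at)
    hence cont: "isCont (\<lambda>z. cmod (D z - 2) + cmod (D z + 2)) x" by (intro continuous_intros)
    have "cmod (D x - 2) + cmod (D x + 2) = 4" by (rule ellipse_sum_cut[OF on[OF xE]])
    also have "4 < 2 * ((1 + e) + 1 / (1 + e))"
    proof -
      have "0 < e\<^sup>2 / (1 + e)" using e by simp
      also have "e\<^sup>2 / (1 + e) = (1 + e) + 1 / (1 + e) - 2"
        using e by (simp add: field_simps power2_eq_square)
      finally show ?thesis by simp
    qed
    finally have lt: "cmod (D x - 2) + cmod (D x + 2) < 2 * ((1 + e) + 1 / (1 + e))" .
    have "eventually (\<lambda>z. cmod (D z - 2) + cmod (D z + 2) < 2 * ((1 + e) + 1 / (1 + e))) (nhds x)"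
      unfolding eventually_nhds_conv_at
      using order_tendstoD(2)[OF cont[unfolded isCont_def] lt] lt by simp
    moreover have "eventually (\<lambda>z. z \<in> - C) (nhds x)"
      using opC xC by (rule eventually_nhds_in_open)
    ultimately show ?thesis
    proof eventually_elim
      case (elim z)
      show ?case
      proof
        assume "z \<in> S"
        hence zSC: "z \<in> S - C" using elim(2) by simp
        note w = joukowski_inv[OF cut[OF zSC]]
        define t where "t = 1 / cmod (?w z)"
        have t0: "t > 0" using w(1) by (simp add: t_def)
        have "1 / t + t < (1 + e) + 1 / (1 + e)"
          using joukowski_ellipse[OF w(1) w(3)[symmetric]] elim(1) by (simp add: t_def)
        have "t \<le> 1 + e"
        proof (rule ccontr)
          assume "\<not> t \<le> 1 + e"
          hence gt: "t > 1 + e" by simp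
          have "t * (1 + e) > 1 * 1" using gt e by (intro mult_strict_mono) auto
          hence "1 / (t * (1 + e)) < 1" using t0 e by (simp add: field_simps)
          hence "0 < (t - (1 + e)) * (1 - 1 / (t * (1 + e)))" using gt by simp
          also have "(t - s) * (1 - 1 / (t * s)) = (1 / t + t) - (s + 1 / s)" if "s > 0" for s
            using t0 that by (simp add: field_simps)
          hence "(t - (1 + e)) * (1 - 1 / (t * (1 + e))) = (1 / t + t) - ((1 + e) + 1 / (1 + e))"
            using e by simp
          finally show False using \<open>1 / t + t < _\<close> by simp
        qed
        have "cmod (h z) = cmod (\<Psi> z) * t" using h[OF zSC] by (simp add: norm_divide t_def)
        also have "\<dots> \<le> 1 * (1 + e)" using le\<Psi>[of z] zSC \<open>t \<le> 1 + e\<close> t0 by (intro mult_mono) auto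
        finally show "cmod (h z) \<le> 1 + e" by simp
      qed
    qed
  qed
  have SU: "S \<noteq> UNIV" using E(2) by (auto simp: S_def)
  have h1: "cmod (h z) \<le> 1" if "z \<in> S" for z
    using maximum_principle_at_infinity[OF opS conS SU holh evS limh bd that] by blast
  have "\<bar>\<kappa> * a\<bar> \<le> 1" unfolding norm_of_real[of "\<kappa> * a", where 'a = complex, symmetric]
    by (rule tendsto_upperbound[OF tendsto_norm[OF limh]])
       (use evS h1 in \<open>auto elim: eventually_mono simp: trivial_limit_at_infinity\<close>)
  hence L: "\<kappa> * a = 1" using L1 by simp
  have "z \<in> S" using z by (simp add: S_def)
  have "h z = of_real (\<kappa> * a)"
    by (rule tendsto_max_at_infinity_const[OF opS conS holh evS limh _ \<open>z \<in> S\<close>]) (use h1 L in simp)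
  hence "\<Psi> z / ?w z = 1" using h[of z] \<open>z \<in> S\<close> z(2) L by simp
  thus ?thesis by simp
qed

section \<open>Partial fractions\<close>

text \<open>
  The rational function with linear part \<open>a z + b\<close> and simple poles at the points
  \<open>c 1, \<dots>, c g\<close>, the residue at \<open>c j\<close> being \<open>- l j\<close> if these are distinct. At the poles its values are those given by division by zero.
\<close>

definition partial_fractions ::
  "nat \<Rightarrow> (nat \<Rightarrow> real) \<Rightarrow> real \<Rightarrow> real \<Rightarrow> (nat \<Rightarrow> real) \<Rightarrow> complex \<Rightarrow> complex" where
  "partial_fractions g c a b l z =
     of_real a * z + of_real b + (\<Sum>j=1..g. of_real (l j) / (of_real (c j) - z))"

lemma holomorphic_partial_fractions:
  "partial_fractions g c a b l holomorphic_on - ((\<lambda>j. of_real (c j)) ` {1..g})"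
  unfolding partial_fractions_def[abs_def] by (intro holomorphic_intros) auto

lemma partial_fractions_residue:
  assumes "inj_on c {1..g}" "k \<in> {1..g}"
  shows "((\<lambda>z. (z - of_real (c k)) * partial_fractions g c a b l z) \<longlongrightarrow> - of_real (l k))
    (at (of_real (c k)))"
proof -
  let ?c = "complex_of_real (c k)"
  let ?s = "\<lambda>z. \<Sum>j\<in>{1..g} - {k}. of_real (l j) / (of_real (c j) - z)"
  have "((\<lambda>z. (z - ?c) * (of_real a * z + of_real b + ?s z) - of_real (l k)) \<longlongrightarrow>
     (?c - ?c) * (of_real a * ?c + of_real b + ?s ?c) - of_real (l k)) (at ?c)"
    using assms by (intro tendsto_intros) (auto dest: inj_onD)
  moreover have "eventually (\<lambda>z. (z - ?c) * (of_real a * z + of_real b + ?s z) - of_real (l k) =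
      (z - ?c) * partial_fractions g c a b l z) (at ?c)"
    using eventually_neq_at_within[of ?c ?c UNIV]
  proof eventually_elim
    case (elim z)
    have "partial_fractions g c a b l z = of_real a * z + of_real b + ?s z + of_real (l k) / (?c - z)"
      unfolding partial_fractions_def using assms(2) by (simp add: sum.remove[of _ k])
    moreover have "(z - ?c) * (of_real (l k) / (?c - z)) = - of_real (l k)"
      using elim by (simp add: field_simps)
    ultimately show ?case by (simp only: distrib_left diff_conv_add_uminus)
  qed
  ultimately show ?thesis by (simp add: tendsto_cong)
qed

lemma partial_fractions_remainder:
  "((\<lambda>z. partial_fractions g c a b l z - of_real a * z) \<longlongrightarrow> of_real b) at_infinity"
proof -
  have lim0: "((\<lambda>z::complex. of_real (l j) / (of_real (c j) - z)) \<longlongrightarrow> 0) at_infinity" for j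
  proof -
    have "filterlim (\<lambda>z::complex. z + - of_real (c j)) at_infinity at_infinity"
      by (rule tendsto_add_filterlim_at_infinity'[OF filterlim_ident tendsto_const])
    hence "((\<lambda>z::complex. - of_real (l j) / (z + - of_real (c j))) \<longlongrightarrow> 0) at_infinity"
      by (intro tendsto_divide_0[OF tendsto_const])
    moreover have "- of_real (l j) / (z + - of_real (c j)) = of_real (l j) / (of_real (c j) - z)"
      for z :: complex
      by (metis minus_diff_eq minus_divide_divide diff_conv_add_uminus minus_minus)
    ultimately show ?thesis by simp
  qed
  have "((\<lambda>z::complex. of_real b + (\<Sum>j=1..g. of_real (l j) / (of_real (c j) - z))) \<longlongrightarrow>
      of_real b + (\<Sum>j=1..g. 0)) at_infinity"
    by (intro tendsto_add tendsto_const tendsto_sum lim0)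
  thus ?thesis by (simp add: partial_fractions_def algebra_simps)
qed

lemma partial_fractions_leading:
  "((\<lambda>z. partial_fractions g c a b l z / z) \<longlongrightarrow> of_real a) at_infinity"
proof -
  have "((\<lambda>z. of_real a + (partial_fractions g c a b l z - of_real a * z) * inverse z) \<longlongrightarrow>
     of_real a + of_real b * 0) at_infinity"
    by (intro tendsto_intros partial_fractions_remainder tendsto_inverse_0)
  moreover have "eventually (\<lambda>z. of_real a + (partial_fractions g c a b l z - of_real a * z) * inverse z =
      partial_fractions g c a b l z / z) at_infinity"
    unfolding eventually_at_infinity
  proof (intro exI[of _ 1] allI impI)
    fix z :: complex assume "1 \<le> norm z"
    hence "z \<noteq> 0" by auto
    thus "of_real a + (partial_fractions g c a b l z - of_real a * z) * inverse z =
      partial_fractions g c a b l z / z" by (simp add: field_simps)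
  qed
  ultimately show ?thesis by (simp add: tendsto_cong)
qed

lemma partial_fractions_unique:
  assumes inj: "inj_on c {1..g}"
    and inf: "eventually (\<lambda>z. partial_fractions g c a b l z = partial_fractions g c a' b' l' z) at_infinity"
    and pole: "\<And>k. k \<in> {1..g} \<Longrightarrow>
      eventually (\<lambda>z. partial_fractions g c a b l z = partial_fractions g c a' b' l' z) (at (of_real (c k)))"
  shows "a = a'" "b = b'" "\<And>k. k \<in> {1..g} \<Longrightarrow> l k = l' k"
proof -
  have "((\<lambda>z. partial_fractions g c a b l z / z) \<longlongrightarrow> of_real a') at_infinity"
    by (rule Lim_transform_eventually[OF partial_fractions_leading[of g c a' b' l']])
       (use inf in eventually_elim, simp)
  hence "complex_of_real a = of_real a'"
    using partial_fractions_leading[of g c a b l]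
    by (intro tendsto_unique[of at_infinity]) (simp_all add: trivial_limit_at_infinity)
  thus aa: "a = a'" by simp
  have "((\<lambda>z. partial_fractions g c a b l z - of_real a * z) \<longlongrightarrow> of_real b') at_infinity"
    by (rule Lim_transform_eventually[OF partial_fractions_remainder[of g c a' b' l']])
       (use inf in eventually_elim, simp add: aa)
  hence "complex_of_real b = of_real b'"
    using partial_fractions_remainder[of g c a b l]
    by (intro tendsto_unique[of at_infinity]) (simp_all add: trivial_limit_at_infinity)
  thus "b = b'" by simp
  fix k assume k: "k \<in> {1..g}"
  have "((\<lambda>z. (z - of_real (c k)) * partial_fractions g c a b l z) \<longlongrightarrow> - of_real (l' k))
    (at (of_real (c k)))"
    by (rule Lim_transform_eventually[OF partial_fractions_residue[OF inj k, of a' b' l']])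
       (use pole[OF k] in eventually_elim, simp)
  hence "- complex_of_real (l k) = - of_real (l' k)"
    using partial_fractions_residue[OF inj k, of a b l]
    by (intro tendsto_unique[of "at (complex_of_real (c k))"]) simp_all
  thus "l k = l' k" by simp
qed

section \<open>Bounded operators on square-summable sequences\<close>

lemma ell2_eqI: "(\<And>n. coord x n = coord y n) \<Longrightarrow> x = y"
  using coord_inject by blast

lemma coord_simps [simp]:
  "coord 0 n = 0" "coord (x + y) n = coord x n + coord y n" "coord (- x) n = - coord x n"
  "coord (r *\<^sub>R x) n = r *\<^sub>R coord x n" "coord (scale_ell2 a x) n = a * coord x n"
  "coord (basis_ell2 m) n = (if n = m then 1 else 0)"
  by (simp_all add: zero_ell2.rep_eq plus_ell2.rep_eq uminus_ell2.rep_eq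
      scaleR_ell2.rep_eq scale_ell2.rep_eq basis_ell2.rep_eq)

lemma coord_diff [simp]: "coord (x - y) n = coord x n - coord y n"
  by (simp only: minus_ell2_def coord_simps diff_conv_add_uminus)

lemma coord_sum [simp]: "coord (\<Sum>i\<in>I. f i) n = (\<Sum>i\<in>I. coord (f i) n)"
  by (induction I rule: infinite_finite_induct) auto

lemma scaleR_eq_scale_ell2: "r *\<^sub>R x = scale_ell2 (of_real r) x"
  by (rule ell2_eqI) (simp add: scaleR_conv_of_real)

lemma coord_square_summable: "(\<lambda>n. (cmod (coord x n))\<^sup>2) summable_on UNIV"
  using coord[of x] by simp

lemma norm_ell2_square: "(norm x)\<^sup>2 = (\<Sum>\<^sub>\<infinity>n. (cmod (coord x n))\<^sup>2)"
  by (simp add: norm_ell2.rep_eq infsum_nonneg)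

lemma sum_coord_le_norm:
  assumes "finite F"
  shows "(\<Sum>n\<in>F. (cmod (coord x n))\<^sup>2) \<le> (norm x)\<^sup>2"
  unfolding norm_ell2_square
  by (rule finite_sum_le_infsum[OF coord_square_summable assms]) auto

lemma coord_le_norm: "cmod (coord x n) \<le> norm x"
  by (rule power2_le_imp_le) (use sum_coord_le_norm[of "{n}" x] in auto)

lemma norm_ell2_leI:
  assumes "\<And>F. finite F \<Longrightarrow> (\<Sum>n\<in>F. (cmod (coord x n))\<^sup>2) \<le> b\<^sup>2" "b \<ge> 0"
  shows "norm x \<le> b"
proof -
  have "(norm x)\<^sup>2 \<le> b\<^sup>2"
    unfolding norm_ell2_square by (rule infsum_le_finite_sums[OF coord_square_summable]) (rule assms(1))
  thus ?thesis using assms(2) by (rule power2_le_imp_le)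
qed

lemma ell2_of_bounded_sums:
  assumes "\<And>F. finite F \<Longrightarrow> (\<Sum>n\<in>F. (cmod (f n))\<^sup>2) \<le> B"
  obtains x where "coord x = f"
proof -
  have "(\<lambda>n. (cmod (f n))\<^sup>2) summable_on UNIV"
  proof (rule nonneg_bdd_above_summable_on)
    show "bdd_above (sum (\<lambda>n. (cmod (f n))\<^sup>2) ` {F. F \<subseteq> UNIV \<and> finite F})"
      by (rule bdd_aboveI2[of _ _ B]) (use assms in auto)
  qed auto
  hence "coord (Abs_ell2 f) = f" by (simp add: Abs_ell2_inverse)
  thus ?thesis by (rule that)
qed

lemma complete_ell2: "complete (UNIV :: ell2 set)"
proof (rule completeI)
  fix X :: "nat \<Rightarrow> ell2" assume X: "Cauchy X"
  have "convergent (\<lambda>k. coord (X k) n)" for n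
  proof (rule Cauchy_convergent, rule CauchyI)
    fix e :: real assume "e > 0"
    then obtain M where M: "\<And>k l. k \<ge> M \<Longrightarrow> l \<ge> M \<Longrightarrow> norm (X k - X l) < e"
      using X by (meson CauchyD)
    show "\<exists>M. \<forall>k\<ge>M. \<forall>l\<ge>M. norm (coord (X k) n - coord (X l) n) < e"
    proof (intro exI[of _ M] allI impI)
      fix k l assume "k \<ge> M" "l \<ge> M"
      thus "norm (coord (X k) n - coord (X l) n) < e"
        using M[of k l] coord_le_norm[of "X k - X l" n] by simp
    qed
  qed
  then obtain f where f: "\<And>n. (\<lambda>k. coord (X k) n) \<longlonglongrightarrow> f n"
    unfolding convergent_def by metis
  \<comment> \<open>A Fatou argument on finite index sets.\<close>
  have tail: "(\<Sum>n\<in>F. (cmod (coord (X k) n - f n))\<^sup>2) \<le> e\<^sup>2"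
    if "finite F" and M: "\<And>k l. k \<ge> M \<Longrightarrow> l \<ge> M \<Longrightarrow> norm (X k - X l) < e" and k: "k \<ge> M" for F k M e
  proof (rule tendsto_upperbound)
    show "(\<lambda>l. \<Sum>n\<in>F. (cmod (coord (X k) n - coord (X l) n))\<^sup>2) \<longlonglongrightarrow>
        (\<Sum>n\<in>F. (cmod (coord (X k) n - f n))\<^sup>2)"
      by (intro tendsto_intros f)
    show "eventually (\<lambda>l. (\<Sum>n\<in>F. (cmod (coord (X k) n - coord (X l) n))\<^sup>2) \<le> e\<^sup>2) sequentially"
      using eventually_ge_at_top[of M]
    proof eventually_elim
      case (elim l)
      have "(\<Sum>n\<in>F. (cmod (coord (X k - X l) n))\<^sup>2) \<le> (norm (X k - X l))\<^sup>2"
        by (rule sum_coord_le_norm[OF \<open>finite F\<close>])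
      also have "\<dots> \<le> e\<^sup>2" using M[OF k elim] by (intro power_mono) auto
      finally show ?case by simp
    qed
  qed simp
  obtain M where M: "\<And>k l. k \<ge> M \<Longrightarrow> l \<ge> M \<Longrightarrow> norm (X k - X l) < 1"
    using X by (meson CauchyD zero_less_one)
  have "(\<Sum>n\<in>F. (cmod (coord (X M) n - f n))\<^sup>2) \<le> 1\<^sup>2" if "finite F" for F
    by (rule tail[OF that M order_refl])
  then obtain y where y: "coord y = (\<lambda>n. coord (X M) n - f n)"
    using ell2_of_bounded_sums[of "\<lambda>n. coord (X M) n - f n" "1\<^sup>2"] by blast
  define x where "x = X M - y"
  have x: "coord x n = f n" for n by (simp add: x_def y)
  have "X \<longlonglongrightarrow> x"
  proof (rule LIMSEQ_I)
    fix r :: real assume r: "r > 0"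
    obtain M where M: "\<And>k l. k \<ge> M \<Longrightarrow> l \<ge> M \<Longrightarrow> norm (X k - X l) < r / 2"
      using X r by (meson CauchyD half_gt_zero)
    show "\<exists>no. \<forall>n\<ge>no. norm (X n - x) < r"
    proof (intro exI[of _ M] allI impI)
      fix k assume k: "k \<ge> M"
      have "norm (X k - x) \<le> r / 2"
        by (rule norm_ell2_leI) (use tail[OF _ M k] r in \<open>simp_all add: x\<close>)
      thus "norm (X k - x) < r" using r by simp
    qed
  qed
  thus "\<exists>l\<in>UNIV. X \<longlonglongrightarrow> l" by blast
qed

lemma norm_scale_ell2: "norm (scale_ell2 a x) = cmod a * norm x"
proof -
  have "(norm (scale_ell2 a x))\<^sup>2 = (cmod a * norm x)\<^sup>2"
    unfolding power_mult_distrib norm_ell2_square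
    by (simp add: norm_mult power_mult_distrib infsum_cmult_right')
  thus ?thesis by (rule power2_eq_imp_eq) auto
qed

lemma scale_ell2_simps:
  "scale_ell2 a (x + y) = scale_ell2 a x + scale_ell2 a y"
  "scale_ell2 a (x - y) = scale_ell2 a x - scale_ell2 a y"
  "scale_ell2 a (scale_ell2 b x) = scale_ell2 (a * b) x"
  "scale_ell2 a 0 = 0" "scale_ell2 1 x = x" "scale_ell2 0 x = 0"
  by (rule ell2_eqI, simp add: algebra_simps)+

lemma bounded_opI:
  assumes "\<And>x y. T (x + y) = T x + T y" "\<And>a x. T (scale_ell2 a x) = scale_ell2 a (T x)"
    and "\<And>x. norm (T x) \<le> K * norm x"
  shows "bounded_op T"
proof -
  have "bounded_linear T"
    by (rule bounded_linear_intro[of _ K])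
       (use assms in \<open>simp_all add: scaleR_eq_scale_ell2 mult.commute\<close>)
  thus ?thesis using assms(2) by (simp add: bounded_op_def)
qed

lemma bounded_op_id: "bounded_op (\<lambda>x. x)"
  by (rule bounded_opI[of _ 1]) auto

lemma bounded_op_comp: "bounded_op S \<Longrightarrow> bounded_op T \<Longrightarrow> bounded_op (\<lambda>x. S (T x))"
  by (simp add: bounded_op_def bounded_linear_compose)

lemma bounded_op_scale: "bounded_op T \<Longrightarrow> bounded_op (\<lambda>x. scale_ell2 a (T x))"
proof -
  have "bounded_op (scale_ell2 a)"
    by (rule bounded_opI[of _ "cmod a"]) (simp_all add: scale_ell2_simps norm_scale_ell2 mult.commute)
  thus "bounded_op T \<Longrightarrow> bounded_op (\<lambda>x. scale_ell2 a (T x))" by (rule bounded_op_comp)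
qed

lemma bounded_op_diff: "bounded_op S \<Longrightarrow> bounded_op T \<Longrightarrow> bounded_op (\<lambda>x. S x - T x)"
  by (simp add: bounded_op_def bounded_linear_sub scale_ell2_simps)

lemma bounded_op_sum: "(\<And>i. i \<in> I \<Longrightarrow> bounded_op (T i)) \<Longrightarrow> bounded_op (\<lambda>x. \<Sum>i\<in>I. T i x)"
proof (induction I rule: infinite_finite_induct)
  case (insert i I)
  thus ?case by (simp add: bounded_op_def bounded_linear_add scale_ell2_simps)
qed (simp_all add: bounded_op_def bounded_linear_zero scale_ell2_simps)

lemma bounded_op_simps:
  assumes "bounded_op T"
  shows "T (x + y) = T x + T y" "T (x - y) = T x - T y" "T (scale_ell2 a x) = scale_ell2 a (T x)"
    "T (\<Sum>i\<in>I. f i) = (\<Sum>i\<in>I. T (f i))" "T 0 = 0"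
  using assms
  by (auto simp: bounded_op_def linear_simps linear_sum bounded_linear.linear)

lemma bounded_op_bound:
  assumes "bounded_op T"
  obtains K where "K > 0" "\<And>x. norm (T x) \<le> K * norm x"
proof -
  obtain K where K: "K > 0" "\<forall>x. norm (T x) \<le> norm x * K"
    using assms bounded_linear.pos_bounded[of T] unfolding bounded_op_def by blast
  show ?thesis by (rule that[OF K(1)]) (use K(2) in \<open>simp add: mult.commute\<close>)
qed

text \<open>Bounded operators are determined by their values on the standard basis.\<close>

lemma bounded_op_eqI:
  assumes "bounded_op S" "bounded_op T" and eq: "\<And>n. S (basis_ell2 n) = T (basis_ell2 n)"
  shows "S = T"
proof
  fix x
  have D: "bounded_op (\<lambda>x. S x - T x)" using assms(1,2) by (rule bounded_op_diff)
  obtain K where K: "K > 0" "\<And>x. norm (S x - T x) \<le> K * norm x"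
    by (rule bounded_op_bound[OF D]) blast
  have "norm (S x - T x) \<le> e" if e: "e > 0" for e
  proof -
    define e' where "e' = e / K"
    have e': "e' > 0" using e K(1) by (simp add: e'_def)
    let ?f = "\<lambda>n. (cmod (coord x n))\<^sup>2"
    have "(?f has_sum infsum ?f UNIV) UNIV" using coord_square_summable by (rule has_sum_infsum)
    hence "eventually (\<lambda>F. dist (sum ?f F) (infsum ?f UNIV) < e'\<^sup>2) (finite_subsets_at_top UNIV)"
      unfolding has_sum_def using e' by (intro tendstoD) auto
    then obtain F where F: "finite F" and
      "\<forall>Y. finite Y \<and> F \<subseteq> Y \<and> Y \<subseteq> UNIV \<longrightarrow> dist (sum ?f Y) (infsum ?f UNIV) < e'\<^sup>2"
      unfolding eventually_finite_subsets_at_top by blast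
    hence Fe: "dist (sum ?f F) (infsum ?f UNIV) < e'\<^sup>2" by blast
    define y where "y = (\<Sum>n\<in>F. scale_ell2 (coord x n) (basis_ell2 n))"
    have y: "coord y n = (if n \<in> F then coord x n else 0)" for n
    proof -
      have "coord y n = (\<Sum>m\<in>F. if n = m then coord x m else 0)"
        unfolding y_def coord_sum by (rule sum.cong) auto
      thus ?thesis using F by simp
    qed
    have xy: "norm (x - y) \<le> e'"
    proof (rule norm_ell2_leI)
      fix G :: "int set" assume G: "finite G"
      have "(\<Sum>n\<in>G. (cmod (coord (x - y) n))\<^sup>2) = (\<Sum>n\<in>G. if n \<in> F then 0 else ?f n)"
        by (intro sum.cong) (auto simp: y)
      also have "\<dots> = sum ?f (G - F)"
        using G by (intro sum.mono_neutral_cong_right) auto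
      also have "\<dots> = sum ?f (G \<union> F) - sum ?f F"
      proof -
        have "sum ?f (G \<union> F) = sum ?f ((G - F) \<union> F)" by (simp add: Un_commute)
        also have "\<dots> = sum ?f (G - F) + sum ?f F"
          using G F by (intro sum.union_disjoint) auto
        finally show ?thesis by simp
      qed
      also have "\<dots> \<le> infsum ?f UNIV - sum ?f F"
        using finite_sum_le_infsum[OF coord_square_summable, of "G \<union> F"] G F by simp
      also have "\<dots> \<le> e'\<^sup>2" using Fe by (simp add: dist_real_def)
      finally show "(\<Sum>n\<in>G. (cmod (coord (x - y) n))\<^sup>2) \<le> e'\<^sup>2" .
    qed (use e' in simp)
    have "S y - T y = 0"
      by (simp add: y_def bounded_op_simps[OF assms(1)] bounded_op_simps[OF assms(2)] eq)
    moreover have "S (x - y) - T (x - y) = (S x - T x) - (S y - T y)"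
      unfolding bounded_op_simps(2)[OF assms(1)] bounded_op_simps(2)[OF assms(2)]
      by (simp add: algebra_simps)
    ultimately have "S x - T x = S (x - y) - T (x - y)" by simp
    hence "norm (S x - T x) \<le> K * norm (x - y)" using K(2)[of "x - y"] by simp
    also have "\<dots> \<le> K * e'" using K(1) xy by (intro mult_left_mono) auto
    finally have "norm (S x - T x) \<le> K * e'" .
    thus ?thesis using K(1) by (simp add: e'_def)
  qed
  hence "norm (S x - T x) \<le> 0" by (rule dense_ge)
  thus "S x = T x" by simp
qed

lemma invertible_opI:
  assumes T: "bounded_op T" and L: "bounded_op L" and R: "bounded_op R"
    and LT: "\<And>x. L (T x) = x" and TR: "\<And>x. T (R x) = x"
  shows "invertible_op T"
proof -
  have "L x = R x" for x using LT[of "R x"] TR[of x] by simp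
  hence "T (L x) = x" for x using TR by simp
  thus ?thesis unfolding invertible_op_def using T L LT by (auto simp: fun_eq_iff)
qed

lemma invertible_op_obtain:
  assumes "invertible_op T"
  obtains R where "bounded_op R" "\<And>x. R (T x) = x" "\<And>x. T (R x) = x"
  using assms unfolding invertible_op_def by (auto simp: fun_eq_iff)

lemma invertible_op_comp:
  assumes "invertible_op S" "invertible_op T"
  shows "invertible_op (\<lambda>x. S (T x))"
proof -
  obtain S' where S': "bounded_op S'" "\<And>x. S' (S x) = x" "\<And>x. S (S' x) = x"
    using invertible_op_obtain[OF assms(1)] by blast
  obtain T' where T': "bounded_op T'" "\<And>x. T' (T x) = x" "\<And>x. T (T' x) = x"
    using invertible_op_obtain[OF assms(2)] by blast
  have b: "bounded_op S" "bounded_op T" using assms by (auto simp: invertible_op_def)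
  show ?thesis
  proof (rule invertible_opI)
    show "bounded_op (\<lambda>x. S (T x))" using b by (rule bounded_op_comp)
    show "bounded_op (\<lambda>x. T' (S' x))" using T'(1) S'(1) by (rule bounded_op_comp)
    show "bounded_op (\<lambda>x. T' (S' x))" using T'(1) S'(1) by (rule bounded_op_comp)
  qed (simp_all add: S' T')
qed

lemma invertible_op_scale: "a \<noteq> 0 \<Longrightarrow> invertible_op (scale_ell2 a)"
  using bounded_op_scale[OF bounded_op_id]
  by (intro invertible_opI[of _ "scale_ell2 (1 / a)" "scale_ell2 (1 / a)"]) (auto simp: scale_ell2_simps)

text \<open>The inverse of \<open>1 - B\<close>, obtained from Banach's fixed point theorem.\<close>

lemma invertible_op_contraction:
  assumes B: "bounded_op B" and le: "\<And>x. norm (B x) \<le> c * norm x" and c: "0 \<le> c" "c < 1"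
  shows "invertible_op (\<lambda>x. x - B x)"
proof -
  have T: "bounded_op (\<lambda>x. x - B x)" by (intro bounded_op_diff bounded_op_id B)
  have "\<exists>!x. x - B x = f" for f
  proof -
    have "\<exists>!x\<in>UNIV. (B x + f) = x"
    proof (rule Banach_fix[OF complete_ell2 _ c])
      fix x y
      have "dist (B x + f) (B y + f) = norm (B (x - y))"
        by (simp add: dist_norm bounded_op_simps(2)[OF B])
      thus "dist (B x + f) (B y + f) \<le> c * dist x y" using le[of "x - y"] by (simp add: dist_norm)
    qed auto
    moreover have "(B x + f) = x \<longleftrightarrow> x - B x = f" for x by (auto simp: algebra_simps)
    ultimately show ?thesis by simp
  qed
  then obtain R where R: "\<And>f x. x - B x = f \<longleftrightarrow> x = R f" by metis
  have R1: "R f - B (R f) = f" for f using R by blast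
  have bound: "norm x \<le> 1 / (1 - c) * norm (x - B x)" for x
  proof -
    have "norm x \<le> norm (x - B x) + norm (B x)" using norm_triangle_ineq[of "x - B x" "B x"] by simp
    hence "(1 - c) * norm x \<le> norm (x - B x)" using le[of x] by (simp add: algebra_simps)
    thus ?thesis using c(2) by (simp add: field_simps)
  qed
  have "bounded_op R"
  proof (rule bounded_opI)
    fix x y a
    have "(R x + R y) - B (R x + R y) = x + y"
      using R1[of x] R1[of y] by (simp add: bounded_op_simps[OF B] algebra_simps)
    thus "R (x + y) = R x + R y" using R by metis
    have "scale_ell2 a (R x) - B (scale_ell2 a (R x)) = scale_ell2 a x"
      using R1[of x] by (simp add: bounded_op_simps[OF B] flip: scale_ell2_simps(2))
    thus "R (scale_ell2 a x) = scale_ell2 a (R x)" using R by metis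
    show "norm (R x) \<le> 1 / (1 - c) * norm x" using bound[of "R x"] by (simp add: R1)
  qed
  thus ?thesis using invertible_opI[OF T, of R R] R by metis
qed

text \<open>Translation by \<open>k\<close> followed by the restriction to the index set given by \<open>Q\<close>.\<close>

lift_definition sel_shift :: "(int \<Rightarrow> bool) \<Rightarrow> int \<Rightarrow> ell2 \<Rightarrow> ell2"
  is "\<lambda>Q k x n. if Q n then x (n + k) else 0"
proof -
  fix Q :: "int \<Rightarrow> bool" and k :: int and x :: "int \<Rightarrow> complex"
  assume "(\<lambda>n. (cmod (x n))\<^sup>2) summable_on UNIV"
  moreover have "bij_betw (\<lambda>n::int. n + k) UNIV UNIV"
    by (rule bij_betwI[of _ _ _ "\<lambda>n. n - k"]) auto
  ultimately have "(\<lambda>n. (cmod (x (n + k)))\<^sup>2) summable_on UNIV"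
    using summable_on_reindex_bij_betw[of "\<lambda>n. n + k" UNIV UNIV "\<lambda>n. (cmod (x n))\<^sup>2"] by simp
  thus "(\<lambda>n. (cmod (if Q n then x (n + k) else 0))\<^sup>2) summable_on UNIV"
    by (rule summable_on_comparison_test) auto
qed

lemma coord_sel_shift [simp]: "coord (sel_shift Q k x) n = (if Q n then coord x (n + k) else 0)"
  by (simp add: sel_shift.rep_eq)

lemma norm_sel_shift: "norm (sel_shift Q k x) \<le> norm x"
proof (rule norm_ell2_leI)
  fix F :: "int set" assume F: "finite F"
  have "(\<Sum>n\<in>F. (cmod (coord (sel_shift Q k x) n))\<^sup>2) \<le> (\<Sum>n\<in>F. (cmod (coord x (n + k)))\<^sup>2)"
    by (intro sum_mono) auto
  also have "\<dots> = (\<Sum>n\<in>(\<lambda>n. n + k) ` F. (cmod (coord x n))\<^sup>2)"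
    by (simp add: sum.reindex)
  also have "\<dots> \<le> (norm x)\<^sup>2" using F by (intro sum_coord_le_norm) auto
  finally show "(\<Sum>n\<in>F. (cmod (coord (sel_shift Q k x) n))\<^sup>2) \<le> (norm x)\<^sup>2" .
qed simp

lemma bounded_op_sel_shift: "bounded_op (sel_shift Q k)"
  by (rule bounded_opI[of _ 1]) (auto intro!: ell2_eqI simp: norm_sel_shift)

text \<open>
  With \<open>T\<close> the translation by \<open>N\<close>, the operator \<open>d - T - 1 / T\<close> factors as
  \<open>(1 - \<mu> T) (1 - \<mu> / T) / \<mu>\<close>, where \<open>\<mu> + 1 / \<mu> = d\<close> and \<open>cmod \<mu> < 1\<close>.
\<close>

lemma invertible_op_laplacian:
  assumes d: "d \<notin> complex_of_real ` {-2..2}"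
  shows "invertible_op (\<lambda>x. scale_ell2 d x - sel_shift (\<lambda>_. True) N x - sel_shift (\<lambda>_. True) (- N) x)"
proof -
  let ?T = "sel_shift (\<lambda>_. True)"
  define \<mu> where "\<mu> = joukowski_inv d"
  have \<mu>: "\<mu> \<noteq> 0" "cmod \<mu> < 1" "\<mu> + 1 / \<mu> = d" unfolding \<mu>_def by (rule joukowski_inv[OF d])+
  have inv: "invertible_op (\<lambda>x. x - scale_ell2 \<mu> (?T k x))" for k
    using \<mu>(2) norm_sel_shift[of "\<lambda>_. True" k]
    by (intro invertible_op_contraction[of _ "cmod \<mu>"] bounded_op_scale bounded_op_sel_shift)
       (auto simp: norm_scale_ell2 intro: mult_left_mono)
  have "scale_ell2 d x - ?T N x - ?T (- N) x = scale_ell2 (1 / \<mu>)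
      ((x - scale_ell2 \<mu> (?T (- N) x)) - scale_ell2 \<mu> (?T N (x - scale_ell2 \<mu> (?T (- N) x))))" for x
    by (rule ell2_eqI) (use \<mu>(1) in \<open>simp add: \<mu>(3)[symmetric] field_simps\<close>)
  moreover have "invertible_op (\<lambda>x. scale_ell2 (1 / \<mu>)
      ((x - scale_ell2 \<mu> (?T (- N) x)) - scale_ell2 \<mu> (?T N (x - scale_ell2 \<mu> (?T (- N) x)))))"
    using invertible_op_comp[OF invertible_op_scale[of "1 / \<mu>"] invertible_op_comp[OF inv[of N] inv[of "- N"]]] \<mu>(1)
    by simp
  ultimately show ?thesis by simp
qed

section \<open>The trace of the transfer matrix\<close>

text \<open>
  Real \<open>2 \<times> 2\<close> matrices as complex ones: the functions \<open>\<Lambda>\<^sub>k\<close> are formed with real matrices, while the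
  spectral parameter is complex.
\<close>

definition cmat :: "real^2^2 \<Rightarrow> complex^2^2" where
  "cmat M = (\<chi> i j. of_real (M $ i $ j))"

text \<open>Multiplication of a complex matrix by a complex scalar.\<close>

definition smul :: "complex \<Rightarrow> complex^2^2 \<Rightarrow> complex^2^2" where
  "smul s M = (\<chi> i j. s * M $ i $ j)"

lemma mat2_eqI:
  fixes A B :: "'a^2^2"
  assumes "A $ 1 $ 1 = B $ 1 $ 1" "A $ 1 $ 2 = B $ 1 $ 2" "A $ 2 $ 1 = B $ 2 $ 1" "A $ 2 $ 2 = B $ 2 $ 2"
  shows "A = B"
  using assms by (simp add: vec_eq_iff forall_2)

lemma mat2_mult_nth: "((A :: 'a::semiring_1^2^2) ** B) $ i $ j = A $ i $ 1 * B $ 1 $ j + A $ i $ 2 * B $ 2 $ j"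
  by (simp add: matrix_matrix_mult_def sum_2)

lemma mat2_nth [simp]:
  "mat2 x y z w $ 1 $ 1 = x" "mat2 x y z w $ 1 $ 2 = y"
  "mat2 x y z w $ 2 $ 1 = z" "mat2 x y z w $ 2 $ 2 = w"
  by (simp_all add: mat2_def vec2_def)

lemma mat_nth [simp]:
  fixes a :: "'a::zero"
  shows "(mat a :: 'a^2^2) $ 1 $ 1 = a" "(mat a :: 'a^2^2) $ 1 $ 2 = 0"
  "(mat a :: 'a^2^2) $ 2 $ 1 = 0" "(mat a :: 'a^2^2) $ 2 $ 2 = a"
  by (simp_all add: mat_def)

lemma smul_nth [simp]: "smul s M $ i $ j = s * M $ i $ j"
  by (simp add: smul_def)

lemma cmat_nth [simp]: "cmat M $ i $ j = of_real (M $ i $ j)"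
  by (simp add: cmat_def)

lemma cmat_mult: "cmat (A ** B) = cmat A ** cmat B"
  by (intro mat2_eqI) (simp_all add: mat2_mult_nth)

lemma cmat_1: "cmat (mat 1) = mat 1"
  by (intro mat2_eqI) simp_all

lemma pole_matrix_nth [simp]:
  "pole_matrix p q $ 1 $ 1 = p * q" "pole_matrix p q $ 1 $ 2 = - (p * p)"
  "pole_matrix p q $ 2 $ 1 = q * q" "pole_matrix p q $ 2 $ 2 = - (p * q)"
  by (simp_all add: pole_matrix_def mat2_mult_nth outer_def jmat_def vec2_def)

lemma trace_mat2: "trace (A :: 'a::semiring_1^2^2) = A $ 1 $ 1 + A $ 2 $ 2"
  by (simp add: trace_def sum_2)

lemma trace_cmat: "trace (cmat A) = of_real (trace A)"
  by (simp add: trace_mat2)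

lemma smul_mult_left: "smul s A ** B = smul s (A ** B)"
  by (intro mat2_eqI) (simp_all add: mat2_mult_nth algebra_simps)

lemma smul_mult_right: "A ** smul s B = smul s (A ** B)"
  by (intro mat2_eqI) (simp_all add: mat2_mult_nth algebra_simps)

lemma smul_add: "smul s (A + B) = smul s A + smul s B"
  by (intro mat2_eqI) (simp_all add: algebra_simps)

lemma smul_sum: "smul s (\<Sum>k\<in>I. A k) = (\<Sum>k\<in>I. smul s (A k))"
  by (intro mat2_eqI) (simp_all add: sum_distrib_left)

lemma smul_smul: "smul a (smul b M) = smul (a * b) M"
  by (intro mat2_eqI) simp_all

lemma matrix_add_rdistrib:
  fixes A B C :: "complex^2^2"
  shows "(A + B) ** C = A ** C + B ** C"
  by (intro mat2_eqI) (simp_all add: mat2_mult_nth algebra_simps)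

lemma sum_matrix_mult:
  fixes B :: "complex^2^2" and A :: "'i \<Rightarrow> complex^2^2"
  shows "(\<Sum>k\<in>I. A k) ** B = (\<Sum>k\<in>I. A k ** B)"
  by (intro mat2_eqI) (simp_all add: mat2_mult_nth sum_distrib_right sum.distrib)

lemma trace_add: "trace (A + B) = trace A + trace (B :: complex^2^2)"
  by (simp add: trace_mat2)

lemma trace_smul: "trace (smul s A) = s * trace A"
  by (simp add: trace_mat2 algebra_simps)

lemma trace_sum: "trace (\<Sum>k\<in>I. A k) = (\<Sum>k\<in>I. trace (A k :: complex^2^2))"
  by (simp add: trace_mat2 sum.distrib)

text \<open>The factor \<open>\<aa>(z, c\<^sub>m\<^sub>+\<^sub>1; p\<^sub>m, q\<^sub>m)\<close>, with a pole at \<open>c (m + 1)\<close>.\<close>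

definition tfac :: "(nat \<Rightarrow> real) \<Rightarrow> (nat \<Rightarrow> real) \<Rightarrow> (nat \<Rightarrow> real) \<Rightarrow> complex \<Rightarrow> nat \<Rightarrow> complex^2^2" where
  "tfac c p q z m = mat 1 + smul (1 / (z - of_real (c (m + 1)))) (cmat (pole_matrix (p m) (q m)))"

text \<open>The product of such factors over a list of indices, from left to right.\<close>

definition tprod :: "(nat \<Rightarrow> real) \<Rightarrow> (nat \<Rightarrow> real) \<Rightarrow> (nat \<Rightarrow> real) \<Rightarrow> complex \<Rightarrow> nat list \<Rightarrow> complex^2^2" where
  "tprod c p q z ms = foldr (\<lambda>m M. tfac c p q z m ** M) ms (mat 1)"

text \<open>The factor \<open>\<aa>(z; p, q)\<close>, with a pole at infinity.\<close>

definition tinf :: "complex \<Rightarrow> real \<Rightarrow> real \<Rightarrow> complex^2^2" where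
  "tinf z p q = (\<chi> i j. if i = 1 then (if j = 1 then 0 else - of_real p)
     else (if j = 1 then 1 / of_real p else (z - of_real (p * q)) / of_real p))"

text \<open>The transfer matrix \<open>\<AA>(z)\<close> of a whole period.\<close>

definition monodromy :: "nat \<Rightarrow> (nat \<Rightarrow> real) \<Rightarrow> (nat \<Rightarrow> real) \<Rightarrow> (nat \<Rightarrow> real) \<Rightarrow> complex \<Rightarrow> complex^2^2" where
  "monodromy g c p q z = tprod c p q z [0..<g] ** tinf z (p g) (q g)"

lemma tinf_nth [simp]:
  "tinf z p q $ 1 $ 1 = 0" "tinf z p q $ 1 $ 2 = - of_real p"
  "tinf z p q $ 2 $ 1 = 1 / of_real p" "tinf z p q $ 2 $ 2 = (z - of_real (p * q)) / of_real p"
  by (simp_all add: tinf_def)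

lemma tprod_append: "tprod c p q z (ms @ ns) = tprod c p q z ms ** tprod c p q z ns"
  by (induction ms) (simp_all add: tprod_def matrix_mul_assoc)

lemma tprod_simps [simp]:
  "tprod c p q z [] = mat 1" "tprod c p q z [m] = tfac c p q z m"
  by (simp_all add: tprod_def)

lemma tprod_Suc: "k \<le> n \<Longrightarrow> tprod c p q z [k..<Suc n] = tprod c p q z [k..<n] ** tfac c p q z n"
  by (simp add: tprod_append)

lemma cmat_transfer_fin: "cmat (transfer_fin x (c (m + 1)) (p m) (q m)) = tfac c p q (of_real x) m"
proof -
  have "1 / (c (m + 1) - x) = - (1 / (x - c (m + 1)))"
    by (metis minus_diff_eq divide_minus_right)
  thus ?thesis
    by (intro mat2_eqI) (simp_all add: transfer_fin_def tfac_def)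
qed

lemma cmat_ordered_prod:
  "cmat (ordered_prod (map (\<lambda>m. transfer_fin x (c (m + 1)) (p m) (q m)) ms)) = tprod c p q (of_real x) ms"
  by (induction ms)
     (simp_all add: ordered_prod_def tprod_def cmat_mult cmat_1 cmat_transfer_fin[simplified])

lemma cmat_transfer_inf: "cmat (transfer_inf x p q) = tinf (of_real x) p q"
  by (intro mat2_eqI) (simp_all add: transfer_inf_def)

text \<open>The residue at \<open>c (k + 1)\<close> of the product of the first \<open>n\<close> factors.\<close>

definition tres :: "(nat \<Rightarrow> real) \<Rightarrow> (nat \<Rightarrow> real) \<Rightarrow> (nat \<Rightarrow> real) \<Rightarrow> nat \<Rightarrow> nat \<Rightarrow> complex^2^2" where
  "tres c p q n k = tprod c p q (of_real (c (k + 1))) [0..<k] ** cmat (pole_matrix (p k) (q k)) **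
     tprod c p q (of_real (c (k + 1))) [Suc k..<n]"

lemma tres_Suc:
  assumes "k < n"
  shows "tres c p q (Suc n) k = tres c p q n k + smul (1 / (of_real (c (k + 1)) - of_real (c (n + 1))))
    (tres c p q n k ** cmat (pole_matrix (p n) (q n)))"
proof -
  have "tres c p q (Suc n) k = tres c p q n k ** tfac c p q (of_real (c (k + 1))) n"
    using assms by (simp add: tres_def tprod_Suc matrix_mul_assoc del: upt_Suc)
  thus ?thesis
    by (simp add: tfac_def matrix_add_ldistrib smul_mult_right)
qed

lemma partial_fraction_identity:
  fixes z a b :: complex
  assumes "z \<noteq> a" "z \<noteq> b" "a \<noteq> b"
  shows "1 / (z - a) * (1 / (z - b)) = 1 / (z - a) * (1 / (a - b)) + 1 / (z - b) * (1 / (b - a))"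
proof -
  have ne: "z - a \<noteq> 0" "z - b \<noteq> 0" "a - b \<noteq> 0" using assms by auto
  have "1 / (z - a) - 1 / (z - b) = (a - b) / ((z - a) * (z - b))"
    using ne(1,2) by (simp add: diff_frac_eq)
  hence "1 / (z - a) * (1 / (z - b)) = (1 / (z - a) - 1 / (z - b)) * (1 / (a - b))"
    using ne(3) by simp
  moreover have "1 / (b - a) = - (1 / (a - b))" by (metis minus_diff_eq divide_minus_right)
  ultimately show ?thesis by (simp only: left_diff_distrib mult_minus_right add_uminus_conv_diff)
qed

lemma tprod_partial_fractions:
  assumes "inj_on c {1..n}" "\<And>k. k < n \<Longrightarrow> z \<noteq> of_real (c (k + 1))"
  shows "tprod c p q z [0..<n] =
    mat 1 + (\<Sum>k<n. smul (1 / (z - of_real (c (k + 1)))) (tres c p q n k))"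
  using assms
proof (induction n arbitrary: z)
  case (Suc n)
  let ?c = "complex_of_real (c (n + 1))" and ?P = "cmat (pole_matrix (p n) (q n))"
  let ?s = "\<lambda>k. 1 / (z - complex_of_real (c (k + 1)))"
  have inj: "inj_on c {1..n}" using Suc.prems(1) by (rule inj_on_subset) auto
  have ne: "c (k + 1) \<noteq> c (n + 1)" if "k < n" for k
    using Suc.prems(1) that by (auto dest: inj_onD)
  have IHz: "tprod c p q z [0..<n] = mat 1 + (\<Sum>k<n. smul (?s k) (tres c p q n k))"
    using Suc.prems(2) by (intro Suc.IH inj) auto
  have IHc: "tprod c p q ?c [0..<n] =
      mat 1 + (\<Sum>k<n. smul (1 / (?c - of_real (c (k + 1)))) (tres c p q n k))"
    using ne by (intro Suc.IH inj) (auto dest: sym)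
  have last: "tres c p q (Suc n) n = ?P + (\<Sum>k<n. smul (1 / (?c - of_real (c (k + 1)))) (tres c p q n k ** ?P))"
    unfolding tres_def[of c p q "Suc n" n] IHc
    by (simp add: matrix_add_rdistrib sum_matrix_mult smul_mult_left)
  define A1 where "A1 = (\<Sum>k<n. smul (?s k) (tres c p q n k))"
  define A2 where "A2 = smul (?s n) ?P"
  define B1 where
    "B1 = (\<Sum>k<n. smul (?s k * (1 / (of_real (c (k + 1)) - ?c))) (tres c p q n k ** ?P))"
  define B2 where
    "B2 = (\<Sum>k<n. smul (?s n * (1 / (?c - of_real (c (k + 1))))) (tres c p q n k ** ?P))"
  have "tprod c p q z [0..<Suc n] = (mat 1 + A1) ** (mat 1 + smul (?s n) ?P)"
    by (simp only: tprod_Suc zero_le tfac_def IHz A1_def)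
  also have "\<dots> = mat 1 + A1 + A2 + smul (?s n) (A1 ** ?P)"
    by (simp add: matrix_add_ldistrib matrix_add_rdistrib smul_mult_right smul_add A2_def add.assoc)
  also have "smul (?s n) (A1 ** ?P) = (\<Sum>k<n. smul (?s k * ?s n) (tres c p q n k ** ?P))"
    unfolding A1_def sum_matrix_mult smul_mult_left smul_sum smul_smul
    by (intro sum.cong refl) (simp only: mult.commute)
  also have "\<dots> = B1 + B2"
    unfolding B1_def B2_def sum.distrib[symmetric]
  proof (rule sum.cong[OF refl])
    fix k assume "k \<in> {..<n}"
    hence "?s k * ?s n = ?s k * (1 / (of_real (c (k + 1)) - ?c)) + ?s n * (1 / (?c - of_real (c (k + 1))))"
      using Suc.prems(2) ne by (intro partial_fraction_identity) auto
    thus "smul (?s k * ?s n) (tres c p q n k ** ?P) =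
      smul (?s k * (1 / (of_real (c (k + 1)) - ?c))) (tres c p q n k ** ?P) +
        smul (?s n * (1 / (?c - of_real (c (k + 1))))) (tres c p q n k ** ?P)"
      by (intro mat2_eqI; simp only: smul_nth vector_add_component distrib_right)
  qed
  finally have 1: "tprod c p q z [0..<Suc n] = mat 1 + A1 + A2 + (B1 + B2)" .
  have 2: "(\<Sum>k<n. smul (?s k) (tres c p q (Suc n) k)) = A1 + B1"
    unfolding A1_def B1_def sum.distrib[symmetric]
    by (intro sum.cong refl) (simp only: tres_Suc lessThan_iff smul_add smul_smul)
  have 3: "smul (?s n) (tres c p q (Suc n) n) = A2 + B2"
    unfolding last A2_def B2_def by (simp only: smul_add smul_sum smul_smul)
  show ?case unfolding 1 sum.lessThan_Suc 2 3 by (simp only: add_ac)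
qed simp

lemma sum_tres:
  assumes "inj_on c {1..n}"
  shows "(\<Sum>k<n. tres c p q n k) = (\<Sum>k<n. cmat (pole_matrix (p k) (q k)))"
  using assms
proof (induction n)
  case (Suc n)
  let ?c = "complex_of_real (c (n + 1))" and ?P = "cmat (pole_matrix (p n) (q n))"
  have inj: "inj_on c {1..n}" using Suc.prems(1) by (rule inj_on_subset) auto
  have ne: "c (k + 1) \<noteq> c (n + 1)" if "k < n" for k
    using Suc.prems(1) that by (auto dest: inj_onD)
  have IHc: "tprod c p q ?c [0..<n] =
      mat 1 + (\<Sum>k<n. smul (1 / (?c - of_real (c (k + 1)))) (tres c p q n k))"
    using ne by (intro tprod_partial_fractions inj) (auto dest: sym)
  have last: "tres c p q (Suc n) n = ?P + (\<Sum>k<n. smul (1 / (?c - of_real (c (k + 1)))) (tres c p q n k ** ?P))"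
    unfolding tres_def[of c p q "Suc n" n] IHc
    by (simp add: matrix_add_rdistrib sum_matrix_mult smul_mult_left)
  have "(\<Sum>k<n. tres c p q (Suc n) k) = (\<Sum>k<n. tres c p q n k +
      smul (1 / (of_real (c (k + 1)) - ?c)) (tres c p q n k ** ?P))"
    by (intro sum.cong refl) (simp only: tres_Suc lessThan_iff)
  moreover have "smul (1 / (of_real (c (k + 1)) - ?c)) X = - smul (1 / (?c - of_real (c (k + 1)))) X" for k X
  proof -
    have "1 / (of_real (c (k + 1)) - ?c) = - (1 / (?c - of_real (c (k + 1))))"
      by (metis minus_diff_eq divide_minus_right)
    thus ?thesis by (intro mat2_eqI) simp_all
  qed
  ultimately have "(\<Sum>k<n. tres c p q (Suc n) k) + tres c p q (Suc n) n = (\<Sum>k<n. tres c p q n k) + ?P"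
    by (simp add: last sum.distrib sum_negf)
  thus ?case by (simp add: Suc.IH[OF inj])
qed simp

lemma Lambda_eq_trace_tres:
  assumes "k < g"
  shows "of_real (Lambda g c (k + 1) p q) = - trace (tres c p q g k ** tinf (of_real (c (k + 1))) (p g) (q g))"
  unfolding Lambda_def tres_def
  by (simp only: of_real_minus trace_cmat[symmetric] cmat_mult cmat_ordered_prod cmat_transfer_inf
      diff_add_inverse2 add_Suc_right Suc_eq_plus1)

text \<open>
  The constant term uses that the residues \<open>tres\<close> have the same sum as those of the single factors,
  both being the coefficient of \<open>1 / z\<close> of the product at infinity.
\<close>

lemma trace_monodromy:
  assumes inj: "inj_on c {1..g}" and z: "z \<notin> (\<lambda>j. complex_of_real (c j)) ` {1..g}" and p: "p g \<noteq> 0"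
  shows "trace (monodromy g c p q z) = partial_fractions g c (1 / p g)
    (- q g - 1 / p g * (\<Sum>j<g. p j * q j)) (\<lambda>k. Lambda g c k p q) z"
proof -
  let ?T = "\<lambda>z. tinf z (p g) (q g)"
  let ?c = "\<lambda>k. complex_of_real (c (k + 1))"
  have zc: "z \<noteq> ?c k" if "k < g" for k using z that by force
  have tr: "trace (M ** ?T z) = trace (M ** ?T w) + (z - w) / of_real (p g) * M $ 2 $ 2" for M w
    using p by (simp add: trace_mat2 mat2_mult_nth field_simps)
  have "trace (monodromy g c p q z) =
      trace (?T z) + (\<Sum>k<g. 1 / (z - ?c k) * trace (tres c p q g k ** ?T z))"
    unfolding monodromy_def
    by (simp add: tprod_partial_fractions[OF inj zc] matrix_add_rdistrib sum_matrix_mult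
        smul_mult_left trace_add trace_sum trace_smul)
  also have "(\<Sum>k<g. 1 / (z - ?c k) * trace (tres c p q g k ** ?T z)) =
      (\<Sum>k<g. of_real (Lambda g c (k + 1) p q) / (?c k - z) + 1 / of_real (p g) * tres c p q g k $ 2 $ 2)"
  proof (rule sum.cong[OF refl])
    fix k assume k: "k \<in> {..<g}"
    have "1 / (z - ?c k) * trace (tres c p q g k ** ?T z) =
      1 / (z - ?c k) * (- of_real (Lambda g c (k + 1) p q) + (z - ?c k) / of_real (p g) * tres c p q g k $ 2 $ 2)"
      using k by (subst tr[of _ "?c k"]) (simp only: Lambda_eq_trace_tres lessThan_iff minus_minus)
    also have "\<dots> = of_real (Lambda g c (k + 1) p q) / (?c k - z) + 1 / of_real (p g) * tres c p q g k $ 2 $ 2"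
    proof -
      have "z - ?c k \<noteq> 0" "?c k - z \<noteq> 0" using zc[of k] k by auto
      thus ?thesis using p by (simp add: divide_simps) (simp add: algebra_simps)
    qed
    finally show "1 / (z - ?c k) * trace (tres c p q g k ** ?T z) =
      of_real (Lambda g c (k + 1) p q) / (?c k - z) + 1 / of_real (p g) * tres c p q g k $ 2 $ 2" .
  qed
  also have "\<dots> = (\<Sum>k<g. of_real (Lambda g c (k + 1) p q) / (?c k - z)) +
      1 / of_real (p g) * (\<Sum>k<g. tres c p q g k) $ 2 $ 2"
    by (simp add: sum.distrib sum_distrib_left)
  also have "(\<Sum>k<g. tres c p q g k) $ 2 $ 2 = - (\<Sum>k<g. of_real (p k * q k))"
    by (simp add: sum_tres[OF inj] sum_negf)
  also have "(\<Sum>k<g. of_real (Lambda g c (k + 1) p q) / (?c k - z)) =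
      (\<Sum>j=1..g. of_real (Lambda g c j p q) / (of_real (c j) - z))"
    by (rule sum.reindex_bij_witness[of _ "\<lambda>j. j - 1" "\<lambda>k. k + 1"]) auto
  also have "trace (?T z) = of_real (1 / p g) * z - of_real (q g)"
    using p by (simp add: trace_mat2 field_simps)
  finally show ?thesis
    by (simp add: partial_fractions_def algebra_simps)
qed

lemma det_monodromy:
  assumes "p g \<noteq> 0"
  shows "monodromy g c p q z $ 1 $ 1 * monodromy g c p q z $ 2 $ 2
    - monodromy g c p q z $ 1 $ 2 * monodromy g c p q z $ 2 $ 1 = 1"
proof -
  have f: "det (tfac c p q z m) = 1" for m
    by (simp add: det_2 tfac_def algebra_simps)
  have "det (tprod c p q z ms) = 1" for ms
    by (induction ms) (simp_all add: tprod_def det_mul f)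
  moreover have "det (tinf z (p g) (q g)) = 1" using assms by (simp add: det_2)
  ultimately have "det (monodromy g c p q z) = 1" by (simp add: monodromy_def det_mul)
  thus ?thesis by (simp add: det_2)
qed

section \<open>The eigenvalue equation of a periodic matrix\<close>

text \<open>
  Two-sided sequences are written as \<open>u j r\<close>, the entry of index \<open>r \<le> g\<close> in block \<open>j\<close>. Apart
  from a diagonal term, the rows with \<open>r < g\<close> only involve two sums. The first one collects what
  lies to the left of the entry \<open>r\<close>, with the coupling to the preceding block.
\<close>

definition left_sum :: "nat \<Rightarrow> (nat \<Rightarrow> real) \<Rightarrow> (int \<Rightarrow> nat \<Rightarrow> complex) \<Rightarrow> int \<Rightarrow> nat \<Rightarrow> complex" where
  "left_sum g q u j r = u (j - 1) g + (\<Sum>s<r. of_real (q s) * u j s)"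

text \<open>
  The second one is the sum over \<open>s = r, \<dots>, g\<close>, written as a difference. The row vector
  \<open>(left_sum, right_sum)\<close> of a formal eigenvector is propagated by the transfer matrices.
\<close>

definition right_sum :: "nat \<Rightarrow> (nat \<Rightarrow> real) \<Rightarrow> (int \<Rightarrow> nat \<Rightarrow> complex) \<Rightarrow> int \<Rightarrow> nat \<Rightarrow> complex" where
  "right_sum g p u j r = (\<Sum>s\<le>g. of_real (p s) * u j s) - (\<Sum>s<r. of_real (p s) * u j s)"

text \<open>The formal action of \<open>z - A\<close> on an arbitrary sequence.\<close>

definition resid :: "nat \<Rightarrow> (nat \<Rightarrow> real) \<Rightarrow> (nat \<Rightarrow> real) \<Rightarrow> (nat \<Rightarrow> real) \<Rightarrow> complex \<Rightarrow>
    (int \<Rightarrow> nat \<Rightarrow> complex) \<Rightarrow> int \<Rightarrow> nat \<Rightarrow> complex" where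
  "resid g c p q z u j r = z * u j r - (of_real (p r) * u (j - 1) g +
     (\<Sum>s\<le>g. of_real (blockB g c p q r s) * u j s) +
     (if r = g then \<Sum>s\<le>g. of_real (p s) * u (j + 1) s else 0))"

lemma sum_blockB:
  assumes "r \<le> g"
  shows "of_real (p r) * u (j - 1) g + (\<Sum>s\<le>g. of_real (blockB g c p q r s) * u j s) =
    of_real (p r) * left_sum g q u j r + of_real (q r) * right_sum g p u j r +
    (if r < g then of_real (c (r + 1)) * u j r else 0)"
proof -
  have "(\<Sum>s\<le>g. of_real (blockB g c p q r s) * u j s) =
      (\<Sum>s\<le>g. of_real (q r) * (of_real (p s) * u j s) +
        (if s < r then of_real (p r) * (of_real (q s) * u j s) - of_real (q r) * (of_real (p s) * u j s) else 0) +
        (if s = r then (if r < g then of_real (c (r + 1)) * u j r else 0) else 0))"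
    by (intro sum.cong refl)
       (auto simp: blockB_def upper_part_def lower_part_def algebra_simps)
  also have "\<dots> = of_real (q r) * (\<Sum>s\<le>g. of_real (p s) * u j s) +
      (\<Sum>s\<le>g. if s < r then of_real (p r) * (of_real (q s) * u j s) - of_real (q r) * (of_real (p s) * u j s) else 0) +
      (if r < g then of_real (c (r + 1)) * u j r else 0)"
    using assms by (simp add: sum.distrib sum_distrib_left)
  also have "(\<Sum>s\<le>g. if s < r then of_real (p r) * (of_real (q s) * u j s) - of_real (q r) * (of_real (p s) * u j s) else 0) =
      (\<Sum>s<r. of_real (p r) * (of_real (q s) * u j s) - of_real (q r) * (of_real (p s) * u j s))"
    using assms by (intro sum.mono_neutral_cong_right) auto
  also have "\<dots> = of_real (p r) * (\<Sum>s<r. of_real (q s) * u j s) - of_real (q r) * (\<Sum>s<r. of_real (p s) * u j s)"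
    by (simp add: sum_subtractf sum_distrib_left)
  finally show ?thesis
    by (simp only: left_sum_def right_sum_def) (simp add: algebra_simps)
qed

lemma resid_lt:
  assumes "r < g"
  shows "resid g c p q z u j r = (z - of_real (c (r + 1))) * u j r -
    (of_real (p r) * left_sum g q u j r + of_real (q r) * right_sum g p u j r)"
  using sum_blockB[of r g p u j c q] assms by (simp add: resid_def algebra_simps)

lemma resid_last:
  "resid g c p q z u j g = z * u j g - (of_real (p g) * left_sum g q u j g +
    of_real (q g) * right_sum g p u j g + right_sum g p u (j + 1) 0)"
  using sum_blockB[of g g p u j c q] by (simp add: resid_def right_sum_def)

lemma left_sum_Suc: "left_sum g q u j (Suc r) = left_sum g q u j r + of_real (q r) * u j r"
  by (simp add: left_sum_def)

lemma right_sum_Suc: "right_sum g p u j (Suc r) = right_sum g p u j r - of_real (p r) * u j r"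
  by (simp add: right_sum_def)

lemma right_sum_last: "right_sum g p u j g = of_real (p g) * u j g"
  by (simp add: right_sum_def lessThan_Suc_atMost[symmetric])

lemma left_sum_0: "left_sum g q u j 0 = u (j - 1) g"
  by (simp add: left_sum_def)

lemma tprod_Suc_nth:
  fixes c p q z k
  defines "M \<equiv> tprod c p q z [0..<k]" and "s \<equiv> 1 / (z - of_real (c (k + 1)))"
  shows "tprod c p q z [0..<Suc k] $ i $ 1 =
      M $ i $ 1 + s * of_real (q k) * (of_real (p k) * M $ i $ 1 + of_real (q k) * M $ i $ 2)"
    and "tprod c p q z [0..<Suc k] $ i $ 2 =
      M $ i $ 2 - s * of_real (p k) * (of_real (p k) * M $ i $ 1 + of_real (q k) * M $ i $ 2)"
  unfolding tprod_Suc[OF le0] M_def[symmetric] mat2_mult_nth tfac_def s_def[symmetric]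
  by (simp_all add: algebra_simps del: One_nat_def)

lemma monodromy_nth:
  fixes c p q z g
  defines "M \<equiv> tprod c p q z [0..<g]"
  shows "monodromy g c p q z $ i $ 1 = M $ i $ 2 / of_real (p g)"
    and "monodromy g c p q z $ i $ 2 =
      (z - of_real (p g * q g)) / of_real (p g) * M $ i $ 2 - of_real (p g) * M $ i $ 1"
  unfolding monodromy_def M_def[symmetric] mat2_mult_nth by simp_all

section \<open>Floquet solutions\<close>

lemma unimodular_multiplier:
  assumes "t \<in> complex_of_real ` {-2..2}"
  obtains \<mu> where "cmod \<mu> = 1" "\<mu> * \<mu> - t * \<mu> + 1 = 0"
proof -
  obtain x where x: "t = of_real x" "\<bar>x\<bar> \<le> 2" using assms by (auto simp: abs_le_iff)
  have "x\<^sup>2 \<le> 2\<^sup>2" using x(2) by (metis abs_le_square_iff abs_numeral)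
  hence y: "(sqrt (1 - x\<^sup>2 / 4))\<^sup>2 = 1 - x\<^sup>2 / 4" by simp
  define \<mu> where "\<mu> = Complex (x / 2) (sqrt (1 - x\<^sup>2 / 4))"
  have "(cmod \<mu>)\<^sup>2 = 1"
    unfolding cmod_power2 \<mu>_def by (simp add: y power_divide)
  hence "(cmod \<mu>)\<^sup>2 = 1\<^sup>2" by simp
  hence "cmod \<mu> = 1" by (rule power2_eq_imp_eq) simp_all
  moreover have "\<mu> * \<mu> - t * \<mu> + 1 = 0"
    using y by (simp add: complex_eq_iff \<mu>_def x(1) power2_eq_square)
  ultimately show ?thesis by (rule that)
qed

lemma left_eigenvector:
  fixes T :: "complex^2^2"
  assumes det: "T $ 1 $ 1 * T $ 2 $ 2 - T $ 1 $ 2 * T $ 2 $ 1 = 1"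
    and \<mu>: "\<mu> * \<mu> - trace T * \<mu> + 1 = 0"
  obtains x y where "x \<noteq> 0 \<or> y \<noteq> 0" "x * T $ 1 $ 1 + y * T $ 2 $ 1 = \<mu> * x"
    "x * T $ 1 $ 2 + y * T $ 2 $ 2 = \<mu> * y"
proof -
  have "\<mu> * \<mu> - (T $ 1 $ 1 + T $ 2 $ 2) * \<mu> + (T $ 1 $ 1 * T $ 2 $ 2 - T $ 1 $ 2 * T $ 2 $ 1) = 0"
    using \<mu> unfolding det trace_mat2 .
  hence ch: "(\<mu> - T $ 1 $ 1) * (\<mu> - T $ 2 $ 2) = T $ 1 $ 2 * T $ 2 $ 1"
    by (simp add: algebra_simps)
  consider "T $ 2 $ 1 \<noteq> 0 \<or> T $ 1 $ 1 \<noteq> \<mu>" | "T $ 1 $ 2 \<noteq> 0 \<or> T $ 2 $ 2 \<noteq> \<mu>"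
    | "T $ 2 $ 1 = 0" "T $ 1 $ 1 = \<mu>" "T $ 1 $ 2 = 0" "T $ 2 $ 2 = \<mu>" by blast
  thus ?thesis
  proof cases
    case 1
    show ?thesis
      by (rule that[of "T $ 2 $ 1" "\<mu> - T $ 1 $ 1"]) (use 1 ch in \<open>auto simp: algebra_simps\<close>)
  next
    case 2
    show ?thesis
      by (rule that[of "\<mu> - T $ 2 $ 2" "T $ 1 $ 2"]) (use 2 ch in \<open>auto simp: algebra_simps\<close>)
  next
    case 3
    show ?thesis by (rule that[of 1 0]) (use 3 in auto)
  qed
qed

text \<open>A trace in \<open>[-2, 2]\<close> yields a bounded solution, with a unimodular multiplier.\<close>

lemma floquet_solution:
  assumes p: "p g \<noteq> 0" and z: "\<And>r. r < g \<Longrightarrow> z \<noteq> of_real (c (r + 1))"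
    and tr: "trace (monodromy g c p q z) \<in> complex_of_real ` {-2..2}"
  obtains \<mu> w where "cmod \<mu> = 1" "\<exists>r\<le>g. w r \<noteq> 0"
    "\<And>j r. r \<le> g \<Longrightarrow> resid g c p q z (\<lambda>j r. \<mu> powi j * w r) j r = 0"
proof -
  let ?T = "monodromy g c p q z"
  obtain \<mu> where \<mu>: "cmod \<mu> = 1" "\<mu> * \<mu> - trace ?T * \<mu> + 1 = 0"
    using unimodular_multiplier[OF tr] by blast
  obtain x0 y0 where v: "x0 \<noteq> 0 \<or> y0 \<noteq> 0" "x0 * ?T $ 1 $ 1 + y0 * ?T $ 2 $ 1 = \<mu> * x0"
    "x0 * ?T $ 1 $ 2 + y0 * ?T $ 2 $ 2 = \<mu> * y0"
    using left_eigenvector[OF det_monodromy[of p g c q z, OF p] \<mu>(2)] by blast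
  have \<mu>0: "\<mu> \<noteq> 0" using \<mu>(1) by auto
  define M where "M = (\<lambda>r. tprod c p q z [0..<r])"
  define X where "X = (\<lambda>r. x0 * M r $ 1 $ 1 + y0 * M r $ 2 $ 1)"
  define Y where "Y = (\<lambda>r. x0 * M r $ 1 $ 2 + y0 * M r $ 2 $ 2)"
  define w where "w = (\<lambda>r. if r < g then
      1 / (z - of_real (c (r + 1))) * (of_real (p r) * X r + of_real (q r) * Y r) else Y g / of_real (p g))"
  define u where "u = (\<lambda>j r. \<mu> powi j * w r)"
  have X0: "X 0 = x0" "Y 0 = y0" by (simp_all add: X_def Y_def M_def)
  have step: "X (Suc r) = X r + of_real (q r) * w r" "Y (Suc r) = Y r - of_real (p r) * w r" if "r < g" for r
    unfolding X_def Y_def M_def tprod_Suc_nth w_def using that by (simp_all add: algebra_simps)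
  have wg: "w g = \<mu> * x0"
  proof -
    have "w g = x0 * ?T $ 1 $ 1 + y0 * ?T $ 2 $ 1"
      unfolding monodromy_nth by (simp add: w_def Y_def M_def add_divide_distrib)
    thus ?thesis using v(2) by simp
  qed
  have y1: "(z - of_real (p g * q g)) / of_real (p g) * Y g - of_real (p g) * X g = \<mu> * y0"
    unfolding v(3)[symmetric] monodromy_nth by (simp only: X_def Y_def M_def) (simp add: algebra_simps)
  have Xsum: "X r = x0 + (\<Sum>s<r. of_real (q s) * w s)" if "r \<le> g" for r
    using that by (induction r) (simp_all add: X0 step)
  have Ysum: "Y r = y0 - (\<Sum>s<r. of_real (p s) * w s)" if "r \<le> g" for r
    using that by (induction r) (simp_all add: X0 step)
  have Ytot: "(\<Sum>s\<le>g. of_real (p s) * w s) = y0"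
    using Ysum[of g] p by (simp add: lessThan_Suc_atMost[symmetric] w_def)
  have L: "left_sum g q u j r = \<mu> powi j * X r" if "r \<le> g" for j r
    using \<mu>0 by (simp add: left_sum_def u_def Xsum[OF that] wg power_int_diff sum_distrib_left algebra_simps)
  have R: "right_sum g p u j r = \<mu> powi j * Y r" if "r \<le> g" for j r
  proof -
    have "right_sum g p u j r = \<mu> powi j * ((\<Sum>s\<le>g. of_real (p s) * w s) - (\<Sum>s<r. of_real (p s) * w s))"
      by (simp add: right_sum_def u_def sum_distrib_left algebra_simps)
    thus ?thesis by (simp only: Ytot Ysum[OF that])
  qed
  have res: "resid g c p q z u j r = 0" if r: "r \<le> g" for j r
  proof (cases "r = g")
    case False
    hence rg: "r < g" using r by simp
    have "(z - of_real (c (r + 1))) * w r = of_real (p r) * X r + of_real (q r) * Y r"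
      using z[OF rg] rg by (simp add: w_def)
    hence "(z - of_real (c (r + 1))) * u j r = \<mu> powi j * (of_real (p r) * X r + of_real (q r) * Y r)"
      by (simp add: u_def)
    thus ?thesis unfolding resid_lt[OF rg] L[OF r] R[OF r] by (simp add: algebra_simps)
  next
    case True
    have "z * w g - of_real (p g) * X g - of_real (q g) * Y g = \<mu> * y0"
      unfolding y1[symmetric] using p by (simp add: w_def field_simps)
    hence "\<mu> powi j * (z * w g - of_real (p g) * X g - of_real (q g) * Y g) = \<mu> powi (j + 1) * y0"
      using \<mu>0 by (simp add: power_int_add)
    thus ?thesis unfolding True resid_last L[OF order_refl] R[OF order_refl] R[OF le0] X0
      by (simp add: u_def algebra_simps)
  qed
  have "\<exists>r\<le>g. w r \<noteq> 0"
  proof (rule ccontr)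
    assume "\<not> (\<exists>r\<le>g. w r \<noteq> 0)"
    hence w0: "\<And>r. r \<le> g \<Longrightarrow> w r = 0" by blast
    have "y0 = 0" unfolding Ytot[symmetric] by (intro sum.neutral) (simp add: w0)
    moreover have "x0 = 0" using w0[of g] wg \<mu>0 by simp
    ultimately show False using v(1) by simp
  qed
  thus ?thesis using that[of \<mu> w] \<mu>(1) res by (simp add: u_def)
qed

section \<open>The equation for the monodromy as a combination of residuals\<close>

text \<open>
  Translation invariant functionals that are finite combinations of the values of \<open>resid\<close> in the
  blocks \<open>j + i\<close> with \<open>i\<close> in a given set.
\<close>

definition resid_comb :: "nat \<Rightarrow> (nat \<Rightarrow> real) \<Rightarrow> (nat \<Rightarrow> real) \<Rightarrow> (nat \<Rightarrow> real) \<Rightarrow> complex \<Rightarrow> int set \<Rightarrow>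
    ((int \<Rightarrow> nat \<Rightarrow> complex) \<Rightarrow> int \<Rightarrow> complex) \<Rightarrow> bool" where
  "resid_comb g c p q z I L \<longleftrightarrow>
     (\<exists>d. \<forall>u j. L u j = (\<Sum>i\<in>I. \<Sum>s\<le>g. d i s * resid g c p q z u (j + i) s))"

lemma resid_comb_0: "resid_comb g c p q z I (\<lambda>u j. 0)"
  unfolding resid_comb_def by (rule exI[of _ "\<lambda>i s. 0"]) simp

lemma resid_comb_add:
  assumes "resid_comb g c p q z I K" "resid_comb g c p q z I L"
  shows "resid_comb g c p q z I (\<lambda>u j. K u j + L u j)"
proof -
  obtain d e where "\<And>u j. K u j = (\<Sum>i\<in>I. \<Sum>s\<le>g. d i s * resid g c p q z u (j + i) s)"
    "\<And>u j. L u j = (\<Sum>i\<in>I. \<Sum>s\<le>g. e i s * resid g c p q z u (j + i) s)"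
    using assms unfolding resid_comb_def by blast
  thus ?thesis
    unfolding resid_comb_def
    by (intro exI[of _ "\<lambda>i s. d i s + e i s"]) (simp add: sum.distrib distrib_right)
qed

lemma resid_comb_scale:
  assumes "resid_comb g c p q z I L"
  shows "resid_comb g c p q z I (\<lambda>u j. a * L u j)"
proof -
  obtain d where "\<And>u j. L u j = (\<Sum>i\<in>I. \<Sum>s\<le>g. d i s * resid g c p q z u (j + i) s)"
    using assms unfolding resid_comb_def by blast
  thus ?thesis
    unfolding resid_comb_def
    by (intro exI[of _ "\<lambda>i s. a * d i s"]) (simp add: sum_distrib_left mult.assoc)
qed

lemma resid_comb_resid:
  assumes "finite I" "i \<in> I" "r \<le> g"
  shows "resid_comb g c p q z I (\<lambda>u j. resid g c p q z u (j + i) r)"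
  unfolding resid_comb_def
proof (intro exI[of _ "\<lambda>i' s. if i' = i then (if s = r then 1 else 0) else 0"] allI)
  fix u j
  have "(\<Sum>i'\<in>I. \<Sum>s\<le>g. (if i' = i then (if s = r then 1 else 0) else 0) * resid g c p q z u (j + i') s) =
      (\<Sum>i'\<in>I. if i' = i then (\<Sum>s\<le>g. if s = r then resid g c p q z u (j + i') s else 0) else 0)"
  proof (intro sum.cong refl)
    fix i'
    have "(if s = r then 1 else 0) * resid g c p q z u (j + i) s =
        (if s = r then resid g c p q z u (j + i) s else 0)" for s by simp
    thus "(\<Sum>s\<le>g. (if i' = i then (if s = r then 1 else 0) else 0) * resid g c p q z u (j + i') s) =
        (if i' = i then (\<Sum>s\<le>g. if s = r then resid g c p q z u (j + i') s else 0) else 0)"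
      by simp
  qed
  thus "resid g c p q z u (j + i) r = (\<Sum>i'\<in>I. \<Sum>s\<le>g. (if i' = i then (if s = r then 1 else 0) else 0) *
      resid g c p q z u (j + i') s)"
    using assms by simp
qed

lemma resid_comb_shift:
  assumes L: "resid_comb g c p q z {0} L" and "finite I" "i \<in> I"
  shows "resid_comb g c p q z I (\<lambda>u j. L u (j + i))"
proof -
  obtain d where d: "\<And>u j. L u j = (\<Sum>i\<in>{0}. \<Sum>s\<le>g. d i s * resid g c p q z u (j + i) s)"
    using L unfolding resid_comb_def by blast
  show ?thesis
    unfolding resid_comb_def
  proof (intro exI[of _ "\<lambda>i' s. if i' = i then d 0 s else 0"] allI)
    fix u j
    have "(\<Sum>i'\<in>I. \<Sum>s\<le>g. (if i' = i then d 0 s else 0) * resid g c p q z u (j + i') s) =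
        (\<Sum>i'\<in>I. if i' = i then (\<Sum>s\<le>g. d 0 s * resid g c p q z u (j + i') s) else 0)"
      by (intro sum.cong refl) auto
    thus "L u (j + i) = (\<Sum>i'\<in>I. \<Sum>s\<le>g. (if i' = i then d 0 s else 0) * resid g c p q z u (j + i') s)"
      using assms(2,3) by (simp add: d)
  qed
qed

text \<open>
  For a formal eigenvector, the row vector at position \<open>r\<close> is the one at position 0 times the product
  of the first \<open>r\<close> factors; in general the difference is a combination of residuals of the same block.
\<close>

lemma sums_propagate:
  fixes c p q z
  defines "M \<equiv> \<lambda>r. tprod c p q z [0..<r]"
  assumes z: "\<And>r. r < g \<Longrightarrow> z \<noteq> of_real (c (r + 1))" and r: "r \<le> g"
  shows "resid_comb g c p q z {0} (\<lambda>u j. left_sum g q u j r -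
      (left_sum g q u j 0 * M r $ 1 $ 1 + right_sum g p u j 0 * M r $ 2 $ 1))"
    and "resid_comb g c p q z {0} (\<lambda>u j. right_sum g p u j r -
      (left_sum g q u j 0 * M r $ 1 $ 2 + right_sum g p u j 0 * M r $ 2 $ 2))"
proof -
  let ?R = "resid_comb g c p q z {0}"
  let ?L1 = "\<lambda>r u j. left_sum g q u j r -
      (left_sum g q u j 0 * M r $ 1 $ 1 + right_sum g p u j 0 * M r $ 2 $ 1)"
  let ?L2 = "\<lambda>r u j. right_sum g p u j r -
      (left_sum g q u j 0 * M r $ 1 $ 2 + right_sum g p u j 0 * M r $ 2 $ 2)"
  have "?R (?L1 r) \<and> ?R (?L2 r)"
    using r
  proof (induction r)
    case 0
    show ?case by (simp add: M_def resid_comb_0)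
  next
    case (Suc r)
    hence rg: "r < g" by simp
    hence IH: "?R (?L1 r)" "?R (?L2 r)" using Suc by auto
    define s where "s = 1 / (z - of_real (c (r + 1)))"
    have s: "s * (z - of_real (c (r + 1))) = 1" using z[OF rg] by (simp add: s_def)
    let ?K = "\<lambda>u j. of_real (p r) * ?L1 r u j + of_real (q r) * ?L2 r u j + resid g c p q z u (j + 0) r"
    have K: "?R ?K"
      by (intro resid_comb_add resid_comb_scale IH resid_comb_resid) (use rg in auto)
    have u: "u j r = s * (of_real (p r) * left_sum g q u j r + of_real (q r) * right_sum g p u j r
        + resid g c p q z u j r)" for u j
    proof -
      have "of_real (p r) * left_sum g q u j r + of_real (q r) * right_sum g p u j r
        + resid g c p q z u j r = (z - of_real (c (r + 1))) * u j r"
        by (simp add: resid_lt[OF rg])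
      thus ?thesis using s by (metis mult.assoc mult_1)
    qed
    have "?L1 (Suc r) = (\<lambda>u j. ?L1 r u j + s * of_real (q r) * ?K u j)"
    proof (intro ext)
      fix u j
      show "?L1 (Suc r) u j = ?L1 r u j + s * of_real (q r) * ?K u j"
        unfolding left_sum_Suc M_def tprod_Suc_nth s_def[symmetric] by (subst u) (simp add: algebra_simps)
    qed
    moreover have "?L2 (Suc r) = (\<lambda>u j. ?L2 r u j + (- (s * of_real (p r))) * ?K u j)"
    proof (intro ext)
      fix u j
      show "?L2 (Suc r) u j = ?L2 r u j + (- (s * of_real (p r))) * ?K u j"
        unfolding right_sum_Suc M_def tprod_Suc_nth s_def[symmetric] by (subst u) (simp add: algebra_simps)
    qed
    ultimately show ?case
      by (auto simp only: intro!: resid_comb_add resid_comb_scale IH K)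
  qed
  thus "?R (?L1 r)" "?R (?L2 r)" by auto
qed

lemma sums_period:
  fixes c p q z g
  defines "T \<equiv> monodromy g c p q z"
  assumes p: "p g \<noteq> 0" and z: "\<And>r. r < g \<Longrightarrow> z \<noteq> of_real (c (r + 1))"
  shows "resid_comb g c p q z {0} (\<lambda>u j. left_sum g q u (j + 1) 0 -
      (left_sum g q u j 0 * T $ 1 $ 1 + right_sum g p u j 0 * T $ 2 $ 1))"
    and "resid_comb g c p q z {0} (\<lambda>u j. right_sum g p u (j + 1) 0 -
      (left_sum g q u j 0 * T $ 1 $ 2 + right_sum g p u j 0 * T $ 2 $ 2))"
proof -
  let ?R = "resid_comb g c p q z {0}"
  define M where "M = tprod c p q z [0..<g]"
  let ?L1 = "\<lambda>u j. left_sum g q u j g -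
      (left_sum g q u j 0 * M $ 1 $ 1 + right_sum g p u j 0 * M $ 2 $ 1)"
  let ?L2 = "\<lambda>u j. right_sum g p u j g -
      (left_sum g q u j 0 * M $ 1 $ 2 + right_sum g p u j 0 * M $ 2 $ 2)"
  have L: "?R ?L1" "?R ?L2"
    using sums_propagate[of g z c g p q] z unfolding M_def by auto
  have ug: "u j g = right_sum g p u j g / of_real (p g)" for u j
    using p by (simp add: right_sum_last)
  have "left_sum g q u (j + 1) 0 - (left_sum g q u j 0 * T $ 1 $ 1 + right_sum g p u j 0 * T $ 2 $ 1)
      = 1 / of_real (p g) * ?L2 u j" for u j
    unfolding T_def monodromy_nth M_def[symmetric] left_sum_0
    using ug[of u j] p by (simp add: diff_divide_distrib add_divide_distrib)
  thus "?R (\<lambda>u j. left_sum g q u (j + 1) 0 -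
      (left_sum g q u j 0 * T $ 1 $ 1 + right_sum g p u j 0 * T $ 2 $ 1))"
    by (simp only: resid_comb_scale L)
  have eq: "right_sum g p u (j + 1) 0 - (left_sum g q u j 0 * T $ 1 $ 2 + right_sum g p u j 0 * T $ 2 $ 2)
      = (z - of_real (p g * q g)) / of_real (p g) * ?L2 u j + (- of_real (p g)) * ?L1 u j +
        (- 1) * resid g c p q z u (j + 0) g" for u j
  proof -
    have "right_sum g p u (j + 1) 0 = z * u j g - of_real (p g) * left_sum g q u j g -
        of_real (q g) * right_sum g p u j g - resid g c p q z u j g"
      by (simp add: resid_last)
    also have "z * u j g = z / of_real (p g) * right_sum g p u j g" by (subst ug) simp
    finally have r1: "right_sum g p u (j + 1) 0 =
        (z - of_real (p g * q g)) / of_real (p g) * right_sum g p u j g -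
        of_real (p g) * left_sum g q u j g - resid g c p q z u j g"
      using p by (simp add: diff_divide_distrib algebra_simps)
    show ?thesis
      unfolding r1 T_def monodromy_nth M_def[symmetric] by (simp add: algebra_simps)
  qed
  show "?R (\<lambda>u j. right_sum g p u (j + 1) 0 -
      (left_sum g q u j 0 * T $ 1 $ 2 + right_sum g p u j 0 * T $ 2 $ 2))"
    unfolding eq by (intro resid_comb_add resid_comb_scale L resid_comb_resid) auto
qed

lemma entry_propagate:
  assumes p: "p g \<noteq> 0" and z: "\<And>r. r < g \<Longrightarrow> z \<noteq> of_real (c (r + 1))" and r: "r \<le> g"
  shows "\<exists>a b. resid_comb g c p q z {0}
    (\<lambda>u j. u j r - (a * left_sum g q u j 0 + b * right_sum g p u j 0))"
proof -
  let ?R = "resid_comb g c p q z {0}"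
  define M where "M = (\<lambda>r. tprod c p q z [0..<r])"
  let ?L1 = "\<lambda>r u j. left_sum g q u j r -
      (left_sum g q u j 0 * M r $ 1 $ 1 + right_sum g p u j 0 * M r $ 2 $ 1)"
  let ?L2 = "\<lambda>r u j. right_sum g p u j r -
      (left_sum g q u j 0 * M r $ 1 $ 2 + right_sum g p u j 0 * M r $ 2 $ 2)"
  have L: "?R (?L1 r)" "?R (?L2 r)"
    using sums_propagate[of g z c r p q] z r unfolding M_def by auto
  show ?thesis
  proof (cases "r = g")
    case True
    have "u j r - (M g $ 1 $ 2 / of_real (p g) * left_sum g q u j 0 +
        M g $ 2 $ 2 / of_real (p g) * right_sum g p u j 0) = 1 / of_real (p g) * ?L2 r u j" for u j
      using p by (simp add: True right_sum_last diff_divide_distrib add_divide_distrib mult.commute)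
    hence "?R (\<lambda>u j. u j r - (M g $ 1 $ 2 / of_real (p g) * left_sum g q u j 0 +
        M g $ 2 $ 2 / of_real (p g) * right_sum g p u j 0))"
      by (simp only: resid_comb_scale L)
    thus ?thesis by blast
  next
    case False
    hence rg: "r < g" using r by simp
    define s where "s = 1 / (z - of_real (c (r + 1)))"
    have s: "s * (z - of_real (c (r + 1))) = 1" using z[OF rg] by (simp add: s_def)
    define a where "a = s * (of_real (p r) * M r $ 1 $ 1 + of_real (q r) * M r $ 1 $ 2)"
    define b where "b = s * (of_real (p r) * M r $ 2 $ 1 + of_real (q r) * M r $ 2 $ 2)"
    have u: "u j r = s * (of_real (p r) * left_sum g q u j r + of_real (q r) * right_sum g p u j r
        + resid g c p q z u j r)" for u j
    proof -
      have "of_real (p r) * left_sum g q u j r + of_real (q r) * right_sum g p u j r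
        + resid g c p q z u j r = (z - of_real (c (r + 1))) * u j r"
        by (simp add: resid_lt[OF rg])
      thus ?thesis using s by (metis mult.assoc mult_1)
    qed
    have "u j r - (a * left_sum g q u j 0 + b * right_sum g p u j 0) =
       s * (of_real (p r) * ?L1 r u j + of_real (q r) * ?L2 r u j + resid g c p q z u (j + 0) r)" for u j
      by (subst u) (simp add: a_def b_def algebra_simps)
    hence "?R (\<lambda>u j. u j r - (a * left_sum g q u j 0 + b * right_sum g p u j 0))"
      by (simp only:) (intro resid_comb_scale resid_comb_add L resid_comb_resid; simp add: r)
    thus ?thesis by blast
  qed
qed

lemma cayley_hamilton_step:
  fixes a b c d :: complex
  assumes "a * d - b * c = 1"
  shows "x2 + x0 - (a + d) * x1 =
      (x2 - (x1 * a + y1 * c)) + (- d) * (x1 - (x0 * a + y0 * c)) + c * (y1 - (x0 * b + y0 * d))"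
    and "y2 + y0 - (a + d) * y1 =
      (y2 - (x1 * b + y1 * d)) + b * (x1 - (x0 * a + y0 * c)) + (- a) * (y1 - (x0 * b + y0 * d))"
  using assms by algebra+

text \<open>
  The Cayley-Hamilton theorem for the monodromy, of determinant one: modulo residuals, a sequence
  satisfies the second order recursion of the monodromy, in which only its trace appears.
\<close>

lemma second_order_recursion:
  assumes p: "p g \<noteq> 0" and z: "\<And>r. r < g \<Longrightarrow> z \<noteq> of_real (c (r + 1))" and r: "r \<le> g"
  shows "resid_comb g c p q z {-1..1}
    (\<lambda>u j. u (j + 1) r + u (j - 1) r - trace (monodromy g c p q z) * u j r)"
proof -
  let ?R = "resid_comb g c p q z {-1..1}"
  define T where "T = monodromy g c p q z"
  let ?X = "\<lambda>u j. left_sum g q u j 0"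
  let ?Y = "\<lambda>u j. right_sum g p u j 0"
  let ?E1 = "\<lambda>u j. ?X u (j + 1) - (?X u j * T $ 1 $ 1 + ?Y u j * T $ 2 $ 1)"
  let ?E2 = "\<lambda>u j. ?Y u (j + 1) - (?X u j * T $ 1 $ 2 + ?Y u j * T $ 2 $ 2)"
  obtain a b where ab: "resid_comb g c p q z {0} (\<lambda>u j. u j r - (a * ?X u j + b * ?Y u j))"
    using entry_propagate[of p g z c r q, OF p z r] by blast
  let ?U = "\<lambda>u j. u j r - (a * ?X u j + b * ?Y u j)"
  note E = sums_period[of p g z c q, OF p z, folded T_def]
  have U: "?R (\<lambda>u j. ?U u (j + i))" if "i \<in> {-1..1}" for i
    by (rule resid_comb_shift[OF ab]) (use that in auto)
  have E1: "?R (\<lambda>u j. ?E1 u (j + i))" if "i \<in> {-1..1}" for i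
    by (rule resid_comb_shift[OF E(1)]) (use that in auto)
  have E2: "?R (\<lambda>u j. ?E2 u (j + i))" if "i \<in> {-1..1}" for i
    by (rule resid_comb_shift[OF E(2)]) (use that in auto)
  have det: "T $ 1 $ 1 * T $ 2 $ 2 - T $ 1 $ 2 * T $ 2 $ 1 = 1"
    unfolding T_def by (rule det_monodromy[of p g c q z, OF p])
  have X2: "?X u (j + 1) + ?X u (j - 1) - trace T * ?X u j =
      ?E1 u (j + 0) + (- T $ 2 $ 2) * ?E1 u (j + - 1) + T $ 2 $ 1 * ?E2 u (j + - 1)" for u j
    unfolding trace_mat2
    using cayley_hamilton_step(1)[OF det, of "?X u (j + 1)" "?X u (j - 1)" "?X u j" "?Y u j" "?Y u (j - 1)"]
    by simp
  have Y2: "?Y u (j + 1) + ?Y u (j - 1) - trace T * ?Y u j =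
      ?E2 u (j + 0) + T $ 1 $ 2 * ?E1 u (j + - 1) + (- T $ 1 $ 1) * ?E2 u (j + - 1)" for u j
    unfolding trace_mat2
    using cayley_hamilton_step(2)[OF det, of "?Y u (j + 1)" "?Y u (j - 1)" "?Y u j" "?X u j" "?X u (j - 1)"]
    by simp
  have "u (j + 1) r + u (j - 1) r - trace T * u j r =
      ?U u (j + 1) + ?U u (j + - 1) + (- trace T) * ?U u (j + 0) +
      a * (?X u (j + 1) + ?X u (j - 1) - trace T * ?X u j) +
      b * (?Y u (j + 1) + ?Y u (j - 1) - trace T * ?Y u j)" for u j
    by (simp add: algebra_simps)
  hence eq: "(\<lambda>u j. u (j + 1) r + u (j - 1) r - trace T * u j r) = (\<lambda>u j.
      ?U u (j + 1) + ?U u (j + - 1) + (- trace T) * ?U u (j + 0) +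
      a * (?E1 u (j + 0) + (- T $ 2 $ 2) * ?E1 u (j + - 1) + T $ 2 $ 1 * ?E2 u (j + - 1)) +
      b * (?E2 u (j + 0) + T $ 1 $ 2 * ?E1 u (j + - 1) + (- T $ 1 $ 1) * ?E2 u (j + - 1)))"
    unfolding X2 Y2 by (intro ext)
  show ?thesis
    unfolding T_def[symmetric] eq
    by (intro resid_comb_add resid_comb_scale U E1 E2) auto
qed

section \<open>The spectrum of a periodic matrix\<close>

text \<open>The index of the entry number \<open>r\<close> of block \<open>j\<close>.\<close>

definition block_index :: "nat \<Rightarrow> int \<Rightarrow> nat \<Rightarrow> int" where
  "block_index g j r = j * int (g + 1) + int r"

lemma block_index_div_mod:
  assumes "r \<le> g"
  shows "block_index g j r div int (g + 1) = j" "block_index g j r mod int (g + 1) = int r"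
proof -
  have *: "0 \<le> int r" "int r < int (g + 1)" using assms by auto
  have "int r div int (g + 1) = 0" using * by (rule div_pos_pos_trivial)
  thus "block_index g j r div int (g + 1) = j"
    unfolding block_index_def by (subst add.commute, subst div_mult_self1) auto
  have "int r mod int (g + 1) = int r" using * by (rule mod_pos_pos_trivial)
  thus "block_index g j r mod int (g + 1) = int r"
    unfolding block_index_def by (subst add.commute, subst mod_mult_self1) auto
qed

lemma block_index_eq_iff:
  assumes "r \<le> g" "s \<le> g"
  shows "block_index g j r = block_index g i s \<longleftrightarrow> j = i \<and> r = s"
  using block_index_div_mod[OF assms(1), of j] block_index_div_mod[OF assms(2), of i]
  by (metis of_nat_eq_iff)

lemma block_index_cases:
  obtains j r where "r \<le> g" "n = block_index g j r"
proof
  let ?N = "int (g + 1)"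
  have N: "?N > 0" by simp
  have *: "0 \<le> n mod ?N" "n mod ?N < ?N" using N by (rule pos_mod_sign pos_mod_bound)+
  thus "nat (n mod ?N) \<le> g" by linarith
  show "n = block_index g (n div ?N) (nat (n mod ?N))"
    unfolding block_index_def nat_0_le[OF *(1)] by (rule div_mult_mod_eq[symmetric])
qed

lemma block_index_add: "block_index g j r + (block_index g i s - int r) = block_index g (j + i) s"
  by (simp add: block_index_def algebra_simps)

lemma block_index_shift:
  "block_index g j r + int (g + 1) = block_index g (j + 1) r"
  "block_index g j r + - int (g + 1) = block_index g (j - 1) r"
  by (simp_all add: block_index_def algebra_simps)

lemma ell2_block_eqI:
  assumes "\<And>j r. r \<le> g \<Longrightarrow> coord x (block_index g j r) = coord y (block_index g j r)"
  shows "x = y"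
proof (rule ell2_eqI)
  fix n
  obtain j r where "r \<le> g" "n = block_index g j r" by (rule block_index_cases)
  thus "coord x n = coord y n" using assms by simp
qed

lemma block_jacobi_entry_index:
  assumes "r \<le> g" "s \<le> g"
  shows "block_jacobi_entry g c (\<lambda>_. p) (\<lambda>_. q) (block_index g j r) (block_index g i s) =
    (if i = j - 1 then (if s = g then p r else 0) else if i = j then blockB g c p q r s
     else if i = j + 1 then (if r = g then p s else 0) else 0)"
  unfolding block_jacobi_entry_def Let_def block_index_div_mod[OF assms(1)] block_index_div_mod[OF assms(2)]
  by (auto simp: blockA_def)

lemma block_jacobi_entry_sym:
  "block_jacobi_entry g c (\<lambda>_. p) (\<lambda>_. q) m n = block_jacobi_entry g c (\<lambda>_. p) (\<lambda>_. q) n m"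
proof -
  obtain j r where m: "r \<le> g" "m = block_index g j r" by (rule block_index_cases)
  obtain i s where n: "s \<le> g" "n = block_index g i s" by (rule block_index_cases)
  have "blockB g c p q r s = blockB g c p q s r"
    by (auto simp: blockB_def upper_part_def lower_part_def)
  thus ?thesis
    unfolding m(2) n(2) block_jacobi_entry_index[OF m(1) n(1)] block_jacobi_entry_index[OF n(1) m(1)]
    by auto
qed

lemma bounded_op_add: "bounded_op S \<Longrightarrow> bounded_op T \<Longrightarrow> bounded_op (\<lambda>x. S x + T x)"
  by (simp add: bounded_op_def bounded_linear_add scale_ell2_simps)

text \<open>The operator \<open>z - A\<close> acts on all sequences through its matrix.\<close>

lemma coord_resolvent_op:
  assumes A: "bounded_op A" and gen: "generating_coeffs g c (\<lambda>_. p) (\<lambda>_. q) A" and r: "r \<le> g"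
  shows "coord (scale_ell2 z x - A x) (block_index g j r) =
    resid g c p q z (\<lambda>j s. coord x (block_index g j s)) j r"
proof -
  define n where "n = block_index g j r"
  define S where "S = (\<lambda>m. sel_shift (\<lambda>l. l = n) (m - n))"
  have S: "coord (S m x) l = (if l = n then coord x m else 0)" for m x l by (simp add: S_def)
  have bS: "bounded_op (S m)" for m unfolding S_def by (rule bounded_op_sel_shift)
  define B where "B = (\<lambda>x. scale_ell2 z (S n x) -
      (scale_ell2 (of_real (p r)) (S (block_index g (j - 1) g) x) +
       (\<Sum>s\<le>g. scale_ell2 (of_real (blockB g c p q r s)) (S (block_index g j s) x)) +
       (\<Sum>s\<le>g. scale_ell2 (if r = g then of_real (p s) else 0) (S (block_index g (j + 1) s) x))))"
  have coordB: "coord (B x) l = (if l = n then resid g c p q z (\<lambda>j s. coord x (block_index g j s)) j r else 0)" for x l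
    by (simp add: B_def S resid_def n_def)
  have "(\<lambda>x. S n (scale_ell2 z x - A x)) = B"
  proof (rule bounded_op_eqI)
    show "bounded_op (\<lambda>x. S n (scale_ell2 z x - A x))"
      by (intro bounded_op_comp[OF bS] bounded_op_diff bounded_op_scale[OF bounded_op_id] A)
    show "bounded_op B"
      unfolding B_def by (intro bounded_op_diff bounded_op_add bounded_op_sum bounded_op_scale bS)
    fix m
    obtain i s where m: "s \<le> g" "m = block_index g i s" by (rule block_index_cases)
    have ent: "coord (A (basis_ell2 m)) n = of_real (block_jacobi_entry g c (\<lambda>_. p) (\<lambda>_. q) n m)"
      using gen by (simp add: generating_coeffs_def entry_op_def)
    have d: "coord (basis_ell2 m) (block_index g k t) = (if k = i then (if t = s then 1 else 0) else 0)"
      if "t \<le> g" for k t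
      using block_index_eq_iff[OF that m(1), of k i] by (simp add: m(2))
    have sum1: "(\<Sum>t\<le>g. f t * coord (basis_ell2 m) (block_index g k t)) = (if k = i then f s else 0)" for f k
    proof -
      have "(\<Sum>t\<le>g. f t * coord (basis_ell2 m) (block_index g k t)) =
          (\<Sum>t\<le>g. if t = s then (if k = i then f t else 0) else 0)"
        by (intro sum.cong refl) (subst d, auto)
      thus ?thesis using m(1) by simp
    qed
    have "resid g c p q z (\<lambda>j s. coord (basis_ell2 m) (block_index g j s)) j r =
        coord (scale_ell2 z (basis_ell2 m) - A (basis_ell2 m)) n"
      unfolding coord_diff coord_simps(5) ent
      unfolding resid_def sum1 unfolding n_def d[OF r] d[OF order_refl]
      unfolding m(2) block_jacobi_entry_index[OF r m(1)]
    proof -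
      consider "i = j - 1" | "i = j" | "i = j + 1" | "j - 1 \<noteq> i" "j \<noteq> i" "j + 1 \<noteq> i" by blast
      thus "z * (if j = i then if r = s then 1 else 0 else 0) -
          (of_real (p r) * (if j - 1 = i then if g = s then 1 else 0 else 0) +
           (if j = i then of_real (blockB g c p q r s) else 0) +
           (if r = g then if j + 1 = i then of_real (p s) else 0 else 0)) =
          z * (if j = i then if r = s then 1 else 0 else 0) -
          complex_of_real (if i = j - 1 then if s = g then p r else 0
            else if i = j then blockB g c p q r s else if i = j + 1 then if r = g then p s else 0 else 0)"
      proof cases
        case 4
        hence "i \<noteq> j - 1" "i \<noteq> j" "i \<noteq> j + 1" by auto
        thus ?thesis using 4 by (simp only: if_False) simp
      qed (simp_all split: if_splits)
    qed
    thus "S n (scale_ell2 z (basis_ell2 m) - A (basis_ell2 m)) = B (basis_ell2 m)"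
      by (intro ell2_eqI) (simp only: S coordB)
  qed
  from fun_cong[OF this, of x] have "coord (S n (scale_ell2 z x - A x)) n = coord (B x) n"
    by (rule arg_cong)
  thus ?thesis unfolding S coordB by (simp add: n_def)
qed

text \<open>
  The second order recursion provides a banded matrix \<open>D\<close>, invariant under translation by a period
  \<open>N = g + 1\<close>, with \<open>D (z - A) = W\<close>, where \<open>W = tr - T - 1 / T\<close> with \<open>T\<close> the translation by \<open>N\<close>. Since
  \<open>A\<close> and \<open>W\<close> are symmetric, the transposed matrix \<open>D'\<close> satisfies \<open>(z - A) D' = W\<close>; and \<open>W\<close> is
  invertible when the trace lies outside \<open>[-2, 2]\<close>.
\<close>

lemma periodic_invertible:
  assumes A: "bounded_op A" and gen: "generating_coeffs g c (\<lambda>_. p) (\<lambda>_. q) A"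
    and z: "z \<notin> (\<lambda>j. complex_of_real (c j)) ` {1..g}"
    and tr: "trace (monodromy g c p q z) \<notin> complex_of_real ` {-2..2}"
  shows "invertible_op (\<lambda>x. scale_ell2 z x - A x)"
proof -
  define N where "N = int (g + 1)"
  note bi_mod = block_index_div_mod(2)[where g = g, folded N_def] and bi_shift = block_index_shift[where g = g, folded N_def]
  let ?pos = "block_index g" and ?t = "trace (monodromy g c p q z)"
  let ?Z = "\<lambda>x. scale_ell2 z x - A x"
  let ?W = "\<lambda>x. scale_ell2 ?t x - sel_shift (\<lambda>_. True) N x - sel_shift (\<lambda>_. True) (- N) x"
  have Z: "bounded_op ?Z" by (intro bounded_op_diff bounded_op_scale[OF bounded_op_id] A)
  have p: "p g \<noteq> 0" using gen by (force simp: generating_coeffs_def)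
  have zc: "z \<noteq> of_real (c (r + 1))" if "r < g" for r using z that by force
  have ex: "\<exists>d. \<forall>u j. u (j + 1) r + u (j - 1) r - ?t * u j r =
      (\<Sum>i\<in>{-1..1}. \<Sum>s\<le>g. d i s * resid g c p q z u (j + i) s)" if "r \<le> g" for r
    using second_order_recursion[of p g z c r q, OF p zc that] unfolding resid_comb_def .
  define d where "d = (\<lambda>r. SOME d. \<forall>u j. u (j + 1) r + u (j - 1) r - ?t * u j r =
      (\<Sum>i\<in>{-1..1}. \<Sum>s\<le>g. d i s * resid g c p q z u (j + i) s))"
  have d: "u (j + 1) r + u (j - 1) r - ?t * u j r =
      (\<Sum>i\<in>{-1..1}. \<Sum>s\<le>g. d r i s * resid g c p q z u (j + i) s)" if "r \<le> g" for r u j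
    unfolding d_def by (rule someI_ex[OF ex[OF that], rule_format])
  define D where "D = (\<lambda>x. \<Sum>r\<le>g. \<Sum>i\<in>{-1..1}. \<Sum>s\<le>g. scale_ell2 (- d r i s)
      (sel_shift (\<lambda>n. n mod N = int r) (?pos i s - int r) x))"
  define D' where "D' = (\<lambda>x. \<Sum>s\<le>g. \<Sum>i\<in>{-1..1}. \<Sum>r\<le>g. scale_ell2 (- d r i s)
      (sel_shift (\<lambda>n. n mod N = int s) (int r - ?pos i s) x))"
  have bD: "bounded_op D" "bounded_op D'"
    unfolding D_def D'_def by (intro bounded_op_sum bounded_op_scale bounded_op_sel_shift)+
  have coordD: "coord (D x) (?pos j r) = - (\<Sum>i\<in>{-1..1}. \<Sum>s\<le>g. d r i s * coord x (?pos (j + i) s))"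
    if "r \<le> g" for x j r
  proof -
    have "coord (D x) (?pos j r) = (\<Sum>r'\<le>g. if r' = r then
        (\<Sum>i\<in>{-1..1}. \<Sum>s\<le>g. - d r i s * coord x (?pos (j + i) s)) else 0)"
      unfolding D_def coord_sum
      by (intro sum.cong refl) (auto simp: bi_mod[OF that] block_index_add)
    thus ?thesis using that by (simp add: sum_negf)
  qed
  have coordD': "coord (D' x) (?pos j s) = - (\<Sum>i\<in>{-1..1}. \<Sum>r\<le>g. d r i s * coord x (?pos (j - i) r))"
    if "s \<le> g" for x j s
  proof -
    have idx: "?pos j s + (int r - ?pos i s) = ?pos (j - i) r" for i r
      by (simp add: block_index_def algebra_simps)
    have "coord (D' x) (?pos j s) = (\<Sum>s'\<le>g. if s' = s then
        (\<Sum>i\<in>{-1..1}. \<Sum>r\<le>g. - d r i s * coord x (?pos (j - i) r)) else 0)"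
      unfolding D'_def coord_sum
      by (intro sum.cong refl) (auto simp: bi_mod[OF that] idx)
    thus ?thesis using that by (simp add: sum_negf)
  qed
  have coordW: "coord (?W x) (?pos j r) = ?t * coord x (?pos j r) - coord x (?pos (j + 1) r) - coord x (?pos (j - 1) r)"
    for x j r
    by (simp only: coord_diff coord_simps coord_sel_shift bi_shift if_True)
  have DZ: "D (?Z x) = ?W x" for x
  proof (rule ell2_block_eqI[of g])
    fix j r assume r: "r \<le> g"
    have "coord (D (?Z x)) (?pos j r) = - (\<Sum>i\<in>{-1..1}. \<Sum>s\<le>g. d r i s *
        resid g c p q z (\<lambda>j s. coord x (?pos j s)) (j + i) s)"
      unfolding coordD[OF r]
      by (intro arg_cong[of _ _ uminus] sum.cong refl arg_cong2[of _ _ _ _ "(*)"] coord_resolvent_op[OF A gen]) auto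
    also have "\<dots> = coord (?W x) (?pos j r)"
      unfolding d[OF r, symmetric] coordW by simp
    finally show "coord (D (?Z x)) (?pos j r) = coord (?W x) (?pos j r)" .
  qed
  have ZD': "(\<lambda>x. ?Z (D' x)) = ?W"
  proof (rule bounded_op_eqI)
    show "bounded_op (\<lambda>x. ?Z (D' x))" using Z bD(2) by (rule bounded_op_comp)
    show "bounded_op ?W" by (intro bounded_op_diff bounded_op_scale[OF bounded_op_id] bounded_op_sel_shift)
    fix m
    obtain a b where m: "b \<le> g" "m = ?pos a b" by (rule block_index_cases)
    have D'm: "D' (basis_ell2 m) = (\<Sum>i\<in>{-1..1}. \<Sum>s\<le>g. scale_ell2 (- d b i s) (basis_ell2 (?pos (a + i) s)))"
    proof (rule ell2_block_eqI[of g])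
      fix j s assume s: "s \<le> g"
      have "(\<Sum>r\<le>g. d r i s * coord (basis_ell2 m) (?pos (j - i) r)) = (if j = a + i then d b i s else 0)" for i
      proof -
        have "(\<Sum>r\<le>g. d r i s * coord (basis_ell2 m) (?pos (j - i) r)) =
            (\<Sum>r\<le>g. if r = b then (if j = a + i then d r i s else 0) else 0)"
          by (intro sum.cong refl) (auto simp: m(2) block_index_eq_iff[OF _ m(1)])
        thus ?thesis using m(1) by simp
      qed
      hence "coord (D' (basis_ell2 m)) (?pos j s) = - (\<Sum>i\<in>{-1..1}. if j = a + i then d b i s else 0)"
        unfolding coordD'[OF s] by simp
      moreover have "(\<Sum>s'\<le>g. - d b i s' * coord (basis_ell2 (?pos (a + i) s')) (?pos j s)) =
          - (if j = a + i then d b i s else 0)" for i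
      proof -
        have "(\<Sum>s'\<le>g. - d b i s' * coord (basis_ell2 (?pos (a + i) s')) (?pos j s)) =
            (\<Sum>s'\<le>g. if s' = s then (if j = a + i then - d b i s else 0) else 0)"
          by (intro sum.cong refl) (auto simp: block_index_eq_iff[OF s])
        thus ?thesis using s by simp
      qed
      ultimately show "coord (D' (basis_ell2 m)) (?pos j s) = coord (\<Sum>i\<in>{-1..1}. \<Sum>s\<le>g.
          scale_ell2 (- d b i s) (basis_ell2 (?pos (a + i) s))) (?pos j s)"
        by (simp only: coord_sum coord_simps(5) sum_negf)
    qed
    have R: "coord (?Z (basis_ell2 k)) l = coord (?Z (basis_ell2 l)) k" for k l
    proof -
      have "coord (A (basis_ell2 k)) l = coord (A (basis_ell2 l)) k"
        using gen block_jacobi_entry_sym[of g c p q k l] by (simp add: generating_coeffs_def entry_op_def)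
      thus ?thesis by simp
    qed
    show "?Z (D' (basis_ell2 m)) = ?W (basis_ell2 m)"
    proof (rule ell2_eqI)
      fix n
      let ?u = "\<lambda>j s. coord (basis_ell2 n) (?pos j s)"
      have "?Z (D' (basis_ell2 m)) = (\<Sum>i\<in>{-1..1}. \<Sum>s\<le>g. scale_ell2 (- d b i s) (?Z (basis_ell2 (?pos (a + i) s))))"
        unfolding D'm by (simp only: bounded_op_simps(3,4)[OF Z])
      hence "coord (?Z (D' (basis_ell2 m))) n =
          (\<Sum>i\<in>{-1..1}. \<Sum>s\<le>g. - d b i s * coord (?Z (basis_ell2 (?pos (a + i) s))) n)"
        by (simp only: coord_sum coord_simps(5))
      also have "\<dots> = (\<Sum>i\<in>{-1..1}. \<Sum>s\<le>g. - d b i s * resid g c p q z ?u (a + i) s)"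
        by (intro sum.cong refl arg_cong2[of _ _ _ _ "(*)"], subst R, rule coord_resolvent_op[OF A gen]) auto
      also have "\<dots> = - (?u (a + 1) b + ?u (a - 1) b - ?t * ?u a b)"
        unfolding d[OF m(1), of ?u a] by (simp only: sum_negf mult_minus_left)
      also have "\<dots> = coord (?W (basis_ell2 n)) m" unfolding m(2) coordW by simp
      also have "\<dots> = coord (?W (basis_ell2 m)) n"
        by (simp only: coord_diff coord_simps coord_sel_shift if_True) auto
      finally show "coord (?Z (D' (basis_ell2 m))) n = coord (?W (basis_ell2 m)) n" .
    qed
  qed
  obtain V where V: "bounded_op V" "\<And>x. V (?W x) = x" "\<And>x. ?W (V x) = x"
    using invertible_op_obtain[OF invertible_op_laplacian[OF tr, of N]] by blast
  show ?thesis
  proof (rule invertible_opI[OF Z])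
    show "bounded_op (\<lambda>x. V (D x))" using V(1) bD(1) by (rule bounded_op_comp)
    show "bounded_op (\<lambda>x. D' (V x))" using bD(2) V(1) by (rule bounded_op_comp)
    show "V (D (?Z x)) = x" for x unfolding DZ by (rule V(2))
    show "?Z (D' (V x)) = x" for x using fun_cong[OF ZD', of "V x"] V(3)[of x] by (rule trans)
  qed
qed

lemma resid_truncation:
  fixes \<iota> :: "int \<Rightarrow> complex"
  shows "resid g c p q z (\<lambda>j s. \<iota> j * u j s) j r = \<iota> j * resid g c p q z u j r +
    of_real (p r) * (\<iota> j - \<iota> (j - 1)) * u (j - 1) g +
    (if r = g then (\<iota> j - \<iota> (j + 1)) * (\<Sum>s\<le>g. of_real (p s) * u (j + 1) s) else 0)"
proof -
  have *: "(\<Sum>s\<le>g. of_real (f s) * (\<iota> k * u k s)) = \<iota> k * (\<Sum>s\<le>g. of_real (f s) * u k s)" for f k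
    by (simp add: sum_distrib_left mult.left_commute)
  show ?thesis unfolding resid_def * by (simp add: algebra_simps)
qed

text \<open>
  Truncations of a bounded solution: their norms are unbounded, while \<open>z - A\<close> maps them to vectors
  supported near the two ends of the truncation, of bounded norm.
\<close>

lemma periodic_not_invertible:
  assumes A: "bounded_op A" and gen: "generating_coeffs g c (\<lambda>_. p) (\<lambda>_. q) A"
    and z: "z \<notin> (\<lambda>j. complex_of_real (c j)) ` {1..g}"
    and tr: "trace (monodromy g c p q z) \<in> complex_of_real ` {-2..2}"
  shows "\<not> invertible_op (\<lambda>x. scale_ell2 z x - A x)"
proof
  let ?pos = "block_index g"
  let ?Z = "\<lambda>x. scale_ell2 z x - A x"
  assume "invertible_op ?Z"
  then obtain R where R: "bounded_op R" "\<And>x. R (?Z x) = x" by (rule invertible_op_obtain) (rule that)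
  obtain \<kappa> where \<kappa>: "\<kappa> > 0" "\<And>x. norm (R x) \<le> \<kappa> * norm x" by (rule bounded_op_bound[OF R(1)]) blast
  have p: "p g \<noteq> 0" using gen by (force simp: generating_coeffs_def)
  have zc: "z \<noteq> of_real (c (r + 1))" if "r < g" for r using z that by force
  obtain \<mu> w where \<mu>: "cmod \<mu> = 1" and ex: "\<exists>r\<le>g. w r \<noteq> 0"
    and res: "\<And>j r. r \<le> g \<Longrightarrow> resid g c p q z (\<lambda>j r. \<mu> powi j * w r) j r = 0"
    by (rule floquet_solution[of p g z c q, OF p zc tr]) (assumption, rule that)
  obtain r0 where r0: "r0 \<le> g" "w r0 \<noteq> 0" using ex by blast
  define u where "u = (\<lambda>j r. \<mu> powi j * w r)"
  have \<mu>j: "cmod (\<mu> powi j) = 1" for j using \<mu> by (simp add: norm_power_int)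
  define C where "C = (\<Sum>r\<le>g. \<bar>p r\<bar>) * cmod (w g) + (\<Sum>s\<le>g. \<bar>p s\<bar> * cmod (w s))"
  have C0: "C \<ge> 0" unfolding C_def by (intro add_nonneg_nonneg mult_nonneg_nonneg sum_nonneg) auto
  define b where "b = sqrt (4 * (real g + 1)) * C"
  have b0: "b \<ge> 0" using C0 by (simp add: b_def)
  \<comment> \<open>The truncation to the blocks \<open>0, \<dots>, K - 1\<close>.\<close>
  have main: "real K * (cmod (w r0))\<^sup>2 \<le> (\<kappa> * b)\<^sup>2" for K :: nat
  proof -
    define x where "x = (\<Sum>j\<in>{0..<int K}. \<Sum>r\<le>g. scale_ell2 (u j r) (basis_ell2 (?pos j r)))"
    define \<iota> where "\<iota> = (\<lambda>j. if j \<in> {0..<int K} then 1 else 0 :: complex)"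
    have coordx: "coord x (?pos j r) = \<iota> j * u j r" if r: "r \<le> g" for j r
    proof -
      have "(\<Sum>s\<le>g. u i s * coord (basis_ell2 (?pos i s)) (?pos j r)) = (if i = j then u j r else 0)" for i
      proof -
        have "(\<Sum>s\<le>g. u i s * coord (basis_ell2 (?pos i s)) (?pos j r)) =
            (\<Sum>s\<le>g. if s = r then (if i = j then u j r else 0) else 0)"
          by (intro sum.cong refl) (auto simp: block_index_eq_iff[OF r])
        thus ?thesis using r by simp
      qed
      hence "coord x (?pos j r) = (\<Sum>i\<in>{0..<int K}. if i = j then u j r else 0)"
        unfolding x_def coord_sum coord_simps(5) by (intro sum.cong refl)
      thus ?thesis by (simp add: \<iota>_def)
    qed
    have resx: "coord (?Z x) (?pos j r) = of_real (p r) * (\<iota> j - \<iota> (j - 1)) * u (j - 1) g +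
        (if r = g then (\<iota> j - \<iota> (j + 1)) * (\<Sum>s\<le>g. of_real (p s) * u (j + 1) s) else 0)"
      if r: "r \<le> g" for j r
    proof -
      have "coord (?Z x) (?pos j r) = resid g c p q z (\<lambda>j s. coord x (?pos j s)) j r"
        by (rule coord_resolvent_op[OF A gen r])
      also have "\<dots> = resid g c p q z (\<lambda>j s. \<iota> j * u j s) j r"
        unfolding resid_def using r by (simp add: coordx)
      finally show ?thesis
        unfolding resid_truncation using res[OF r, of j, folded u_def] by simp
    qed
    define J where "J = {-1, 0, int K - 1, int K}"
    have out: "coord (?Z x) (?pos j r) = 0" if "r \<le> g" "j \<notin> J" for j r
    proof -
      have "\<iota> j - \<iota> (j - 1) = 0" "\<iota> j - \<iota> (j + 1) = 0"
        using that(2) by (auto simp: \<iota>_def J_def)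
      thus ?thesis unfolding resx[OF that(1)] by simp
    qed
    have bd: "cmod (coord (?Z x) (?pos j r)) \<le> C" if r: "r \<le> g" for j r
    proof -
      have \<iota>1: "cmod (\<iota> i - \<iota> k) \<le> 1" for i k by (simp add: \<iota>_def)
      have "cmod (of_real (p r) * (\<iota> j - \<iota> (j - 1)) * u (j - 1) g) \<le> \<bar>p r\<bar> * 1 * cmod (w g)"
        unfolding norm_mult u_def by (intro mult_mono) (auto simp: \<mu>j \<iota>1)
      also have "\<bar>p r\<bar> \<le> (\<Sum>r\<le>g. \<bar>p r\<bar>)" using r by (intro member_le_sum) auto
      hence "\<bar>p r\<bar> * 1 * cmod (w g) \<le> (\<Sum>r\<le>g. \<bar>p r\<bar>) * cmod (w g)"
        by (simp add: mult_right_mono)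
      finally have 1: "cmod (of_real (p r) * (\<iota> j - \<iota> (j - 1)) * u (j - 1) g) \<le> (\<Sum>r\<le>g. \<bar>p r\<bar>) * cmod (w g)" .
      have "cmod (\<Sum>s\<le>g. of_real (p s) * u (j + 1) s) \<le> (\<Sum>s\<le>g. \<bar>p s\<bar> * cmod (w s))"
        by (rule order_trans[OF norm_sum]) (simp add: norm_mult u_def \<mu>j)
      hence "cmod ((\<iota> j - \<iota> (j + 1)) * (\<Sum>s\<le>g. of_real (p s) * u (j + 1) s)) \<le> 1 * (\<Sum>s\<le>g. \<bar>p s\<bar> * cmod (w s))"
        unfolding norm_mult using \<iota>1 by (intro mult_mono) auto
      moreover have "0 \<le> (\<Sum>s\<le>g. \<bar>p s\<bar> * cmod (w s))" by (intro sum_nonneg) auto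
      ultimately have 2: "cmod (if r = g then (\<iota> j - \<iota> (j + 1)) * (\<Sum>s\<le>g. of_real (p s) * u (j + 1) s) else 0)
          \<le> (\<Sum>s\<le>g. \<bar>p s\<bar> * cmod (w s))" by simp
      show ?thesis unfolding resx[OF r] C_def by (rule order_trans[OF norm_triangle_ineq add_mono[OF 1 2]])
    qed
    have "norm (?Z x) \<le> b"
    proof (rule norm_ell2_leI[OF _ b0])
      fix F :: "int set" assume F: "finite F"
      define S where "S = (\<lambda>(j, r). ?pos j r) ` (J \<times> {..g})"
      have S: "finite S" "card S \<le> 4 * (g + 1)"
      proof -
        have "finite J" by (simp add: J_def)
        thus "finite S" by (simp add: S_def)
        have "card S \<le> card (J \<times> {..g})" unfolding S_def using \<open>finite J\<close> by (intro card_image_le) auto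
        also have "\<dots> = card J * (g + 1)" by (simp add: card_cartesian_product)
        also have "card J \<le> 4" unfolding J_def by (simp add: card_insert_if)
        hence "card J * (g + 1) \<le> 4 * (g + 1)" by (rule mult_right_mono) simp
        finally show "card S \<le> 4 * (g + 1)" .
      qed
      have zero: "coord (?Z x) n = 0" if "n \<notin> S" for n
      proof -
        obtain j r where n: "r \<le> g" "n = ?pos j r" by (rule block_index_cases)
        hence "j \<notin> J" using that by (auto simp: S_def)
        thus ?thesis using out n by simp
      qed
      have le: "cmod (coord (?Z x) n) \<le> C" for n
      proof -
        obtain j r where n: "r \<le> g" "n = ?pos j r" by (rule block_index_cases)
        thus ?thesis using bd by simp
      qed
      have "(\<Sum>n\<in>F. (cmod (coord (?Z x) n))\<^sup>2) = (\<Sum>n\<in>F \<inter> S. (cmod (coord (?Z x) n))\<^sup>2)"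
        using F zero by (intro sum.mono_neutral_right) auto
      also have "\<dots> \<le> (\<Sum>n\<in>S. (cmod (coord (?Z x) n))\<^sup>2)"
        using S(1) by (intro sum_mono2) auto
      also have "\<dots> \<le> (\<Sum>n\<in>S. C\<^sup>2)" by (intro sum_mono power_mono le) auto
      also have "\<dots> = real (card S) * C\<^sup>2" by simp
      also have "\<dots> \<le> (4 * (real g + 1)) * C\<^sup>2"
        using of_nat_mono[OF S(2), where 'a = real] by (intro mult_right_mono) (auto simp: algebra_simps)
      also have "\<dots> = b\<^sup>2" by (simp add: b_def power_mult_distrib)
      finally show "(\<Sum>n\<in>F. (cmod (coord (?Z x) n))\<^sup>2) \<le> b\<^sup>2" .
    qed
    hence "norm x \<le> \<kappa> * b"
      using \<kappa>(2)[of "?Z x"] \<kappa>(1) mult_left_mono[of "norm (?Z x)" b \<kappa>] unfolding R(2) by linarith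
    hence "(norm x)\<^sup>2 \<le> (\<kappa> * b)\<^sup>2" by (intro power_mono) auto
    moreover have "real K * (cmod (w r0))\<^sup>2 \<le> (norm x)\<^sup>2"
    proof -
      have inj: "inj_on (\<lambda>j. ?pos j r0) {0..<int K}"
        by (rule inj_onI) (simp add: block_index_eq_iff[OF r0(1) r0(1)])
      have "(\<Sum>n\<in>(\<lambda>j. ?pos j r0) ` {0..<int K}. (cmod (coord x n))\<^sup>2) =
          (\<Sum>j\<in>{0..<int K}. (cmod (w r0))\<^sup>2)"
        unfolding sum.reindex[OF inj] o_def
        by (intro sum.cong refl) (simp add: coordx[OF r0(1)] \<iota>_def u_def norm_mult \<mu>j)
      thus ?thesis using sum_coord_le_norm[of "(\<lambda>j. ?pos j r0) ` {0..<int K}" x] by simp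
    qed
    ultimately show ?thesis by linarith
  qed
  have "(cmod (w r0))\<^sup>2 > 0" using r0(2) by simp
  then obtain K :: nat where "real K * (cmod (w r0))\<^sup>2 > (\<kappa> * b)\<^sup>2"
    using reals_Archimedean3 by blast
  thus False using main[of K] by simp
qed

section \<open>Periodic GMP matrices with a given spectrum\<close>

lemma spectrum_off_poles:
  assumes "bounded_op A" "generating_coeffs g c (\<lambda>_. p) (\<lambda>_. q) A"
    and "z \<notin> (\<lambda>j. complex_of_real (c j)) ` {1..g}"
  shows "z \<in> spectrum_op A \<longleftrightarrow> trace (monodromy g c p q z) \<in> complex_of_real ` {-2..2}"
  using periodic_invertible[OF assms] periodic_not_invertible[OF assms]
  unfolding spectrum_op_def by blast

theorem theorem1p10:
  fixes g :: nat and E :: "real set" and \<Psi> :: "complex \<Rightarrow> complex"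
    and c lam :: "nat \<Rightarrow> real" and c\<^sub>0 :: real
    and A :: "ell2 \<Rightarrow> ell2" and p q :: "nat \<Rightarrow> real"
  assumes "g \<ge> 1" and "finite_gap_set g E"
    and "ahlfors_function E \<Psi>"
    and "bij_betw (\<lambda>j. complex_of_real (c j)) {1..g} {z. z \<notin> of_real ` E \<and> \<Psi> z = 0}"
    and "\<And>z. z \<notin> of_real ` E \<Longrightarrow> \<Psi> z \<noteq> 0 \<Longrightarrow>
           Delta \<Psi> z = of_real (lam 0) * z + of_real c\<^sub>0 +
             (\<Sum>j=1..g. of_real (lam j) / (of_real (c j) - z))"
    and "A \<in> GMP g c"
    and "generating_coeffs g c (\<lambda>_. p) (\<lambda>_. q) A"
  shows "A \<in> isospectral_GMP E g c \<longleftrightarrow>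
           p g = 1 / lam 0 \<and>
           q g = - c\<^sub>0 - lam 0 * (\<Sum>j<g. p j * q j) \<and>
           (\<forall>k\<in>{1..g}. Lambda g c k p q = lam k)"
proof -
  let ?C = "(\<lambda>j. complex_of_real (c j)) ` {1..g}"
  let ?E = "complex_of_real ` E"
  let ?cut = "complex_of_real ` {-2..2}"
  define D where "D = partial_fractions g c (lam 0) c\<^sub>0 lam"
  define DA where "DA = partial_fractions g c (1 / p g)
    (- q g - 1 / p g * (\<Sum>j<g. p j * q j)) (\<lambda>k. Lambda g c k p q)"
  have E: "compact E" by (rule finite_gap_compact[OF assms(2)])
  have E0: "E \<noteq> {}" by (rule finite_gap_nonempty[OF assms(2)])
  have CZ: "?C = {z. z \<notin> ?E \<and> \<Psi> z = 0}" using assms(4) by (rule bij_betw_imp_surj_on)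
  have Cdisj: "?C \<inter> ?E = {}" and C\<Psi>: "\<And>z. z \<in> ?C \<Longrightarrow> \<Psi> z = 0" unfolding CZ by auto
  have inj: "inj_on c {1..g}"
  proof (rule inj_onI)
    fix i j assume "i \<in> {1..g}" "j \<in> {1..g}" "c i = c j"
    thus "i = j" by (intro inj_onD[OF bij_betw_imp_inj_on[OF assms(4)]]) simp_all
  qed
  have D: "D z = \<Psi> z + 1 / \<Psi> z" if "z \<notin> ?E" "\<Psi> z \<noteq> 0" for z
    unfolding D_def partial_fractions_def by (rule assms(5)[OF that, unfolded Delta_def, symmetric])
  have gmp: "A \<in> class_A g c" "\<And>k. k \<in> {1..g} \<Longrightarrow> invertible_op (\<lambda>x. c k *\<^sub>R x - A x)"
    using assms(6) by (auto simp: GMP_def)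
  have A: "bounded_op A" using gmp(1) by (simp add: class_A_def)
  have pg: "p g > 0" using assms(7) by (simp add: generating_coeffs_def)
  have poles: "z \<notin> spectrum_op A" if "z \<in> ?C" for z
    using gmp(2) that by (auto simp: spectrum_op_def scaleR_eq_scale_ell2)
  have spec: "z \<in> spectrum_op A \<longleftrightarrow> DA z \<in> ?cut" if "z \<notin> ?C" for z
    using spectrum_off_poles[OF A assms(7) that] trace_monodromy[OF inj that] pg
    by (simp add: DA_def)
  have member: "A \<in> isospectral_GMP E g c \<longleftrightarrow> spectrum_op A = ?E"
    using assms(6,7) by (auto simp: isospectral_GMP_def periodic_GMP_def)
  show ?thesis
  proof
    assume "A \<in> isospectral_GMP E g c"
    hence sp: "spectrum_op A = ?E" using member by simp
    have \<Psi>: "\<Psi> z = joukowski_inv (DA z)" if "z \<notin> ?E" "z \<notin> ?C" for z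
    proof (rule ahlfors_eq_joukowski_inv[OF E E0 assms(3) _ Cdisj _ _ C\<Psi> _ _ _ _ that])
      show "finite ?C" by simp
      show "DA holomorphic_on - ?C" unfolding DA_def by (rule holomorphic_partial_fractions)
      show "\<exists>B. eventually (\<lambda>z. cmod ((z - c') * DA z) \<le> B) (at c')" if c': "c' \<in> ?C" for c'
      proof -
        obtain k where k: "k \<in> {1..g}" "c' = of_real (c k)" using c' by blast
        have "((\<lambda>z. cmod ((z - c') * DA z)) \<longlongrightarrow> cmod (- of_real (Lambda g c k p q))) (at c')"
          unfolding k(2) DA_def by (intro tendsto_norm partial_fractions_residue inj k(1))
        hence "eventually (\<lambda>z. cmod ((z - c') * DA z) < cmod (- of_real (Lambda g c k p q)) + 1) (at c')"
          by (rule order_tendstoD(2)) simp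
        thus ?thesis by (intro exI) (erule eventually_mono, erule less_imp_le)
      qed
      show "((\<lambda>z. DA z / z) \<longlongrightarrow> of_real (1 / p g)) at_infinity"
        unfolding DA_def by (rule partial_fractions_leading)
      show "1 / p g > 0" using pg by simp
      show "DA z \<notin> ?cut" if "z \<notin> ?E" "z \<notin> ?C" for z
        using spec[OF that(2)] that(1) sp by simp
      show "DA z \<in> ?cut" if "z \<in> ?E" for z
      proof -
        have "z \<notin> ?C" using that Cdisj by blast
        thus ?thesis using spec that sp by simp
      qed
    qed
    have eq: "DA z = D z" if "z \<notin> ?E" "z \<notin> ?C" for z
    proof -
      have "DA z \<notin> ?cut" using spec[OF that(2)] that(1) sp by simp
      note w = joukowski_inv[OF this, folded \<Psi>[OF that]]
      show ?thesis using D[OF that(1) w(1)] w(3) by simp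
    qed
    have op: "open (- (?E \<union> ?C) \<union> {z})" if "z \<in> ?C" for z
    proof -
      have eq: "- (?E \<union> ?C) \<union> {z} = - ?E - (?C - {z})" using that Cdisj by blast
      show ?thesis
        unfolding eq by (intro open_Diff open_compl_real[OF E] finite_imp_closed) simp
    qed
    have inf: "eventually (\<lambda>z. DA z = D z) at_infinity"
    proof -
      have "bounded ?C" by (rule finite_imp_bounded) simp
      then obtain B where B: "\<And>z. z \<in> ?C \<Longrightarrow> norm z \<le> B" unfolding bounded_iff by blast
      have "eventually (\<lambda>z::complex. norm z \<ge> B + 1) at_infinity" by (auto simp: eventually_at_infinity)
      with eventually_compl_real[OF E] show ?thesis
      proof eventually_elim
        case (elim z)
        have "z \<notin> ?C" using B[of z] elim(2) by fastforce
        thus ?case using eq elim(1) by simp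
      qed
    qed
    have pole: "eventually (\<lambda>z. DA z = D z) (at (of_real (c k)))" if k: "k \<in> {1..g}" for k
    proof -
      have ck: "complex_of_real (c k) \<in> ?C" using k by blast
      have "eventually (\<lambda>z. z \<in> - (?E \<union> ?C) \<union> {of_real (c k)}) (at (complex_of_real (c k)))"
        using op[OF ck] by (rule eventually_at_in_open') simp
      thus ?thesis
        using eventually_neq_at_within[of "complex_of_real (c k)" "complex_of_real (c k)" UNIV]
        by eventually_elim (use eq in blast)
    qed
    note uniq = partial_fractions_unique[OF inj inf[unfolded DA_def D_def] pole[unfolded DA_def D_def]]
    have 1: "1 / p g = lam 0" by (rule uniq(1))
    have 2: "- q g - 1 / p g * (\<Sum>j<g. p j * q j) = c\<^sub>0" by (rule uniq(2))
    have 3: "Lambda g c k p q = lam k" if "k \<in> {1..g}" for k using uniq(3)[of k] that by simp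
    have "p g = 1 / lam 0" unfolding 1[symmetric] by simp
    moreover have "q g = - c\<^sub>0 - lam 0 * (\<Sum>j<g. p j * q j)" using 2 unfolding 1 by simp
    ultimately show "p g = 1 / lam 0 \<and> q g = - c\<^sub>0 - lam 0 * (\<Sum>j<g. p j * q j) \<and>
           (\<forall>k\<in>{1..g}. Lambda g c k p q = lam k)" using 3 by blast
  next
    assume asm: "p g = 1 / lam 0 \<and> q g = - c\<^sub>0 - lam 0 * (\<Sum>j<g. p j * q j) \<and>
           (\<forall>k\<in>{1..g}. Lambda g c k p q = lam k)"
    have DA: "DA z = D z" for z
    proof -
      have "1 / p g = lam 0" using asm by simp
      moreover have "- q g - lam 0 * (\<Sum>j<g. p j * q j) = c\<^sub>0" using asm by simp
      moreover have "(\<Sum>j=1..g. of_real (Lambda g c j p q) / (of_real (c j) - z)) =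
          (\<Sum>j=1..g. of_real (lam j) / (of_real (c j) - z))" using asm by simp
      ultimately show ?thesis by (simp only: DA_def D_def partial_fractions_def)
    qed
    have "z \<in> spectrum_op A \<longleftrightarrow> z \<in> ?E" for z
    proof (cases "z \<in> ?C")
      case True
      thus ?thesis using poles Cdisj by blast
    next
      case False
      have "D z \<in> ?cut \<longleftrightarrow> z \<in> ?E"
      proof
        assume "D z \<in> ?cut"
        show "z \<in> ?E"
        proof (rule ccontr)
          assume zE: "z \<notin> ?E"
          hence nz: "\<Psi> z \<noteq> 0" using False CZ by blast
          have "D z \<notin> ?cut"
            unfolding D[OF zE nz] by (rule joukowski_not_cut[OF nz ahlfors_lt_1[OF E assms(3) zE]])
          thus False using \<open>D z \<in> ?cut\<close> by simp
        qed
      next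
        assume "z \<in> ?E"
        then obtain x where x: "x \<in> E" "z = of_real x" by blast
        have "isCont D (of_real y)" if "y \<in> E" for y
        proof -
          have op: "open (- ?C)" by (intro open_Compl finite_imp_closed) simp
          have "continuous_on (- ?C) D"
            unfolding D_def by (intro holomorphic_on_imp_continuous_on holomorphic_partial_fractions)
          moreover have "of_real y \<in> - ?C" using Cdisj that by blast
          ultimately show ?thesis using continuous_on_eq_continuous_at[OF op] by blast
        qed
        thus "D z \<in> ?cut" unfolding x(2) by (rule ahlfors_delta_on_bands[OF assms(2,3) _ D x(1)])
      qed
      thus ?thesis using spec[OF False] DA by simp
    qed
    hence "spectrum_op A = ?E" by blast
    thus "A \<in> isospectral_GMP E g c" using member by simp
  qed
qed

end
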